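(* In the online bipartite matching problem with replacements (servers $S$ given in advance; clients arriving one at a time with all their incident edges), there is an implementation of the SAP protocol whose total running time over the whole sequence of insertions is $O(m\sqrt{n}\sqrt{\log n})$, where $n$ is the total number of clients and $m$ is the total number of edges in the final graph.
   Context: The SAP protocol: when a client $c$ arrives, if there is an augmenting path (with respect to the current matching) from $c$ to an unmatched server, augment along a shortest such path (ties broken arbitrarily); otherwise do nothing. An augmenting path is a path alternating between unmatched and matched edges, starting and ending at unmatched vertices; augmenting flips the matched status of its edges.
   Formalization: The time bound is proved for n ≥ 2 and n ≤ m (as when every client has an edge); without this it fails, since n clients with no edges cost at least n steps while the bound is 0, and log n = 0 for n = 1. That the program follows SAP is proved for all instances. *)

theory Defs
  imports Complex_Main
begin

section \<open>Augmenting paths and the SAP protocol\<close>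

text \<open>Undirected edges are two-element sets; graphs and matchings are sets of edges.\<close>

definition is_path :: "'v set set \<Rightarrow> 'v list \<Rightarrow> bool" where
  "is_path E p \<longleftrightarrow>
     p \<noteq> [] \<and> distinct p \<and> (\<forall>k. Suc k < length p \<longrightarrow> {p ! k, p ! Suc k} \<in> E)"

definition path_edges :: "'v list \<Rightarrow> 'v set set" where
  "path_edges p = {{p ! k, p ! Suc k} | k. Suc k < length p}"

definition unmatched :: "'v set set \<Rightarrow> 'v \<Rightarrow> bool" where
  "unmatched M v \<longleftrightarrow> v \<notin> \<Union>M"

definition alternating :: "'v set set \<Rightarrow> 'v list \<Rightarrow> bool" where
  "alternating M p \<longleftrightarrow>
     (\<forall>k. Suc (Suc k) < length p \<longrightarrow>
        ({p ! k, p ! Suc k} \<in> M \<longleftrightarrow> {p ! Suc k, p ! Suc (Suc k)} \<notin> M))"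

definition augmenting_path :: "'v set set \<Rightarrow> 'v set set \<Rightarrow> 'v list \<Rightarrow> bool" where
  "augmenting_path E M p \<longleftrightarrow>
     is_path E p \<and> 2 \<le> length p \<and> alternating M p \<and> unmatched M (hd p) \<and> unmatched M (last p)"

definition augment :: "'v set set \<Rightarrow> 'v list \<Rightarrow> 'v set set" where
  "augment M p = sym_diff M (path_edges p)"

datatype vertex = Client nat | Server nat

definition augmenting_from ::
  "vertex set set \<Rightarrow> vertex set set \<Rightarrow> nat \<Rightarrow> vertex list \<Rightarrow> bool" where
  "augmenting_from E M c p \<longleftrightarrow>
     augmenting_path E M p \<and> hd p = Client c \<and> (\<exists>v. last p = Server v)"

text \<open>
  \<open>sap_step E M c M'\<close>: on arrival of client \<open>c\<close>, where \<open>E\<close> already contains the edges of \<open>c\<close>, the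
  protocol may replace the matching \<open>M\<close> by \<open>M'\<close>. It is a relation because ties between shortest
  paths are broken arbitrarily.
\<close>

definition sap_step ::
  "vertex set set \<Rightarrow> vertex set set \<Rightarrow> nat \<Rightarrow> vertex set set \<Rightarrow> bool" where
  "sap_step E M c M' \<longleftrightarrow>
     (if \<exists>p. augmenting_from E M c p
      then \<exists>p. is_arg_min length (augmenting_from E M c) p \<and> M' = augment M p
      else M' = M)"

section \<open>Online instances\<close>

text \<open>
  The servers are \<open>0, \<dots>, s - 1\<close>, and the clients are numbered \<open>0, 1, \<dots>\<close> in order of arrival;
  \<open>Ns ! c\<close> lists the neighbours of client \<open>c\<close>, in arbitrary order.
\<close>

definition online_instance :: "nat \<Rightarrow> nat list list \<Rightarrow> bool" where
  "online_instance s Ns \<longleftrightarrow> (\<forall>N \<in> set Ns. distinct N \<and> set N \<subseteq> {..<s})"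

definition graph_of :: "nat list list \<Rightarrow> vertex set set" where
  "graph_of Ns = {{Client c, Server v} | c v. c < length Ns \<and> v \<in> set (Ns ! c)}"

section \<open>A word RAM\<close>

text \<open>
  Programs of a while language over finitely many registers and finitely many word-addressed arrays,
  with unit cost for each arithmetic operation, comparison, memory access and control step. With
  words of \<open>w\<close> bits every computed value has to be below \<open>2 ^ w\<close>: an execution that overflows is
  stuck.
\<close>

datatype binop = Add | Sub | Mul | Div | Mod

fun binop_val :: "binop \<Rightarrow> nat \<Rightarrow> nat \<Rightarrow> nat" where
  "binop_val Add x y = x + y"
| "binop_val Sub x y = x - y"
| "binop_val Mul x y = x * y"
| "binop_val Div x y = x div y"
| "binop_val Mod x y = x mod y"

datatype aexp =
    Const nat
  | Reg string
  | Load string aexp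
  | BinOp binop aexp aexp

datatype bexp =
    Less aexp aexp
  | Equal aexp aexp
  | Neg bexp
  | Conj bexp bexp

datatype com =
    Skip
  | Assign string aexp
  | Store string aexp aexp
  | Seq com com
  | Cond bexp com com
  | While bexp com

record state =
  regs :: "string \<Rightarrow> nat"
  arrs :: "string \<Rightarrow> nat \<Rightarrow> nat"

fun aval :: "aexp \<Rightarrow> state \<Rightarrow> nat" where
  "aval (Const k) \<sigma> = k"
| "aval (Reg x) \<sigma> = regs \<sigma> x"
| "aval (Load a e) \<sigma> = arrs \<sigma> a (aval e \<sigma>)"
| "aval (BinOp f e e') \<sigma> = binop_val f (aval e \<sigma>) (aval e' \<sigma>)"

fun acost :: "aexp \<Rightarrow> nat" where
  "acost (Const k) = 1"
| "acost (Reg x) = 1"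
| "acost (Load a e) = 1 + acost e"
| "acost (BinOp f e e') = 1 + acost e + acost e'"

fun afits :: "nat \<Rightarrow> aexp \<Rightarrow> state \<Rightarrow> bool" where
  "afits w (Const k) \<sigma> \<longleftrightarrow> k < 2 ^ w"
| "afits w (Reg x) \<sigma> \<longleftrightarrow> regs \<sigma> x < 2 ^ w"
| "afits w (Load a e) \<sigma> \<longleftrightarrow> afits w e \<sigma> \<and> aval (Load a e) \<sigma> < 2 ^ w"
| "afits w (BinOp f e e') \<sigma> \<longleftrightarrow> afits w e \<sigma> \<and> afits w e' \<sigma> \<and> aval (BinOp f e e') \<sigma> < 2 ^ w"

fun bval :: "bexp \<Rightarrow> state \<Rightarrow> bool" where
  "bval (Less e e') \<sigma> \<longleftrightarrow> aval e \<sigma> < aval e' \<sigma>"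
| "bval (Equal e e') \<sigma> \<longleftrightarrow> aval e \<sigma> = aval e' \<sigma>"
| "bval (Neg b) \<sigma> \<longleftrightarrow> \<not> bval b \<sigma>"
| "bval (Conj b b') \<sigma> \<longleftrightarrow> bval b \<sigma> \<and> bval b' \<sigma>"

fun bcost :: "bexp \<Rightarrow> nat" where
  "bcost (Less e e') = 1 + acost e + acost e'"
| "bcost (Equal e e') = 1 + acost e + acost e'"
| "bcost (Neg b) = 1 + bcost b"
| "bcost (Conj b b') = 1 + bcost b + bcost b'"

fun bfits :: "nat \<Rightarrow> bexp \<Rightarrow> state \<Rightarrow> bool" where
  "bfits w (Less e e') \<sigma> \<longleftrightarrow> afits w e \<sigma> \<and> afits w e' \<sigma>"
| "bfits w (Equal e e') \<sigma> \<longleftrightarrow> afits w e \<sigma> \<and> afits w e' \<sigma>"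
| "bfits w (Neg b) \<sigma> \<longleftrightarrow> bfits w b \<sigma>"
| "bfits w (Conj b b') \<sigma> \<longleftrightarrow> bfits w b \<sigma> \<and> bfits w b' \<sigma>"

text \<open>\<open>exec w P \<sigma> t \<sigma>'\<close>: with \<open>w\<close>-bit words, \<open>P\<close> takes \<open>\<sigma>\<close> to \<open>\<sigma>'\<close> in time \<open>t\<close>.\<close>

inductive exec :: "nat \<Rightarrow> com \<Rightarrow> state \<Rightarrow> nat \<Rightarrow> state \<Rightarrow> bool" for w :: nat where
  Skip: "exec w Skip \<sigma> 1 \<sigma>"
| Assign: "afits w e \<sigma> \<Longrightarrow>
    exec w (Assign x e) \<sigma> (1 + acost e) (\<sigma>\<lparr>regs := (regs \<sigma>)(x := aval e \<sigma>)\<rparr>)"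
| Store: "afits w i \<sigma> \<Longrightarrow> afits w e \<sigma> \<Longrightarrow>
    exec w (Store a i e) \<sigma> (1 + acost i + acost e)
      (\<sigma>\<lparr>arrs := (arrs \<sigma>)(a := (arrs \<sigma> a)(aval i \<sigma> := aval e \<sigma>))\<rparr>)"
| Seq: "exec w P \<sigma> t \<sigma>' \<Longrightarrow> exec w Q \<sigma>' t' \<sigma>'' \<Longrightarrow> exec w (Seq P Q) \<sigma> (t + t') \<sigma>''"
| CondTrue: "bfits w b \<sigma> \<Longrightarrow> bval b \<sigma> \<Longrightarrow> exec w P \<sigma> t \<sigma>' \<Longrightarrow>
    exec w (Cond b P Q) \<sigma> (1 + bcost b + t) \<sigma>'"
| CondFalse: "bfits w b \<sigma> \<Longrightarrow> \<not> bval b \<sigma> \<Longrightarrow> exec w Q \<sigma> t \<sigma>' \<Longrightarrow>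
    exec w (Cond b P Q) \<sigma> (1 + bcost b + t) \<sigma>'"
| WhileFalse: "bfits w b \<sigma> \<Longrightarrow> \<not> bval b \<sigma> \<Longrightarrow> exec w (While b P) \<sigma> (1 + bcost b) \<sigma>"
| WhileTrue: "bfits w b \<sigma> \<Longrightarrow> bval b \<sigma> \<Longrightarrow> exec w P \<sigma> t \<sigma>' \<Longrightarrow> exec w (While b P) \<sigma>' t' \<sigma>'' \<Longrightarrow>
    exec w (While b P) \<sigma> (1 + bcost b + t + t') \<sigma>''"

inductive_cases exec_SkipE: "exec w Skip \<sigma> t \<sigma>'"
inductive_cases exec_AssignE: "exec w (Assign x e) \<sigma> t \<sigma>'"
inductive_cases exec_StoreE: "exec w (Store a i e) \<sigma> t \<sigma>'"
inductive_cases exec_SeqE: "exec w (Seq P Q) \<sigma> t \<sigma>'"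
inductive_cases exec_CondE: "exec w (Cond b P Q) \<sigma> t \<sigma>'"
inductive_cases exec_WhileE: "exec w (While b P) \<sigma> t \<sigma>'"

lemma exec_deterministic:
  "exec w P \<sigma> t \<sigma>' \<Longrightarrow> exec w P \<sigma> u \<sigma>'' \<Longrightarrow> u = t \<and> \<sigma>'' = \<sigma>'"
proof (induction arbitrary: u \<sigma>'' rule: exec.induct)
  case (Skip \<sigma>)
  then show ?case by (rule exec_SkipE) simp
next
  case (Assign e \<sigma> x)
  from Assign.prems show ?case by (rule exec_AssignE) simp
next
  case (Store i \<sigma> e a)
  from Store.prems show ?case by (rule exec_StoreE) simp
next
  case (Seq P \<sigma> t \<sigma>' Q t' \<rho>)
  from Seq.prems show ?case
  proof (rule exec_SeqE)
    fix t1 \<sigma>1 t2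
    assume *: "u = t1 + t2" "exec w P \<sigma> t1 \<sigma>1" "exec w Q \<sigma>1 t2 \<sigma>''"
    from Seq.IH(1)[OF *(2)] *(3) have "exec w Q \<sigma>' t2 \<sigma>''" by simp
    from Seq.IH(2)[OF this] Seq.IH(1)[OF *(2)] *(1) show ?thesis by simp
  qed
next
  case (CondTrue b \<sigma> P t \<sigma>' Q)
  from CondTrue.prems show ?case
    by (rule exec_CondE) (use CondTrue.hyps in \<open>auto dest: CondTrue.IH\<close>)
next
  case (CondFalse b \<sigma> Q t \<sigma>' P)
  from CondFalse.prems show ?case
    by (rule exec_CondE) (use CondFalse.hyps in \<open>auto dest: CondFalse.IH\<close>)
next
  case (WhileFalse b \<sigma> P)
  from WhileFalse.prems show ?case
    by (rule exec_WhileE) (use WhileFalse.hyps in simp_all)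
next
  case (WhileTrue b \<sigma> P t \<sigma>' t' \<rho>)
  from WhileTrue.prems show ?case
  proof cases
    case WhileFalse
    with WhileTrue.hyps show ?thesis by simp
  next
    case step: (WhileTrue t1 \<sigma>1 t2)
    from WhileTrue.IH(1)[OF step(4)] step(5) have "exec w (While b P) \<sigma>' t2 \<sigma>''" by simp
    from WhileTrue.IH(2)[OF this] WhileTrue.IH(1)[OF step(4)] step(1) show ?thesis by simp
  qed
qed

section \<open>Implementations of SAP\<close>

text \<open>
  One program handles every arrival. Initially the memory is zero, apart from the number of servers;
  on an arrival the environment writes the degree and the neighbours of the new client. The number
  of clients and the later arrivals are unknown to the program.
\<close>

definition initial_state :: "nat \<Rightarrow> state" where
  "initial_state s = \<lparr>regs = (\<lambda>_. 0)(''servers'' := s), arrs = (\<lambda>_ _. 0)\<rparr>"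

definition arrival :: "nat list \<Rightarrow> state \<Rightarrow> state" where
  "arrival N \<sigma> =
     \<sigma>\<lparr>regs := (regs \<sigma>)(''degree'' := length N),
       arrs := (arrs \<sigma>)(''neighbours'' :=
         (\<lambda>k. if k < length N then N ! k else arrs \<sigma> ''neighbours'' k))\<rparr>"

text \<open>
  \<open>\<sigma> i\<close> is the memory after the first \<open>i\<close> insertions and \<open>\<tau> i\<close> is the time spent on inserting
  client \<open>i\<close>.
\<close>

definition online_run ::
  "nat \<Rightarrow> com \<Rightarrow> nat \<Rightarrow> nat list list \<Rightarrow> (nat \<Rightarrow> state) \<Rightarrow> (nat \<Rightarrow> nat) \<Rightarrow> bool" where
  "online_run w P s Ns \<sigma> \<tau> \<longleftrightarrow>
     \<sigma> 0 = initial_state s \<and>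
     (\<forall>i < length Ns. exec w P (arrival (Ns ! i) (\<sigma> i)) (\<tau> i) (\<sigma> (Suc i)))"

text \<open>
  The current matching is kept explicitly in an array: the entry of a client is \<open>0\<close> if the client is
  unmatched, and \<open>Suc v\<close> if it is matched to server \<open>v\<close>.
\<close>

definition matching_of :: "nat \<Rightarrow> state \<Rightarrow> vertex set set" where
  "matching_of i \<sigma> = {{Client c, Server v} | c v. c < i \<and> arrs \<sigma> ''match'' c = Suc v}"

definition follows_sap :: "nat list list \<Rightarrow> (nat \<Rightarrow> state) \<Rightarrow> bool" where
  "follows_sap Ns \<sigma> \<longleftrightarrow>
     (\<forall>i < length Ns.
        sap_step (graph_of (take (Suc i) Ns))
          (matching_of i (\<sigma> i)) i (matching_of (Suc i) (\<sigma> (Suc i))))"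

end

theory Submission
  imports Defs "HOL-Library.Extended_Nat"
begin

text \<open>
  The distance of a client is the number of matched edges on a shortest alternating walk to a free
  server. Augmenting along shortest paths never decreases a distance, so the program keeps a lower
  bound for it, the label of the client. A depth-first search from the new client only enters
  clients with smaller label; a client whose neighbours are exhausted has its label increased. A
  path found in this way has strictly decreasing labels and is therefore shortest. With a current
  arc for every client, each label value costs at most one scan of the adjacency list, so that the
  searches cost \<open>O(m K)\<close> in total if labels are raised only up to \<open>K\<close>. When the label of the new
  client exceeds the number \<open>B\<close> of successful breadth-first searches made so far, a breadth-first
  search is made instead. If it fails, the clients it reached never reach a free server again and
  are given the label \<open>s\<close> (distances are below \<open>s\<close>); if it succeeds, \<open>B\<close> is increased. The total
  time is \<open>O(m (B + 1))\<close>.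

  It remains to bound \<open>B\<close>. For a set \<open>T\<close> of matched clients let
  \<open>g T = card (N(T)) - (1 + \<epsilon>) * card T\<close>. If the new client has distance at least \<open>h\<close> and
  \<open>(1 + \<epsilon>) ^ h \<ge> n\<close>, then adding to \<open>T\<close> one of the first \<open>h\<close> layers of the breadth-first search
  decreases \<open>g\<close> by at least one: otherwise the parts of the layers outside \<open>T\<close> grow by a factor
  \<open>1 + \<epsilon>\<close> each time and exceed \<open>n\<close>. Since matched clients satisfy Hall's condition,
  \<open>g T \<ge> - \<epsilon> n\<close>, so fewer than \<open>h + \<epsilon> n\<close> breadth-first searches succeed. Choosing
  \<open>\<epsilon> = sqrt (ln n / n)\<close> gives \<open>B = O(sqrt (n ln n))\<close>.
\<close>

section \<open>Alternating walks and matchings\<close>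

primrec free_walk :: "('c \<Rightarrow> 's set) \<Rightarrow> ('c \<rightharpoonup> 's) \<Rightarrow> nat \<Rightarrow> 'c \<Rightarrow> bool" where
  "free_walk adj M 0 u \<longleftrightarrow> (\<exists>v \<in> adj u. v \<notin> ran M)"
| "free_walk adj M (Suc k) u \<longleftrightarrow> (\<exists>v \<in> adj u. \<exists>x. M x = Some v \<and> free_walk adj M k x)"

definition free_dist :: "('c \<Rightarrow> 's set) \<Rightarrow> ('c \<rightharpoonup> 's) \<Rightarrow> 'c \<Rightarrow> enat" where
  "free_dist adj M u = (INF k \<in> {k. free_walk adj M k u}. enat k)"

lemma le_free_dist_iff:
  "e \<le> free_dist adj M u \<longleftrightarrow> (\<forall>k. free_walk adj M k u \<longrightarrow> e \<le> enat k)"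
  unfolding free_dist_def by (simp add: le_INF_iff)

lemma free_dist_le: "free_walk adj M k u \<Longrightarrow> free_dist adj M u \<le> enat k"
  using le_free_dist_iff[of "free_dist adj M u" adj M u] by simp

lemma free_walk_free_dist:
  assumes "free_dist adj M u = enat k"
  shows "free_walk adj M k u"
proof (rule ccontr)
  assume no: "\<not> free_walk adj M k u"
  have "Suc k \<le> j" if "free_walk adj M j u" for j
    using free_dist_le[OF that] no that assms by (cases "j = k") auto
  then have "enat (Suc k) \<le> free_dist adj M u"
    by (simp add: le_free_dist_iff)
  with assms show False by simp
qed

lemma free_dist_eq_infinity_iff: "free_dist adj M u = \<infinity> \<longleftrightarrow> (\<forall>k. \<not> free_walk adj M k u)"
  using le_free_dist_iff[of \<infinity> adj M u] by simp

lemma free_dist_eq_0: "v \<in> adj u \<Longrightarrow> v \<notin> ran M \<Longrightarrow> free_dist adj M u = 0"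
  using free_dist_le[of adj M 0 u] by (auto simp: zero_enat_def[symmetric])

lemma free_dist_le_eSuc:
  assumes "v \<in> adj u" and "M x = Some v"
  shows "free_dist adj M u \<le> eSuc (free_dist adj M x)"
proof (cases "free_dist adj M x")
  case (enat k)
  then have "free_walk adj M (Suc k) u"
    using assms free_walk_free_dist by fastforce
  then show ?thesis
    using enat by (simp add: free_dist_le eSuc_enat)
qed simp

lemma free_dist_SucE:
  assumes "free_dist adj M u = enat (Suc k)"
  obtains v x where "v \<in> adj u" and "M x = Some v" and "free_dist adj M x = enat k"
proof -
  obtain v x where v: "v \<in> adj u" "M x = Some v" and "free_walk adj M k x"
    using free_walk_free_dist[OF assms] by auto
  then have "free_dist adj M x \<le> enat k"
    by (simp add: free_dist_le)
  moreover have "enat k \<le> free_dist adj M x"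
    using free_dist_le_eSuc[of v adj u M x, OF v] assms by (simp flip: eSuc_enat)
  ultimately show ?thesis
    using that v by simp
qed

lemma le_free_distI:
  assumes "u \<in> Q"
    and free: "\<And>u v. u \<in> Q \<Longrightarrow> v \<in> adj u \<Longrightarrow> v \<notin> ran M \<Longrightarrow> g u = 0"
    and step: "\<And>u v x. u \<in> Q \<Longrightarrow> v \<in> adj u \<Longrightarrow> M x = Some v \<Longrightarrow>
      g u \<le> eSuc (free_dist adj M x) \<or> x \<in> Q \<and> g u \<le> eSuc (g x)"
  shows "g u \<le> free_dist adj M u"
proof -
  have "g u \<le> enat k" if "free_walk adj M k u" and "u \<in> Q" for k u
    using that
  proof (induction k arbitrary: u)
    case 0
    then show ?case using free by auto
  next
    case (Suc k)
    then obtain v x where v: "v \<in> adj u" "M x = Some v" and x: "free_walk adj M k x"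
      by auto
    from step[OF Suc.prems(2) v] show ?case
      using Suc.IH[OF x] free_dist_le[OF x] by (auto simp flip: eSuc_enat intro: order_trans)
  qed
  with \<open>u \<in> Q\<close> show ?thesis by (simp add: le_free_dist_iff)
qed

locale bipartite_matching =
  fixes adj :: "'c \<Rightarrow> 's set" and M :: "'c \<rightharpoonup> 's"
  assumes edge: "M u = Some v \<Longrightarrow> v \<in> adj u"
    and client_unique: "M u = Some v \<Longrightarrow> M u' = Some v \<Longrightarrow> u = u'"
begin

lemma eSuc_le_free_dist:
  assumes "\<And>v. v \<in> adj u \<Longrightarrow> \<exists>x. M x = Some v \<and> e \<le> free_dist adj M x"
  shows "eSuc e \<le> free_dist adj M u"
proof (rule le_free_distI[where Q = "{u}" and g = "\<lambda>_. eSuc e"])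
  show "eSuc e = 0" if "y \<in> {u}" "v \<in> adj y" "v \<notin> ran M" for y v
    using that assms by (auto simp: ran_def)
  show "eSuc e \<le> eSuc (free_dist adj M x) \<or> x \<in> {u} \<and> eSuc e \<le> eSuc (eSuc e)"
    if "y \<in> {u}" "v \<in> adj y" "M x = Some v" for y v x
    using that assms client_unique by fastforce
qed simp

lemma inj_on_the_match: "inj_on (\<lambda>u. the (M u)) (dom M)"
  by (rule inj_onI) (metis client_unique domD option.sel)

lemma ex_client_at_dist:
  "free_dist adj M u = enat k \<Longrightarrow> i < k \<Longrightarrow> \<exists>x \<in> dom M. free_dist adj M x = enat i"
proof (induction k arbitrary: u)
  case (Suc k)
  then obtain v x where "M x = Some v" "free_dist adj M x = enat k"
    by (elim free_dist_SucE)
  then show ?case using Suc by (cases "i = k") auto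
qed simp

lemma free_dist_less_card_servers:
  assumes "finite S" and nbrs: "\<And>x. x \<in> insert u (dom M) \<Longrightarrow> adj x \<subseteq> S"
    and "free_dist adj M u \<noteq> \<infinity>"
  shows "free_dist adj M u < enat (card S)"
proof -
  obtain k where k: "free_dist adj M u = enat k" using assms(3) by blast
  then obtain x where x: "\<And>i. i < k \<Longrightarrow> x i \<in> dom M \<and> free_dist adj M (x i) = enat i"
    using ex_client_at_dist by metis
  let ?server = "\<lambda>i. the (M (x i))"
  have "inj_on x {..<k}" using x by (metis enat.inject inj_onI lessThan_iff)
  moreover have "x ` {..<k} \<subseteq> dom M" using x by blast
  ultimately have "inj_on ?server {..<k}"
    using comp_inj_on[of x "{..<k}" "\<lambda>u. the (M u)"] inj_on_the_match
    by (auto simp: comp_def intro: inj_on_subset)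
  then have card: "card (?server ` {..<k}) = k" by (simp add: card_image)
  have servers: "?server ` {..<k} \<subseteq> S \<inter> ran M"
  proof (rule image_subsetI)
    fix i assume "i \<in> {..<k}"
    then obtain v where "M (x i) = Some v" "x i \<in> dom M" using x by blast
    then show "?server i \<in> S \<inter> ran M" using nbrs edge by (auto intro: ranI)
  qed
  obtain y where y: "y \<in> insert u (dom M)" "free_dist adj M y = enat 0"
    using k x by (cases k) auto
  then obtain v where "v \<in> adj y" "v \<notin> ran M"
    using free_walk_free_dist[OF y(2)] by auto
  then have v: "v \<in> S" "v \<notin> ran M" using nbrs[OF y(1)] by auto
  then have "v \<notin> ?server ` {..<k}" using servers by blast
  with card have "Suc k = card (insert v (?server ` {..<k}))" by simp
  also have "\<dots> \<le> card S"
    using servers v(1) \<open>finite S\<close> by (intro card_mono) auto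
  finally show ?thesis using k by simp
qed

end

section \<open>Shortest augmentations\<close>

primrec upd_prefix :: "('a \<Rightarrow> 'b) \<Rightarrow> (nat \<Rightarrow> 'a) \<Rightarrow> (nat \<Rightarrow> 'b) \<Rightarrow> nat \<Rightarrow> 'a \<Rightarrow> 'b" where
  "upd_prefix f x y 0 = f"
| "upd_prefix f x y (Suc i) = (upd_prefix f x y i)(x i := y i)"

lemma upd_prefix_in: "inj_on x {..<i} \<Longrightarrow> j < i \<Longrightarrow> upd_prefix f x y i (x j) = y j"
  by (induction i) (auto simp: lessThan_Suc less_Suc_eq inj_on_def)

lemma upd_prefix_out: "a \<notin> x ` {..<i} \<Longrightarrow> upd_prefix f x y i a = f a"
  by (induction i) (auto simp: lessThan_Suc)

text \<open>
  The path is indexed from its free server \<open>pv 0\<close> backwards to the new client \<open>pu k\<close>, so that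
  \<open>j\<close> is the distance of \<open>pu j\<close>.
\<close>

locale shortest_augmentation = bipartite_matching adj M
  for adj :: "'c \<Rightarrow> 's set" and M :: "'c \<rightharpoonup> 's" +
  fixes c :: 'c and k :: nat and pu :: "nat \<Rightarrow> 'c" and pv :: "nat \<Rightarrow> 's"
  assumes path_start: "pu k = c" and start_unmatched: "M c = None" and end_free: "pv 0 \<notin> ran M"
    and path_edge: "j \<le> k \<Longrightarrow> pv j \<in> adj (pu j)"
    and path_match: "j < k \<Longrightarrow> M (pu j) = Some (pv (Suc j))"
    and shortest: "enat k \<le> free_dist adj M c"
begin

lemma free_dist_pu: "j \<le> k \<Longrightarrow> free_dist adj M (pu j) = enat j"
proof (rule antisym)
  show "j \<le> k \<Longrightarrow> free_dist adj M (pu j) \<le> enat j"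
  proof (induction j)
    case 0
    then show ?case
      using free_dist_eq_0[of "pv 0" adj "pu 0" M] path_edge[of 0] end_free
      by (simp add: zero_enat_def)
  next
    case (Suc j)
    then have "free_dist adj M (pu (Suc j)) \<le> eSuc (free_dist adj M (pu j))"
      using path_edge path_match by (intro free_dist_le_eSuc) auto
    then show ?case using Suc by (simp flip: eSuc_enat) (meson eSuc_ile_mono order_trans)
  qed
  show "j \<le> k \<Longrightarrow> enat j \<le> free_dist adj M (pu j)"
  proof (induction rule: inc_induct)
    case base
    then show ?case using shortest path_start by simp
  next
    case (step j)
    then have "free_dist adj M (pu (Suc j)) \<le> eSuc (free_dist adj M (pu j))"
      using path_edge path_match by (intro free_dist_le_eSuc) auto
    with step.IH have "eSuc (enat j) \<le> eSuc (free_dist adj M (pu j))"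
      by (simp add: eSuc_enat)
    then show ?case by simp
  qed
qed

lemma free_dist_start: "free_dist adj M c = enat k"
  using free_dist_pu path_start by blast

lemma inj_on_pu: "inj_on pu {..k}"
  by (rule inj_onI) (metis atMost_iff enat.inject free_dist_pu)

lemma pu_eq_iff: "i \<le> k \<Longrightarrow> j \<le> k \<Longrightarrow> pu i = pu j \<longleftrightarrow> i = j"
  using inj_on_pu by (auto simp: inj_on_def)

lemma pu_in_insert_dom: "j \<le> k \<Longrightarrow> pu j \<in> insert c (dom M)"
  using path_match path_start by (cases "j = k") auto

lemma inj_on_pv: "inj_on pv {..k}"
proof (rule inj_onI)
  have in_ran: "j \<le> k \<Longrightarrow> pv j \<in> ran M \<longleftrightarrow> j \<noteq> 0" for j
    using path_match end_free by (cases j) (auto intro: ranI[of M "pu (j - 1)"])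
  fix i j assume ij: "i \<in> {..k}" "j \<in> {..k}" "pv i = pv j"
  show "i = j"
  proof (cases "i = 0 \<or> j = 0")
    case False
    then obtain i' j' where i': "i = Suc i'" and j': "j = Suc j'" by (meson not0_implies_Suc)
    then have "pu i' = pu j'" using ij path_match by (intro client_unique) auto
    then show ?thesis using i' j' ij pu_eq_iff by simp
  qed (use ij in_ran[of i] in_ran[of j] in_ran[of 0] in auto)
qed

lemma pv_eq_iff: "i \<le> k \<Longrightarrow> j \<le> k \<Longrightarrow> pv i = pv j \<longleftrightarrow> i = j"
  using inj_on_pv by (auto simp: inj_on_def)

lemma server_on_path_iff:
  assumes "M u = Some v"
  shows "v \<in> pv ` {..k} \<longleftrightarrow> u \<in> pu ` {..k}"
proof
  assume "v \<in> pv ` {..k}"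
  then obtain j where j: "j \<le> k" "v = pv j" by blast
  with assms end_free have "j \<noteq> 0" by (metis ranI)
  then obtain i where "j = Suc i" by (meson not0_implies_Suc)
  with j assms have "u = pu i" "i \<le> k" using path_match client_unique by auto
  then show "u \<in> pu ` {..k}" by simp
next
  assume "u \<in> pu ` {..k}"
  then obtain j where j: "j \<le> k" "u = pu j" by blast
  with assms have "j < k" using path_start start_unmatched by (cases "j = k") auto
  with j assms have "v = pv (Suc j)" "Suc j \<le> k" using path_match by auto
  then show "v \<in> pv ` {..k}" by simp
qed

definition augmented :: "'c \<rightharpoonup> 's" where
  "augmented = upd_prefix M pu (\<lambda>j. Some (pv j)) (Suc k)"

lemma augmented_pu: "j \<le> k \<Longrightarrow> augmented (pu j) = Some (pv j)"
  unfolding augmented_def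
  by (rule upd_prefix_in) (simp_all add: inj_on_pu lessThan_Suc_atMost less_Suc_eq_le)

lemma augmented_off_path: "u \<notin> pu ` {..k} \<Longrightarrow> augmented u = M u"
  unfolding augmented_def by (rule upd_prefix_out) (simp add: lessThan_Suc_atMost)

lemma augmented_eq_Some_iff:
  "augmented u = Some v \<longleftrightarrow>
     (\<exists>j\<le>k. u = pu j \<and> v = pv j) \<or> u \<notin> pu ` {..k} \<and> v \<notin> pv ` {..k} \<and> M u = Some v"
proof (cases "u \<in> pu ` {..k}")
  case True
  then obtain i where "i \<le> k" "u = pu i" by blast
  then show ?thesis using augmented_pu pu_eq_iff by auto
next
  case False
  then have "augmented u = Some v \<longleftrightarrow> v \<notin> pv ` {..k} \<and> M u = Some v"
    using augmented_off_path[of u] server_on_path_iff[of u v] by (cases "M u = Some v") simp_all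
  then show ?thesis using False by blast
qed

lemma augmented_inverse:
  assumes "\<And>u v. R v = Some u \<longleftrightarrow> M u = Some v"
  shows "upd_prefix R pv (\<lambda>j. Some (pu j)) (Suc k) v = Some u \<longleftrightarrow> augmented u = Some v"
proof (cases "v \<in> pv ` {..k}")
  case True
  then obtain j where j: "j \<le> k" "v = pv j" by blast
  then have "upd_prefix R pv (\<lambda>j. Some (pu j)) (Suc k) v = Some (pu j)"
    by (simp add: upd_prefix_in inj_on_pv lessThan_Suc_atMost less_Suc_eq_le del: upd_prefix.simps)
  then show ?thesis
    unfolding augmented_eq_Some_iff using j pv_eq_iff by auto
next
  case False
  then have "upd_prefix R pv (\<lambda>j. Some (pu j)) (Suc k) v = R v"
    by (intro upd_prefix_out) (simp add: lessThan_Suc_atMost)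
  then show ?thesis
    unfolding augmented_eq_Some_iff using False assms server_on_path_iff by auto
qed

lemma dom_augmented: "dom augmented = insert c (dom M)"
proof (intro equalityI subsetI)
  show "u \<in> dom augmented" if "u \<in> insert c (dom M)" for u
    using that augmented_pu augmented_off_path path_start by (cases "u \<in> pu ` {..k}") auto
  show "u \<in> insert c (dom M)" if "u \<in> dom augmented" for u
    using that augmented_off_path pu_in_insert_dom by (cases "u \<in> pu ` {..k}") auto
qed

lemma ran_subset_ran_augmented: "ran M \<subseteq> ran augmented"
proof
  fix v assume "v \<in> ran M"
  then obtain u where u: "M u = Some v" by (auto simp: ran_def)
  show "v \<in> ran augmented"
  proof (cases "v \<in> pv ` {..k}")
    case True
    then show ?thesis using augmented_pu by (auto intro: ranI)
  next
    case False
    then show ?thesis using u server_on_path_iff augmented_off_path by (metis ranI)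
  qed
qed

lemma bipartite_matching_augmented: "bipartite_matching adj augmented"
proof
  fix u u' v assume u: "augmented u = Some v"
  then show "v \<in> adj u"
    unfolding augmented_eq_Some_iff using path_edge edge by auto
  show "u = u'" if "augmented u' = Some v"
    using u that pv_eq_iff client_unique unfolding augmented_eq_Some_iff by auto
qed

lemma free_dist_le_free_dist_augmented: "free_dist adj M u \<le> free_dist adj augmented u"
proof (rule le_free_distI[where Q = UNIV and g = "free_dist adj M"])
  fix u v x
  show "free_dist adj M u = 0" if "v \<in> adj u" "v \<notin> ran augmented"
    using that ran_subset_ran_augmented by (intro free_dist_eq_0) auto
  assume v: "v \<in> adj u" and "augmented x = Some v"
  then consider (new) j where "j \<le> k" "x = pu j" "v = pv j" | (old) "M x = Some v"
    unfolding augmented_eq_Some_iff by blast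
  then have "free_dist adj M u \<le> eSuc (free_dist adj M x)"
  proof cases
    case new
    show ?thesis
    proof (cases j)
      case 0
      then show ?thesis using v new end_free by (simp add: free_dist_eq_0)
    next
      case (Suc i)
      then have "free_dist adj M u \<le> eSuc (free_dist adj M (pu i))"
        using v new path_match by (intro free_dist_le_eSuc) auto
      also have "\<dots> \<le> eSuc (free_dist adj M x)" using new Suc by (simp add: free_dist_pu)
      finally show ?thesis .
    qed
  next
    case old
    with v show ?thesis by (rule free_dist_le_eSuc)
  qed
  then show "free_dist adj M u \<le> eSuc (free_dist adj augmented x) \<or>
      x \<in> UNIV \<and> free_dist adj M u \<le> eSuc (free_dist adj M x)"
    by simp
qed simp

end

section \<open>Counting long augmentations\<close>

definition excess :: "('c \<Rightarrow> 's set) \<Rightarrow> real \<Rightarrow> 'c set \<Rightarrow> real" where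
  "excess adj \<epsilon> T = real (card (\<Union> (adj ` T))) - (1 + \<epsilon>) * real (card T)"

lemma excess_Un:
  assumes fin: "finite T" "finite L" "\<And>u. finite (adj u)"
  shows "excess adj \<epsilon> (T \<union> L) =
    excess adj \<epsilon> T + real (card (\<Union> (adj ` L) - \<Union> (adj ` T))) - (1 + \<epsilon>) * real (card (L - T))"
proof -
  have card_Un: "card (X \<union> Y) = card X + card (Y - X)" if "finite X" "finite Y" for X Y :: "'x set"
    using that card_Un_disjoint[of X "Y - X"] by simp
  have "card (T \<union> L) = card T + card (L - T)"
    by (rule card_Un) (use fin in auto)
  moreover have "card (\<Union> (adj ` (T \<union> L))) = card (\<Union> (adj ` T)) + card (\<Union> (adj ` L) - \<Union> (adj ` T))"
    unfolding image_Un Union_Un_distrib by (rule card_Un) (use fin in auto)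
  ultimately show ?thesis
    by (simp add: excess_def algebra_simps)
qed

primrec layer :: "('c \<Rightarrow> 's set) \<Rightarrow> ('c \<rightharpoonup> 's) \<Rightarrow> 'c \<Rightarrow> nat \<Rightarrow> 'c set" where
  "layer adj M c 0 = {c}"
| "layer adj M c (Suc i) =
     layer adj M c i \<union> {x. \<exists>v \<in> \<Union> (adj ` layer adj M c i). M x = Some v}"

lemma center_in_layer: "c \<in> layer adj M c i"
  by (induction i) auto

lemma layer_subset: "layer adj M c i \<subseteq> insert c (dom M)"
  by (induction i) auto

lemma free_dist_le_layer:
  "u \<in> layer adj M c i \<Longrightarrow> free_dist adj M c \<le> enat i + free_dist adj M u"
proof (induction i arbitrary: u)
  case 0
  then show ?case by (simp add: zero_enat_def[symmetric])
next
  case (Suc i)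
  then consider (inner) "u \<in> layer adj M c i"
    | (outer) y v where "y \<in> layer adj M c i" "v \<in> adj y" "M u = Some v" by auto
  then show ?case
  proof cases
    case inner
    then have "free_dist adj M c \<le> enat i + free_dist adj M u" by (rule Suc.IH)
    also have "\<dots> \<le> enat (Suc i) + free_dist adj M u" by (intro add_right_mono) simp
    finally show ?thesis .
  next
    case outer
    have "free_dist adj M c \<le> enat i + free_dist adj M y" using outer(1) by (rule Suc.IH)
    also have "\<dots> \<le> enat i + eSuc (free_dist adj M u)"
      using outer by (intro add_left_mono free_dist_le_eSuc)
    finally show ?thesis by (simp add: iadd_Suc iadd_Suc_right flip: eSuc_enat)
  qed
qed

lemma (in bipartite_matching) card_new_neighbours_less:
  assumes "finite (dom M)" and c: "M c = None" and T: "T \<subseteq> dom M"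
    and far: "enat i < free_dist adj M c"
  shows "card (\<Union> (adj ` layer adj M c i) - \<Union> (adj ` T)) < card (layer adj M c (Suc i) - T)"
proof -
  let ?V = "\<Union> (adj ` layer adj M c i) - \<Union> (adj ` T)"
  define X where "X = {x. \<exists>v \<in> ?V. M x = Some v}"
  have finite_layer: "finite (layer adj M c (Suc i))"
    by (rule finite_subset[OF layer_subset]) (use \<open>finite (dom M)\<close> in simp)
  have "X \<subseteq> layer adj M c (Suc i) - T - {c}"
    using c by (auto simp: X_def dest: edge)
  moreover have "c \<in> layer adj M c (Suc i) - T"
    using center_in_layer[of c adj M "Suc i"] c T by blast
  ultimately have X: "X \<subset> layer adj M c (Suc i) - T" by blast
  have "?V \<subseteq> (\<lambda>x. the (M x)) ` X"
  proof
    fix v assume v: "v \<in> ?V"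
    then obtain u where u: "u \<in> layer adj M c i" "v \<in> adj u" by blast
    have "v \<in> ran M"
    proof (rule ccontr)
      assume "v \<notin> ran M"
      then have "free_dist adj M c \<le> enat i"
        using free_dist_le_layer[OF u(1)] free_dist_eq_0[of v adj u M] u(2) by simp
      with far show False by simp
    qed
    then obtain x where "M x = Some v" by (auto simp: ran_def)
    with v show "v \<in> (\<lambda>x. the (M x)) ` X" unfolding X_def by force
  qed
  moreover have "finite X" using X finite_layer finite_subset by blast
  ultimately have "card ?V \<le> card X" by (rule surj_card_le[rotated])
  also have "\<dots> < card (layer adj M c (Suc i) - T)"
    using X finite_layer by (intro psubset_card_mono) auto
  finally show ?thesis .
qed

lemma ex_slow_growth:
  fixes \<epsilon> :: real and k q :: "nat \<Rightarrow> nat"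
  assumes "k 0 = 1" and q: "\<And>i. i < h \<Longrightarrow> q i < k (Suc i)"
    and "0 \<le> \<epsilon>" and "0 < h" and "real (k h) \<le> (1 + \<epsilon>) ^ h"
  shows "\<exists>i<h. real (q i) \<le> (1 + \<epsilon>) * real (k i) - 1"
proof (rule ccontr)
  assume "\<not> ?thesis"
  then have growth: "(1 + \<epsilon>) * real (k i) < real (k (Suc i))" if "i < h" for i
    using that q[OF that] by force
  have power_le: "i \<le> h \<Longrightarrow> (1 + \<epsilon>) ^ i \<le> real (k i)" for i
  proof (induction i)
    case (Suc i)
    then have "(1 + \<epsilon>) ^ Suc i \<le> (1 + \<epsilon>) * real (k i)" using \<open>0 \<le> \<epsilon>\<close> by simp
    also have "\<dots> < real (k (Suc i))" using Suc.prems by (intro growth) simp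
    finally show ?case by simp
  qed (simp add: \<open>k 0 = 1\<close>)
  obtain j where h: "h = Suc j" using \<open>0 < h\<close> by (cases h) auto
  have "(1 + \<epsilon>) ^ h \<le> (1 + \<epsilon>) * real (k j)" using power_le[of j] h \<open>0 \<le> \<epsilon>\<close> by simp
  also have "\<dots> < real (k h)" using growth[of j] h by simp
  finally show False using assms(5) by simp
qed

lemma (in bipartite_matching) excess_decrease:
  assumes "finite (dom M)" and fin: "\<And>u. finite (adj u)" and c: "M c = None" and T: "T \<subseteq> dom M"
    and far: "enat h \<le> free_dist adj M c" and "0 < h"
    and eps: "0 \<le> \<epsilon>" "real (card (insert c (dom M))) \<le> (1 + \<epsilon>) ^ h"
  shows "\<exists>T' \<subseteq> insert c (dom M). excess adj \<epsilon> T' \<le> excess adj \<epsilon> T - 1"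
proof -
  let ?L = "layer adj M c"
  let ?q = "\<lambda>i. card (\<Union> (adj ` ?L i) - \<Union> (adj ` T))"
  have finite_layer: "finite (?L i)" for i
    by (rule finite_subset[OF layer_subset]) (use \<open>finite (dom M)\<close> in simp)
  have "\<exists>i<h. real (?q i) \<le> (1 + \<epsilon>) * real (card (?L i - T)) - 1"
  proof (rule ex_slow_growth)
    show "card (?L 0 - T) = 1" using c T by (auto simp: insert_Diff_if)
    show "?q i < card (?L (Suc i) - T)" if "i < h" for i
    proof (rule card_new_neighbours_less[OF \<open>finite (dom M)\<close> c T])
      have "enat i < enat h" using that by simp
      then show "enat i < free_dist adj M c" using far by (rule less_le_trans)
    qed
    have "card (?L h - T) \<le> card (insert c (dom M))"
      using \<open>finite (dom M)\<close> layer_subset[of adj M c h] by (intro card_mono) auto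
    with eps(2) show "real (card (?L h - T)) \<le> (1 + \<epsilon>) ^ h" by linarith
  qed fact+
  then obtain i where i: "real (?q i) \<le> (1 + \<epsilon>) * real (card (?L i - T)) - 1" by blast
  have "finite T" using T \<open>finite (dom M)\<close> by (rule finite_subset)
  then have "excess adj \<epsilon> (T \<union> ?L i) \<le> excess adj \<epsilon> T - 1"
    using i excess_Un[of T "?L i" adj \<epsilon>] finite_layer fin by simp
  moreover have "T \<union> ?L i \<subseteq> insert c (dom M)" using T layer_subset[of adj M c i] by blast
  ultimately show ?thesis by blast
qed

lemma (in bipartite_matching) card_le_card_neighbours:
  assumes "T \<subseteq> dom M" and "finite T" and "\<And>u. finite (adj u)"
  shows "card T \<le> card (\<Union> (adj ` T))"
proof (rule card_inj_on_le)
  show "inj_on (\<lambda>u. the (M u)) T" using inj_on_the_match assms(1) by (rule inj_on_subset)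
  show "(\<lambda>u. the (M u)) ` T \<subseteq> \<Union> (adj ` T)" using assms(1) edge by fastforce
qed (use assms in auto)

text \<open>
  \<open>low_excess adj n D B\<close> holds when \<open>D\<close> are the matched clients and \<open>B\<close> augmenting paths were found
  so far of which the \<open>b\<close>-th one had distance at least \<open>b\<close>.
\<close>

definition low_excess :: "('c \<Rightarrow> 's set) \<Rightarrow> nat \<Rightarrow> 'c set \<Rightarrow> nat \<Rightarrow> bool" where
  "low_excess adj n D B \<longleftrightarrow>
     (\<forall>h \<epsilon>. 0 < h \<longrightarrow> 0 \<le> \<epsilon> \<longrightarrow> real n \<le> (1 + \<epsilon>) ^ h \<longrightarrow>
        (\<exists>T \<subseteq> D. excess adj \<epsilon> T \<le> real h - 1 - real B))"

lemma low_excess_0: "low_excess adj n D 0"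
  unfolding low_excess_def by (auto intro!: exI[of _ "{}"] simp: excess_def)

lemma low_excess_mono: "low_excess adj n D B \<Longrightarrow> D \<subseteq> D' \<Longrightarrow> low_excess adj n D' B"
  unfolding low_excess_def by (meson subset_trans)

lemma (in bipartite_matching) low_excess_Suc:
  assumes low: "low_excess adj n (dom M) B"
    and "finite (dom M)" and fin: "\<And>u. finite (adj u)" and c: "M c = None"
    and n: "card (insert c (dom M)) \<le> n" and far: "enat (Suc B) \<le> free_dist adj M c"
  shows "low_excess adj n (insert c (dom M)) (Suc B)"
  unfolding low_excess_def
proof (intro allI impI)
  fix h and \<epsilon> :: real assume h: "0 < h" and eps: "0 \<le> \<epsilon>" "real n \<le> (1 + \<epsilon>) ^ h"
  show "\<exists>T \<subseteq> insert c (dom M). excess adj \<epsilon> T \<le> real h - 1 - real (Suc B)"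
  proof (cases "h \<le> Suc B")
    case True
    obtain T where T: "T \<subseteq> dom M" "excess adj \<epsilon> T \<le> real h - 1 - real B"
      using low h eps unfolding low_excess_def by blast
    have "enat h \<le> free_dist adj M c" using True far by (meson enat_ord_simps(1) order_trans)
    moreover have "real (card (insert c (dom M))) \<le> (1 + \<epsilon>) ^ h" using n eps(2) by linarith
    ultimately obtain T' where "T' \<subseteq> insert c (dom M)" "excess adj \<epsilon> T' \<le> excess adj \<epsilon> T - 1"
      using excess_decrease[OF \<open>finite (dom M)\<close> fin c T(1)] h eps(1) by blast
    with T(2) show ?thesis by (intro exI[of _ T']) simp
  next
    case False
    then show ?thesis by (intro exI[of _ "{}"]) (simp add: excess_def)
  qed
qed

lemma (in bipartite_matching) low_excess_le:
  assumes low: "low_excess adj n (dom M) B"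
    and "finite (dom M)" and fin: "\<And>u. finite (adj u)" and n: "card (dom M) \<le> n"
    and h: "0 < h" and eps: "0 \<le> \<epsilon>" "real n \<le> (1 + \<epsilon>) ^ h"
  shows "real B \<le> real h - 1 + \<epsilon> * real n"
proof -
  obtain T where T: "T \<subseteq> dom M" "excess adj \<epsilon> T \<le> real h - 1 - real B"
    using low h eps unfolding low_excess_def by blast
  have "finite T" using T(1) \<open>finite (dom M)\<close> by (rule finite_subset)
  then have "card T \<le> card (\<Union> (adj ` T))" using T(1) fin by (intro card_le_card_neighbours)
  then have "- (\<epsilon> * real (card T)) \<le> excess adj \<epsilon> T" by (simp add: excess_def algebra_simps)
  moreover have "card T \<le> n" using card_mono[OF \<open>finite (dom M)\<close> T(1)] n by simp
  then have "\<epsilon> * real (card T) \<le> \<epsilon> * real n" using eps(1) by (simp add: mult_left_mono)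
  ultimately show ?thesis using T(2) by linarith
qed

lemma half_le_ln_one_plus:
  assumes "0 \<le> x" and "x \<le> (1 :: real)"
  shows "x / 2 \<le> ln (1 + x)"
proof -
  have "- ln (1 + x) = ln (1 / (1 + x))" using assms by (simp add: ln_div)
  also have "\<dots> \<le> 1 / (1 + x) - 1" using assms by (intro ln_le_minus_one) simp
  also have "\<dots> = - (x / (1 + x))" using assms by (simp add: field_simps)
  also have "\<dots> \<le> - (x / 2)" using assms divide_left_mono[of "1 + x" 2 x] by simp
  finally show ?thesis by simp
qed

lemma (in bipartite_matching) low_excess_le_sqrt:
  assumes "low_excess adj n (dom M) B"
    and "finite (dom M)" and "\<And>u. finite (adj u)" and "card (dom M) \<le> n" and n: "2 \<le> n"
  shows "real B \<le> 3 * sqrt (real n * ln (real n))"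
proof -
  define \<epsilon> where "\<epsilon> = sqrt (ln (real n) / real n)"
  define r where "r = sqrt (real n * ln (real n))"
  define h where "h = nat \<lceil>2 * r\<rceil>"
  have ln_pos: "0 < ln (real n)" using n by simp
  have "0 < r" using ln_pos n by (simp add: r_def)
  then have "0 < h" and h_ge: "2 * r \<le> real h" and h_le: "real h \<le> 2 * r + 1"
    unfolding h_def by linarith+
  have eps_n: "\<epsilon> * real n = r"
    using n ln_pos by (simp add: \<epsilon>_def r_def real_sqrt_divide real_sqrt_mult field_simps)
  have eps: "0 \<le> \<epsilon>" "\<epsilon> \<le> 1"
    using ln_pos ln_le_minus_one[of "real n"] n by (simp_all add: \<epsilon>_def)
  have "r * \<epsilon> = ln (real n)"
    using n ln_pos by (simp add: \<epsilon>_def r_def flip: real_sqrt_mult)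
  then have "ln (real n) = (2 * r) * (\<epsilon> / 2)" by simp
  also have "\<dots> \<le> real h * ln (1 + \<epsilon>)"
    using h_ge half_le_ln_one_plus[OF eps] eps \<open>0 < r\<close> by (intro mult_mono) auto
  also have "\<dots> = ln ((1 + \<epsilon>) ^ h)" using eps by (simp add: ln_realpow)
  finally have "real n \<le> (1 + \<epsilon>) ^ h" using n eps by (subst (asm) ln_le_cancel_iff) auto
  then have "real B \<le> real h - 1 + \<epsilon> * real n"
    using assms(1-4) \<open>0 < h\<close> eps(1) by (intro low_excess_le)
  then show ?thesis using h_le eps_n unfolding r_def by linarith
qed

section \<open>Augmenting paths as vertex lists\<close>

lemma all_Suc_less_Cons:
  "(\<forall>k. Suc k < length (x # y # p) \<longrightarrow> P ((x # y # p) ! k) ((x # y # p) ! Suc k)) \<longleftrightarrow>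
     P x y \<and> (\<forall>k. Suc k < length (y # p) \<longrightarrow> P ((y # p) ! k) ((y # p) ! Suc k))"
  by (auto simp: nth_Cons split: nat.split)

lemma is_path_Cons:
  "is_path E (x # y # p) \<longleftrightarrow> x \<notin> set (y # p) \<and> {x, y} \<in> E \<and> is_path E (y # p)"
  unfolding is_path_def all_Suc_less_Cons[where P = "\<lambda>x y. {x, y} \<in> E"] by auto

lemma is_path_pair: "is_path E [x, y] \<longleftrightarrow> x \<noteq> y \<and> {x, y} \<in> E"
  by (auto simp: is_path_def)

lemma path_edges_pair: "path_edges [x, y] = {{x, y}}"
  by (auto simp: path_edges_def)

lemma path_edges_Cons: "path_edges (x # y # p) = insert {x, y} (path_edges (y # p))"
proof -
  have "e \<in> path_edges (x # y # p) \<longleftrightarrow> e = {x, y} \<or> e \<in> path_edges (y # p)" for e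
    using all_Suc_less_Cons[where P = "\<lambda>x y. e \<noteq> {x, y}" and x = x and y = y and p = p]
    unfolding path_edges_def by blast
  then show ?thesis by blast
qed

lemma alternating_pair: "alternating M [x, y]"
  by (simp add: alternating_def)

lemma alternating_Cons:
  "alternating M (x # y # z # p) \<longleftrightarrow> ({x, y} \<in> M \<longleftrightarrow> {y, z} \<notin> M) \<and> alternating M (y # z # p)"
  unfolding alternating_def by (auto simp: nth_Cons split: nat.splits)

definition client_edges :: "nat set \<Rightarrow> (nat \<Rightarrow> nat set) \<Rightarrow> vertex set set" where
  "client_edges C adj = {{Client u, Server v} | u v. u \<in> C \<and> v \<in> adj u}"

definition matching_edges :: "(nat \<rightharpoonup> nat) \<Rightarrow> vertex set set" where
  "matching_edges M = {{Client u, Server v} | u v. M u = Some v}"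

lemma client_edges_iff [simp]:
  "{Client u, Server v} \<in> client_edges C adj \<longleftrightarrow> u \<in> C \<and> v \<in> adj u"
  "{Server v, Client u} \<in> client_edges C adj \<longleftrightarrow> u \<in> C \<and> v \<in> adj u"
  "{Client u, Client x} \<notin> client_edges C adj"
  by (auto simp: client_edges_def doubleton_eq_iff)

lemma matching_edges_iff [simp]:
  "{Client u, Server v} \<in> matching_edges M \<longleftrightarrow> M u = Some v"
  "{Server v, Client u} \<in> matching_edges M \<longleftrightarrow> M u = Some v"
  "{Server v, Server x} \<notin> matching_edges M"
  by (auto simp: matching_edges_def doubleton_eq_iff)

lemma unmatched_Server_iff: "unmatched (matching_edges M) (Server v) \<longleftrightarrow> v \<notin> ran M"
  by (auto simp: unmatched_def matching_edges_def ran_def)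

lemma unmatched_Client_iff: "unmatched (matching_edges M) (Client u) \<longleftrightarrow> M u = None"
  unfolding unmatched_def matching_edges_def by (cases "M u") auto

lemma free_walk_of_alternating_path:
  assumes "is_path (client_edges C adj) p" and "alternating (matching_edges M) p"
    and "hd p = Client u" and "last p = Server v" and "v \<notin> ran M"
    and "\<And>x y r. p = x # y # r \<Longrightarrow> {x, y} \<notin> matching_edges M"
  shows "\<exists>k. length p = 2 * k + 2 \<and> free_walk adj M k u"
  using assms
proof (induction p arbitrary: u rule: induct_list012)
  case (3 x y r)
  then obtain a where "x = Client u" "y = Server a" and a: "a \<in> adj u"
    by (cases y) (auto simp: is_path_Cons)
  show ?case
  proof (cases r)
    case Nil
    with 3 a \<open>y = Server a\<close> show ?thesis by (intro exI[of _ 0]) auto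
  next
    case (Cons z r')
    have yz: "{y, z} \<in> matching_edges M"
      using "3.prems"(2,6) Cons by (simp add: alternating_Cons)
    then obtain b where z: "z = Client b" and "M b = Some a"
      using \<open>y = Server a\<close> by (cases z) auto
    then obtain z' r'' where r': "r' = z' # r''"
      using "3.prems"(4) Cons by (cases r') auto
    have "is_path (client_edges C adj) r" "alternating (matching_edges M) r"
      "last r = Server v" "hd r = Client b"
      using "3.prems"(1,2,4) Cons z r' by (simp_all add: is_path_Cons alternating_Cons)
    moreover have "{x', y'} \<notin> matching_edges M" if "r = x' # y' # r''" for x' y' r''
      using "3.prems"(2) yz that Cons by (simp add: alternating_Cons)
    ultimately obtain k where "length r = 2 * k + 2" "free_walk adj M k b"
      using "3.IH"(1) \<open>v \<notin> ran M\<close> by blast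
    then show ?thesis
      using a \<open>M b = Some a\<close> by (intro exI[of _ "Suc k"]) auto
  qed
qed (auto simp: is_path_def)

lemma free_walk_of_augmenting_from:
  assumes "augmenting_from (client_edges C adj) (matching_edges M) c p"
  shows "\<exists>k. length p = 2 * k + 2 \<and> free_walk adj M k c"
proof -
  obtain v where v: "last p = Server v" "v \<notin> ran M"
    using assms by (auto simp: augmenting_from_def augmenting_path_def unmatched_Server_iff)
  have "{x, y} \<notin> matching_edges M" if "p = x # y # r" for x y r
    using assms that unfolding augmenting_from_def augmenting_path_def unmatched_def by auto
  with assms v show ?thesis
    unfolding augmenting_from_def augmenting_path_def
    by (intro free_walk_of_alternating_path) auto
qed

primrec path_list :: "(nat \<Rightarrow> nat) \<Rightarrow> (nat \<Rightarrow> nat) \<Rightarrow> nat \<Rightarrow> vertex list" where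
  "path_list pu pv 0 = [Client (pu 0), Server (pv 0)]"
| "path_list pu pv (Suc j) = Client (pu (Suc j)) # Server (pv (Suc j)) # path_list pu pv j"

lemma path_list_eq_Cons: "\<exists>r. path_list pu pv j = Client (pu j) # Server (pv j) # r"
  by (cases j) auto

lemma length_path_list: "length (path_list pu pv j) = 2 * j + 2"
  by (induction j) auto

lemma last_path_list: "last (path_list pu pv j) = Server (pv 0)"
proof (induction j)
  case (Suc j)
  then show ?case using path_list_eq_Cons[of pu pv j] by auto
qed simp

lemma set_path_list: "set (path_list pu pv j) = Client ` pu ` {..j} \<union> Server ` pv ` {..j}"
  by (induction j) (auto simp: atMost_Suc)

lemma path_edges_path_list:
  "path_edges (path_list pu pv j) =
     {{Client (pu i), Server (pv i)} | i. i \<le> j} \<union>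
     {{Client (pu i), Server (pv (Suc i))} | i. i < j}"
proof (induction j)
  case (Suc j)
  obtain r where r: "path_list pu pv j = Client (pu j) # Server (pv j) # r"
    using path_list_eq_Cons by blast
  then have "path_edges (path_list pu pv (Suc j)) =
      {{Client (pu (Suc j)), Server (pv (Suc j))}, {Client (pu j), Server (pv (Suc j))}} \<union>
      path_edges (path_list pu pv j)"
    by (simp add: path_edges_Cons insert_commute)
  then show ?case unfolding Suc.IH by (auto simp: le_Suc_eq less_Suc_eq)
qed (auto simp: path_edges_pair)

locale client_augmentation = shortest_augmentation adj M c k pu pv
  for adj :: "nat \<Rightarrow> nat set" and M :: "nat \<rightharpoonup> nat" and c k pu pv +
  fixes C :: "nat set"
  assumes clients: "insert c (dom M) \<subseteq> C"
begin

lemma path_edge_unmatched: "j \<le> k \<Longrightarrow> M (pu j) \<noteq> Some (pv j)"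
  using path_match[of j] path_start start_unmatched pv_eq_iff[of "Suc j" j] by (cases "j = k") auto

lemma is_path_path_list: "j \<le> k \<Longrightarrow> is_path (client_edges C adj) (path_list pu pv j)"
proof (induction j)
  case 0
  then show ?case
    using path_edge pu_in_insert_dom clients by (auto simp: is_path_pair)
next
  case (Suc j)
  obtain r where r: "path_list pu pv j = Client (pu j) # Server (pv j) # r"
    using path_list_eq_Cons by blast
  have "pu (Suc j) \<noteq> pu i \<and> pv (Suc j) \<noteq> pv i" if "i \<le> j" for i
    using that Suc.prems pu_eq_iff[of "Suc j" i] pv_eq_iff[of "Suc j" i] by simp
  then have "Client (pu (Suc j)) \<notin> set (path_list pu pv j)"
    "Server (pv (Suc j)) \<notin> set (path_list pu pv j)"
    unfolding set_path_list by auto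
  moreover have "pu (Suc j) \<in> C" "pu j \<in> C"
    using Suc.prems pu_in_insert_dom[of "Suc j"] pu_in_insert_dom[of j] clients by auto
  moreover have "pv (Suc j) \<in> adj (pu (Suc j))" "pv (Suc j) \<in> adj (pu j)"
    using Suc.prems path_edge path_match edge by auto
  ultimately show ?case
    using Suc r by (simp add: is_path_Cons)
qed

lemma alternating_path_list: "j \<le> k \<Longrightarrow> alternating (matching_edges M) (path_list pu pv j)"
proof (induction j)
  case (Suc j)
  obtain r where r: "path_list pu pv j = Client (pu j) # Server (pv j) # r"
    using path_list_eq_Cons by blast
  then show ?case
    using Suc path_match[of j] pv_eq_iff[of "Suc j" j] path_edge_unmatched[of "Suc j"]
    by (simp add: alternating_Cons)
qed (simp add: alternating_pair)

lemma augmenting_from_path_list: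
  "augmenting_from (client_edges C adj) (matching_edges M) c (path_list pu pv k)"
proof -
  obtain r where "path_list pu pv k = Client (pu k) # Server (pv k) # r"
    using path_list_eq_Cons by blast
  then have "hd (path_list pu pv k) = Client c" by (simp add: path_start)
  then show ?thesis
    unfolding augmenting_from_def augmenting_path_def last_path_list
    using is_path_path_list alternating_path_list
    by (simp add: length_path_list unmatched_Server_iff unmatched_Client_iff
        start_unmatched end_free)
qed

lemma augment_path_list: "augment (matching_edges M) (path_list pu pv k) = matching_edges augmented"
proof (rule set_eqI)
  fix e
  let ?P = "path_edges (path_list pu pv k)"
  show "e \<in> augment (matching_edges M) (path_list pu pv k) \<longleftrightarrow> e \<in> matching_edges augmented"
  proof (cases "\<exists>u v. e = {Client u, Server v}")
    case True
    then obtain u v where e: "e = {Client u, Server v}" by blast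
    have "e \<in> ?P \<longleftrightarrow> (\<exists>i\<le>k. u = pu i \<and> v = pv i) \<or> (\<exists>i<k. u = pu i \<and> v = pv (Suc i))"
      unfolding path_edges_path_list e by (auto simp: doubleton_eq_iff)
    also have "(\<exists>i<k. u = pu i \<and> v = pv (Suc i)) \<longleftrightarrow> u \<in> pu ` {..k} \<and> M u = Some v"
    proof
      assume "u \<in> pu ` {..k} \<and> M u = Some v"
      then obtain i where i: "i \<le> k" "u = pu i" "M (pu i) = Some v" by auto
      then have "i < k" using path_start start_unmatched by (cases "i = k") auto
      then show "\<exists>i<k. u = pu i \<and> v = pv (Suc i)" using i path_match[of i] by auto
    qed (use path_match in auto)
    finally have "e \<in> ?P \<longleftrightarrow> (\<exists>i\<le>k. u = pu i \<and> v = pv i) \<or> u \<in> pu ` {..k} \<and> M u = Some v" .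
    moreover have "M u \<noteq> Some v" if "\<exists>i\<le>k. u = pu i \<and> v = pv i"
      using that path_edge_unmatched by auto
    moreover have "e \<in> matching_edges M \<longleftrightarrow> M u = Some v"
      "e \<in> matching_edges augmented \<longleftrightarrow> augmented u = Some v"
      by (simp_all add: e)
    ultimately show ?thesis
      using server_on_path_iff[of u v] unfolding augment_def augmented_eq_Some_iff by blast
  next
    case False
    then show ?thesis
      unfolding augment_def path_edges_path_list matching_edges_def by blast
  qed
qed

lemma sap_step_augmented:
  "sap_step (client_edges C adj) (matching_edges M) c (matching_edges augmented)"
proof -
  have "length (path_list pu pv k) \<le> length p"
    if p: "augmenting_from (client_edges C adj) (matching_edges M) c p" for p
  proof -
    obtain l where "length p = 2 * l + 2" "free_walk adj M l c"
      using free_walk_of_augmenting_from[OF p] by blast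
    then show ?thesis using shortest by (simp add: le_free_dist_iff length_path_list)
  qed
  then have "is_arg_min length (augmenting_from (client_edges C adj) (matching_edges M) c)
      (path_list pu pv k)"
    using augmenting_from_path_list by (auto simp: is_arg_min_def not_less)
  then show ?thesis
    unfolding sap_step_def augment_path_list[symmetric] using augmenting_from_path_list by auto
qed

end

lemma sap_step_no_path:
  assumes "free_dist adj M c = \<infinity>"
  shows "sap_step (client_edges C adj) (matching_edges M) c (matching_edges M)"
  using assms free_walk_of_augmenting_from[of C adj M c]
  unfolding sap_step_def free_dist_eq_infinity_iff by auto

lemma graph_of_take:
  "i < length Ns \<Longrightarrow> graph_of (take (Suc i) Ns) = client_edges {..i} (\<lambda>u. set (Ns ! u))"
  unfolding graph_of_def client_edges_def
  by (intro Collect_cong ex_cong1) (auto simp: less_Suc_eq_le)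

lemma card_graph_of:
  assumes "online_instance s Ns"
  shows "card (graph_of Ns) = (\<Sum>u<length Ns. length (Ns ! u))"
proof -
  let ?edge = "\<lambda>(u, v). {Client u, Server v}"
  have "graph_of Ns = ?edge ` (SIGMA u:{..<length Ns}. set (Ns ! u))"
    unfolding graph_of_def by auto
  moreover have "inj_on ?edge (SIGMA u:{..<length Ns}. set (Ns ! u))"
    by (auto simp: inj_on_def doubleton_eq_iff)
  ultimately have "card (graph_of Ns) = (\<Sum>u<length Ns. card (set (Ns ! u)))"
    by (simp add: card_image)
  also have "\<dots> = (\<Sum>u<length Ns. length (Ns ! u))"
    using assms unfolding online_instance_def by (intro sum.cong) (auto simp: distinct_card)
  finally show ?thesis .
qed

section \<open>Distance labels and current arcs\<close>

abbreviation nbrs :: "('c \<Rightarrow> 's list) \<Rightarrow> 'c \<Rightarrow> 's set" where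
  "nbrs adj u \<equiv> set (adj u)"

locale labelled_matching = bipartite_matching "nbrs adj" M
  for adj :: "'c \<Rightarrow> 's list" and M :: "'c \<rightharpoonup> 's" +
  fixes lab cur :: "'c \<Rightarrow> nat"
  assumes lab_le_free_dist: "enat (lab u) \<le> free_dist (nbrs adj) M u"
    and cur_le_length: "cur u \<le> length (adj u)"
    and arc_spent: "p < cur u \<Longrightarrow> \<exists>x. M x = Some (adj u ! p) \<and> lab u \<le> lab x"
begin

lemma labelled_matching_next_arc:
  assumes "cur u < length (adj u)" and "M x = Some (adj u ! cur u)" and "lab u \<le> lab x"
  shows "labelled_matching adj M lab (cur(u := Suc (cur u)))"
proof
  show "enat (lab y) \<le> free_dist (nbrs adj) M y" for y by (rule lab_le_free_dist)
  show "(cur(u := Suc (cur u))) y \<le> length (adj y)" for y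
    using assms(1) cur_le_length by simp
  show "\<exists>x. M x = Some (adj y ! p) \<and> lab y \<le> lab x" if "p < (cur(u := Suc (cur u))) y" for y p
    using that assms(2,3) arc_spent by (auto simp: less_Suc_eq split: if_splits)
qed

lemma labelled_matching_relabel:
  assumes "cur u = length (adj u)"
  shows "labelled_matching adj M (lab(u := Suc (lab u))) (cur(u := 0))"
proof
  have "\<exists>x. M x = Some v \<and> enat (lab u) \<le> free_dist (nbrs adj) M x" if v: "v \<in> nbrs adj u" for v
  proof -
    obtain p where "p < length (adj u)" "v = adj u ! p"
      using v by (auto simp: in_set_conv_nth)
    then obtain x where "M x = Some v" "lab u \<le> lab x"
      using arc_spent[of p u] assms by auto
    then show ?thesis using lab_le_free_dist[of x] by (meson enat_ord_simps(1) order_trans)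
  qed
  then have "enat (Suc (lab u)) \<le> free_dist (nbrs adj) M u"
    unfolding eSuc_enat[symmetric] by (rule eSuc_le_free_dist)
  then show "enat ((lab(u := Suc (lab u))) y) \<le> free_dist (nbrs adj) M y" for y
    using lab_le_free_dist by simp
  show "(cur(u := 0)) y \<le> length (adj y)" for y
    using cur_le_length by simp
  show "\<exists>x. M x = Some (adj y ! p) \<and> (lab(u := Suc (lab u))) y \<le> (lab(u := Suc (lab u))) x"
    if p: "p < (cur(u := 0)) y" for y p
  proof -
    have "y \<noteq> u" "p < cur y" using p by (auto split: if_splits)
    then obtain x where "M x = Some (adj y ! p)" "lab y \<le> lab x" using arc_spent by blast
    then show ?thesis using \<open>y \<noteq> u\<close> by (intro exI[of _ x]) auto
  qed
qed

lemma labelled_matching_raise: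
  assumes le: "\<And>u. u \<in> Q \<Longrightarrow> lab u \<le> l"
    and far: "\<And>u. u \<in> Q \<Longrightarrow> enat l \<le> free_dist (nbrs adj) M u"
    and closed: "\<And>u v. u \<in> Q \<Longrightarrow> v \<in> nbrs adj u \<Longrightarrow> \<exists>x. M x = Some v \<and> (x \<in> Q \<or> l \<le> lab x)"
  shows "labelled_matching adj M (\<lambda>u. if u \<in> Q then l else lab u) cur"
proof
  show "enat (if u \<in> Q then l else lab u) \<le> free_dist (nbrs adj) M u" for u
    using far lab_le_free_dist by simp
  show "\<exists>x. M x = Some (adj u ! p) \<and> (if u \<in> Q then l else lab u) \<le> (if x \<in> Q then l else lab x)"
    if p: "p < cur u" for u p
  proof (cases "u \<in> Q")
    case True
    have "adj u ! p \<in> nbrs adj u" using p cur_le_length[of u] by simp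
    from closed[OF True this] obtain x where "M x = Some (adj u ! p)" "x \<in> Q \<or> l \<le> lab x"
      by blast
    then show ?thesis using True by (intro exI[of _ x]) auto
  next
    case False
    obtain x where "M x = Some (adj u ! p)" "lab u \<le> lab x" using arc_spent[OF p] by blast
    then show ?thesis using False le[of x] by (intro exI[of _ x]) auto
  qed
qed (rule cur_le_length)

end

locale labelled_augmentation =
  labelled_matching adj M lab cur + shortest_augmentation "nbrs adj" M c k pu pv
  for adj :: "'c \<Rightarrow> 's list" and M :: "'c \<rightharpoonup> 's" and lab cur :: "'c \<Rightarrow> nat"
    and c k pu pv
begin

definition raised :: "'c \<Rightarrow> nat" where
  "raised = upd_prefix lab pu (\<lambda>j. j) (Suc k)"

lemma raised_pu: "j \<le> k \<Longrightarrow> raised (pu j) = j"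
  unfolding raised_def
  by (rule upd_prefix_in) (simp_all add: inj_on_pu lessThan_Suc_atMost less_Suc_eq_le)

lemma raised_off_path: "u \<notin> pu ` {..k} \<Longrightarrow> raised u = lab u"
  unfolding raised_def by (rule upd_prefix_out) (simp add: lessThan_Suc_atMost)

lemma lab_pu_le: "j \<le> k \<Longrightarrow> lab (pu j) \<le> j"
  using lab_le_free_dist[of "pu j"] by (simp add: free_dist_pu)

lemma lab_le_raised: "lab u \<le> raised u"
  using raised_off_path raised_pu lab_pu_le by (cases "u \<in> pu ` {..k}") auto

lemma raised_le_free_dist_augmented: "enat (raised u) \<le> free_dist (nbrs adj) augmented u"
proof -
  have "enat (raised u) \<le> free_dist (nbrs adj) M u"
    using raised_off_path raised_pu free_dist_pu lab_le_free_dist by (cases "u \<in> pu ` {..k}") auto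
  also have "\<dots> \<le> free_dist (nbrs adj) augmented u" by (rule free_dist_le_free_dist_augmented)
  finally show ?thesis .
qed

lemma labelled_matching_augmented:
  "labelled_matching adj augmented raised (\<lambda>u. if raised u = lab u then cur u else 0)"
proof (intro labelled_matching.intro labelled_matching_axioms.intro)
  fix u p assume "p < (if raised u = lab u then cur u else 0)"
  then have "p < cur u" and same: "raised u = lab u" by (auto split: if_splits)
  then obtain x where x: "M x = Some (adj u ! p)" "lab u \<le> lab x" using arc_spent by blast
  show "\<exists>x. augmented x = Some (adj u ! p) \<and> raised u \<le> raised x"
  proof (cases "x \<in> pu ` {..k}")
    case True
    then obtain i where i: "i \<le> k" "x = pu i" by blast
    with x have "i < k" using start_unmatched path_start by (cases "i = k") auto
    then have "augmented (pu (Suc i)) = Some (adj u ! p)"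
      using x i path_match by (simp add: augmented_pu)
    moreover have "lab u \<le> raised (pu (Suc i))"
      using x i \<open>i < k\<close> lab_pu_le[of i] by (simp add: raised_pu)
    ultimately show ?thesis using same by auto
  next
    case False
    then show ?thesis
      using x same by (intro exI[of _ x]) (simp add: augmented_off_path raised_off_path)
  qed
qed (use bipartite_matching_augmented raised_le_free_dist_augmented cur_le_length in auto)

end

section \<open>Depth-first search along decreasing labels\<close>

definition alt_step :: "('c \<Rightarrow> 's set) \<Rightarrow> ('c \<rightharpoonup> 's) \<Rightarrow> 'c \<Rightarrow> 'c \<Rightarrow> bool" where
  "alt_step adj M y x \<longleftrightarrow> (\<exists>v \<in> adj y. M x = Some v)"

primrec parent_path :: "('c \<Rightarrow> 'c \<Rightarrow> bool) \<Rightarrow> ('c \<Rightarrow> 'c) \<Rightarrow> 'c \<Rightarrow> nat \<Rightarrow> 'c \<Rightarrow> bool" where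
  "parent_path E par c 0 u \<longleftrightarrow> u = c"
| "parent_path E par c (Suc k) u \<longleftrightarrow> E (par u) u \<and> parent_path E par c k (par u)"

lemma parent_path_mono:
  "parent_path E par c k u \<Longrightarrow> (\<And>y x. E y x \<Longrightarrow> E' y x) \<Longrightarrow> parent_path E' par c k u"
  by (induction k arbitrary: u) auto

lemma parent_path_end: "parent_path E par c k u \<Longrightarrow> (par ^^ k) u = c"
  by (induction k arbitrary: u) (auto simp: funpow_swap1)

lemma parent_path_step:
  "parent_path E par c k u \<Longrightarrow> j < k \<Longrightarrow> E ((par ^^ Suc j) u) ((par ^^ j) u)"
proof (induction k arbitrary: u j)
  case (Suc k)
  then show ?case by (cases j) (auto simp: funpow_swap1)
qed simp

lemma (in bipartite_matching) shortest_augmentation_parent_path: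
  assumes path: "parent_path (alt_step adj M) par c k u" and "M c = None"
    and v: "v \<in> adj u" "v \<notin> ran M" and "enat k \<le> free_dist adj M c"
  shows "\<exists>pv. pv 0 = v \<and> shortest_augmentation adj M c k (\<lambda>j. (par ^^ j) u) pv"
proof -
  define pv where "pv j = (case j of 0 \<Rightarrow> v | Suc i \<Rightarrow> the (M ((par ^^ i) u)))" for j
  have step: "M ((par ^^ j) u) = Some (pv (Suc j)) \<and> pv (Suc j) \<in> adj ((par ^^ Suc j) u)"
    if "j < k" for j
    using parent_path_step[OF path that] by (auto simp: alt_step_def pv_def)
  have "shortest_augmentation adj M c k (\<lambda>j. (par ^^ j) u) pv"
  proof
    show "(par ^^ k) u = c" by (rule parent_path_end[OF path])
    show "pv j \<in> adj ((par ^^ j) u)" if "j \<le> k" for j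
      using v step[of "j - 1"] that by (cases j) (auto simp: pv_def)
  qed (use assms step in \<open>auto simp: pv_def\<close>)
  then show ?thesis by (intro exI[of _ pv]) (simp add: pv_def)
qed

definition descent :: "('c \<Rightarrow> 's set) \<Rightarrow> ('c \<rightharpoonup> 's) \<Rightarrow> ('c \<Rightarrow> nat) \<Rightarrow> 'c \<Rightarrow> 'c \<Rightarrow> bool" where
  "descent adj M lab y x \<longleftrightarrow> alt_step adj M y x \<and> lab x < lab y"

lemma descent_path_lab:
  "parent_path (descent adj M lab) par c k u \<Longrightarrow> lab u + k \<le> lab c"
  by (induction k arbitrary: u) (fastforce simp: descent_def)+

lemma descent_path_upd_lab:
  "parent_path (descent adj M lab) par c k u \<Longrightarrow> lab w < lab u \<Longrightarrow>
    parent_path (descent adj M (lab(w := y))) par c k u"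
  by (induction k arbitrary: u) (auto simp: descent_def)

lemma descent_path_upd_par:
  "parent_path (descent adj M lab) par c k u \<Longrightarrow> lab w < lab u \<Longrightarrow>
    parent_path (descent adj M lab) (par(w := y)) c k u"
  by (induction k arbitrary: u) (auto simp: descent_def)

locale dfs = labelled_matching adj M lab cur
  for adj :: "'c \<Rightarrow> 's list" and M :: "'c \<rightharpoonup> 's" and lab cur :: "'c \<Rightarrow> nat" +
  fixes c :: 'c and par :: "'c \<Rightarrow> 'c" and u :: 'c and k :: nat
  assumes root_unmatched: "M c = None" and root_parent: "par c = c"
    and descent_path: "parent_path (descent (nbrs adj) M lab) par c k u"
begin

lemma lab_add_depth_le: "lab u + k \<le> lab c"
  by (rule descent_path_lab[OF descent_path])

lemma current_in_insert_dom: "u \<in> insert c (dom M)"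
  using descent_path by (cases k) (auto simp: descent_def alt_step_def)

lemma dfs_advance:
  assumes "v \<in> nbrs adj u" and "M x = Some v" and "lab x < lab u"
  shows "dfs adj M lab cur c (par(x := u)) x (Suc k)"
proof
  have "x \<noteq> c" using assms(2) root_unmatched by auto
  then show "(par(x := u)) c = c" using root_parent by simp
  show "parent_path (descent (nbrs adj) M lab) (par(x := u)) c (Suc k) x"
    using assms descent_path descent_path_upd_par by (auto simp: descent_def alt_step_def)
qed (rule root_unmatched)

lemma dfs_next_arc:
  assumes "cur u < length (adj u)" and "M x = Some (adj u ! cur u)" and "\<not> lab x < lab u"
  shows "dfs adj M lab (cur(u := Suc (cur u))) c par u k"
proof (intro dfs.intro dfs_axioms.intro)
  show "labelled_matching adj M lab (cur(u := Suc (cur u)))"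
    using assms by (intro labelled_matching_next_arc) auto
qed (fact root_unmatched root_parent descent_path)+

lemma dfs_relabel:
  assumes "cur u = length (adj u)"
  shows "dfs adj M (lab(u := Suc (lab u))) (cur(u := 0)) c par (par u) (k - 1)"
proof (intro dfs.intro dfs_axioms.intro)
  show "labelled_matching adj M (lab(u := Suc (lab u))) (cur(u := 0))"
    using assms by (rule labelled_matching_relabel)
  show "parent_path (descent (nbrs adj) M (lab(u := Suc (lab u)))) par c (k - 1) (par u)"
  proof (cases k)
    case 0
    then show ?thesis using descent_path root_parent by simp
  next
    case (Suc i)
    then have "parent_path (descent (nbrs adj) M lab) par c i (par u)" "lab u < lab (par u)"
      using descent_path by (auto simp: descent_def)
    then show ?thesis using Suc by (simp add: descent_path_upd_lab)
  qed
qed (fact root_unmatched root_parent)+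

lemma dfs_found:
  assumes "v \<in> nbrs adj u" and "v \<notin> ran M"
  shows "\<exists>pv. pv 0 = v \<and> shortest_augmentation (nbrs adj) M c k (\<lambda>j. (par ^^ j) u) pv"
proof (rule shortest_augmentation_parent_path[OF _ root_unmatched assms])
  show "parent_path (alt_step (nbrs adj) M) par c k u"
    using descent_path by (rule parent_path_mono) (simp add: descent_def)
  have "enat k \<le> enat (lab c)" using lab_add_depth_le by simp
  also have "\<dots> \<le> free_dist (nbrs adj) M c" by (rule lab_le_free_dist)
  finally show "enat k \<le> free_dist (nbrs adj) M c" .
qed

end

section \<open>Potentials for scanning adjacency lists\<close>

definition weight :: "('c \<Rightarrow> 's list) \<Rightarrow> 'c set \<Rightarrow> nat" where
  "weight adj C = (\<Sum>u \<in> C. length (adj u) + 1)"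

definition scans :: "('c \<Rightarrow> 's list) \<Rightarrow> ('c \<Rightarrow> nat) \<Rightarrow> ('c \<Rightarrow> nat) \<Rightarrow> 'c \<Rightarrow> nat" where
  "scans adj lab cur u = lab u * (length (adj u) + 1) + cur u"

text \<open>
  The cap \<open>K\<close> restricts the potential to the labels that the depth-first searches pay for; larger
  labels are set by failing breadth-first searches.
\<close>

definition scan_pot :: "('c \<Rightarrow> 's list) \<Rightarrow> nat \<Rightarrow> 'c set \<Rightarrow> ('c \<Rightarrow> nat) \<Rightarrow> ('c \<Rightarrow> nat) \<Rightarrow> nat" where
  "scan_pot adj K C lab cur = (\<Sum>u \<in> C. min (scans adj lab cur u) (K * (length (adj u) + 1)))"

lemma weight_mono: "finite C' \<Longrightarrow> C \<subseteq> C' \<Longrightarrow> weight adj C \<le> weight adj C'"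
  unfolding weight_def by (intro sum_mono2) auto

lemma scan_pot_le: "scan_pot adj K C lab cur \<le> K * weight adj C"
  unfolding scan_pot_def weight_def sum_distrib_left by (intro sum_mono) simp

lemma scan_pot_mono:
  assumes "K \<le> K'" and "finite C'" and "C \<subseteq> C'"
    and "\<And>u. u \<in> C \<Longrightarrow> scans adj lab cur u \<le> scans adj lab' cur' u"
  shows "scan_pot adj K C lab cur \<le> scan_pot adj K' C' lab' cur'"
proof -
  have "scan_pot adj K C lab cur \<le> scan_pot adj K' C lab' cur'"
    unfolding scan_pot_def using assms by (intro sum_mono min.mono mult_le_mono1) auto
  also have "\<dots> \<le> scan_pot adj K' C' lab' cur'"
    unfolding scan_pot_def using assms by (intro sum_mono2) auto
  finally show ?thesis .
qed

lemma (in labelled_matching) scans_mono: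
  assumes "lab u \<le> lab' u" and "lab' u = lab u \<Longrightarrow> cur u \<le> cur' u"
  shows "scans adj lab cur u \<le> scans adj lab' cur' u"
proof (cases "lab' u = lab u")
  case False
  then have "lab u + 1 \<le> lab' u" using assms(1) by simp
  then have "(lab u + 1) * (length (adj u) + 1) \<le> lab' u * (length (adj u) + 1)"
    by (rule mult_le_mono1)
  then show ?thesis using cur_le_length[of u] unfolding scans_def by simp
qed (use assms in \<open>simp add: scans_def\<close>)

lemma scan_pot_Suc:
  assumes "finite C" and "u \<in> C" and "scans adj lab cur u < K * (length (adj u) + 1)"
    and u: "scans adj lab' cur' u = Suc (scans adj lab cur u)"
    and others: "\<And>x. x \<noteq> u \<Longrightarrow> scans adj lab' cur' x = scans adj lab cur x"
  shows "scan_pot adj K C lab' cur' = Suc (scan_pot adj K C lab cur)"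
proof -
  let ?f = "\<lambda>lab cur u. min (scans adj lab cur u) (K * (length (adj u) + 1))"
  have "scan_pot adj K C lab' cur' = ?f lab' cur' u + (\<Sum>x \<in> C - {u}. ?f lab' cur' x)"
    unfolding scan_pot_def using assms by (intro sum.remove)
  also have "(\<Sum>x \<in> C - {u}. ?f lab' cur' x) = (\<Sum>x \<in> C - {u}. ?f lab cur x)"
    using others by (intro sum.cong) auto
  also have "?f lab' cur' u + \<dots> = Suc (?f lab cur u + (\<Sum>x \<in> C - {u}. ?f lab cur x))"
    using assms(3) u by simp
  also have "?f lab cur u + (\<Sum>x \<in> C - {u}. ?f lab cur x) = scan_pot adj K C lab cur"
    unfolding scan_pot_def using assms by (intro sum.remove[symmetric])
  finally show ?thesis .
qed

lemma (in labelled_matching) scans_less: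
  assumes "lab u < K"
  shows "scans adj lab cur u < K * (length (adj u) + 1)"
proof -
  have "scans adj lab cur u < (lab u + 1) * (length (adj u) + 1)"
    using cur_le_length[of u] by (simp add: scans_def)
  also have "\<dots> \<le> K * (length (adj u) + 1)" using assms by (intro mult_le_mono1) simp
  finally show ?thesis .
qed

lemma (in labelled_matching) scan_pot_next_arc:
  assumes "finite C" and "u \<in> C" and "lab u < K"
  shows "scan_pot adj K C lab (cur(u := Suc (cur u))) = Suc (scan_pot adj K C lab cur)"
  using assms scans_less by (intro scan_pot_Suc[of C u]) (auto simp: scans_def)

lemma (in labelled_matching) scan_pot_relabel:
  assumes "finite C" and "u \<in> C" and "lab u < K" and "cur u = length (adj u)"
  shows "scan_pot adj K C (lab(u := Suc (lab u))) (cur(u := 0)) = Suc (scan_pot adj K C lab cur)"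
  using assms scans_less[of u K] by (intro scan_pot_Suc[of C u]) (auto simp: scans_def)

section \<open>Breadth-first search\<close>

definition scanned ::
  "('c \<rightharpoonup> 's) \<Rightarrow> 'c set \<Rightarrow> 'c list \<Rightarrow> ('c \<Rightarrow> nat) \<Rightarrow> 'c \<Rightarrow> 's \<Rightarrow> bool" where
  "scanned M dead qs d y v \<longleftrightarrow> (\<exists>x. M x = Some v \<and> (x \<in> dead \<or> x \<in> set qs \<and> d x \<le> Suc (d y)))"

lemma scanned_append:
  "scanned M dead qs d y v \<Longrightarrow> x \<notin> set qs \<Longrightarrow> y \<in> set qs \<Longrightarrow>
    scanned M dead (qs @ [x]) (d(x := e)) y v"
  unfolding scanned_def by (metis Un_iff fun_upd_other set_append)

text \<open>
  The list \<open>qs\<close> holds all clients that were ever in the queue, and the search is about to scan arc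
  \<open>p\<close> of client \<open>qs ! h\<close>. The clients in \<open>dead\<close> reach no free server and are not entered.
\<close>

locale bfs = bipartite_matching "nbrs adj" M
  for adj :: "'c \<Rightarrow> 's list" and M :: "'c \<rightharpoonup> 's" +
  fixes dead :: "'c set" and c :: 'c and par :: "'c \<Rightarrow> 'c" and qs :: "'c list" and d :: "'c \<Rightarrow> nat"
    and h p :: nat
  assumes root: "c \<in> set qs" and root_dist: "d c = 0"
    and parent: "y \<in> set qs \<Longrightarrow> y \<noteq> c \<Longrightarrow>
      par y \<in> set qs \<and> d y = Suc (d (par y)) \<and> alt_step (nbrs adj) M (par y) y"
    and distinct_queue: "distinct qs" and sorted_queue: "sorted (map d qs)"
    and alive: "set qs \<inter> dead = {}"
    and head_le: "h \<le> length qs"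
    and clients_scanned: "a < h \<Longrightarrow> v \<in> nbrs adj (qs ! a) \<Longrightarrow> scanned M dead qs d (qs ! a) v"
    and near: "h < length qs \<Longrightarrow> y \<in> set qs \<Longrightarrow> d y \<le> Suc (d (qs ! h))"
    and arcs: "p \<le> (if h < length qs then length (adj (qs ! h)) else 0)"
    and arcs_scanned: "i < p \<Longrightarrow> scanned M dead qs d (qs ! h) (adj (qs ! h) ! i)"

lemma bfs_start:
  assumes "bipartite_matching (nbrs adj) M" and "c \<notin> dead"
  shows "bfs adj M dead c par [c] (\<lambda>_. 0) 0 0"
  using assms by (intro bfs.intro bfs_axioms.intro) auto

context bfs
begin

lemma bfs_scan:
  assumes "h < length qs" and "p < length (adj (qs ! h))"
    and "scanned M dead qs d (qs ! h) (adj (qs ! h) ! p)"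
  shows "bfs adj M dead c par qs d h (Suc p)"
proof
  show "scanned M dead qs d (qs ! h) (adj (qs ! h) ! i)" if "i < Suc p" for i
    using that assms arcs_scanned by (cases "i = p") auto
qed (use assms root root_dist parent distinct_queue sorted_queue alive clients_scanned near in auto)

lemma bfs_enqueue:
  assumes h: "h < length qs" and step: "alt_step (nbrs adj) M (qs ! h) x"
    and x: "x \<notin> set qs" "x \<notin> dead"
  shows "bfs adj M dead c (par(x := qs ! h)) (qs @ [x]) (d(x := Suc (d (qs ! h)))) h p"
proof
  let ?par = "par(x := qs ! h)" and ?d = "d(x := Suc (d (qs ! h)))"
  have u: "qs ! h \<in> set qs" "qs ! h \<noteq> x" using h x by auto
  show "c \<in> set (qs @ [x])" "?d c = 0" "set (qs @ [x]) \<inter> dead = {}" "distinct (qs @ [x])"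
    using root root_dist x alive distinct_queue by auto
  show "?par y \<in> set (qs @ [x]) \<and> ?d y = Suc (?d (?par y)) \<and> alt_step (nbrs adj) M (?par y) y"
    if "y \<in> set (qs @ [x])" "y \<noteq> c" for y
    using that parent[of y] x(1) u step by auto
  show "sorted (map ?d (qs @ [x]))"
    using sorted_queue near[OF h] x(1) by (auto simp: sorted_append)
  show "scanned M dead (qs @ [x]) ?d ((qs @ [x]) ! a) v"
    if "a < h" "v \<in> nbrs adj ((qs @ [x]) ! a)" for a v
    using that h x(1) clients_scanned by (auto simp: nth_append intro!: scanned_append)
  show "?d y \<le> Suc (?d ((qs @ [x]) ! h))" if "y \<in> set (qs @ [x])" for y
    using that near[OF h] u h by (auto simp: nth_append)
  show "scanned M dead (qs @ [x]) ?d ((qs @ [x]) ! h) (adj ((qs @ [x]) ! h) ! i)" if "i < p" for i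
    using that h x(1) arcs_scanned by (auto simp: nth_append intro!: scanned_append)
qed (use h arcs in \<open>auto simp: nth_append\<close>)

lemma bfs_next_client:
  assumes h: "h < length qs" and "p = length (adj (qs ! h))"
  shows "bfs adj M dead c par qs d (Suc h) 0"
proof
  show "scanned M dead qs d (qs ! a) v" if "a < Suc h" "v \<in> nbrs adj (qs ! a)" for a v
    using that clients_scanned arcs_scanned assms(2) by (cases "a = h") (auto simp: in_set_conv_nth)
  show "d y \<le> Suc (d (qs ! Suc h))" if "Suc h < length qs" "y \<in> set qs" for y
  proof -
    have "d (qs ! h) \<le> d (qs ! Suc h)"
      using sorted_nth_mono[OF sorted_queue, of h "Suc h"] that(1) by simp
    then show ?thesis using near[OF h that(2)] by simp
  qed
qed (use h root root_dist parent distinct_queue sorted_queue alive in auto)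

lemma parent_path_queue: "y \<in> set qs \<Longrightarrow> parent_path (alt_step (nbrs adj) M) par c (d y) y"
proof (induction "d y" arbitrary: y)
  case 0
  then show ?case using parent[of y] by auto
next
  case (Suc e)
  then have "y \<noteq> c" using root_dist by auto
  then have y: "par y \<in> set qs" "d y = Suc (d (par y))" "alt_step (nbrs adj) M (par y) y"
    using parent Suc.prems by auto
  then show ?case using Suc.hyps by simp
qed

lemma le_free_dist_queue:
  assumes dead: "\<And>x. x \<in> dead \<Longrightarrow> free_dist (nbrs adj) M x = \<infinity>" and "y \<in> set qs"
  shows "(if h < length qs then enat (d (qs ! h) - d y) else \<infinity>) \<le> free_dist (nbrs adj) M y"
proof -
  let ?g = "\<lambda>y. if h < length qs then enat (d (qs ! h) - d y) else \<infinity>"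
  have unscanned: "h < length qs \<and> d (qs ! h) \<le> d y"
    if "y \<in> set qs" "v \<in> nbrs adj y" "\<not> scanned M dead qs d y v" for y v
  proof -
    obtain a where a: "a < length qs" "y = qs ! a"
      using \<open>y \<in> set qs\<close> by (auto simp: in_set_conv_nth)
    have "h \<le> a" using clients_scanned that(2,3) a(2) by (meson not_le)
    then show ?thesis using a sorted_nth_mono[OF sorted_queue, of h a] by simp
  qed
  show ?thesis
  proof (rule le_free_distI[where Q = "set qs" and g = ?g, OF \<open>y \<in> set qs\<close>])
    show "?g y = 0" if "y \<in> set qs" "v \<in> nbrs adj y" "v \<notin> ran M" for y v
    proof -
      have "\<not> scanned M dead qs d y v" using that(3) by (auto simp: scanned_def ran_def)
      from unscanned[OF that(1,2) this] show ?thesis by (simp add: zero_enat_def)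
    qed
    fix y v x assume y: "y \<in> set qs" "v \<in> nbrs adj y" and x: "M x = Some v"
    show "?g y \<le> eSuc (free_dist (nbrs adj) M x) \<or> x \<in> set qs \<and> ?g y \<le> eSuc (?g x)"
    proof (cases "scanned M dead qs d y v")
      case True
      then have "x \<in> dead \<or> x \<in> set qs \<and> d x \<le> Suc (d y)"
        using x client_unique by (auto simp: scanned_def)
      then show ?thesis
        using dead by (auto simp: eSuc_enat)
    next
      case False
      from unscanned[OF y this] show ?thesis by (simp add: zero_enat_def[symmetric])
    qed
  qed
qed

lemma bfs_found:
  assumes dead: "\<And>x. x \<in> dead \<Longrightarrow> free_dist (nbrs adj) M x = \<infinity>" and h: "h < length qs"
    and "M c = None" and v: "v \<in> nbrs adj (qs ! h)" "v \<notin> ran M"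
  shows "\<exists>pv. pv 0 = v \<and>
    shortest_augmentation (nbrs adj) M c (d (qs ! h)) (\<lambda>j. (par ^^ j) (qs ! h)) pv"
proof (rule shortest_augmentation_parent_path[OF _ \<open>M c = None\<close> v])
  show "parent_path (alt_step (nbrs adj) M) par c (d (qs ! h)) (qs ! h)"
    using h by (intro parent_path_queue) simp
  show "enat (d (qs ! h)) \<le> free_dist (nbrs adj) M c"
    using le_free_dist_queue[OF dead root] h root_dist by simp
qed

lemma free_dist_exhausted:
  assumes "\<And>x. x \<in> dead \<Longrightarrow> free_dist (nbrs adj) M x = \<infinity>" and "h = length qs" and "y \<in> set qs"
  shows "free_dist (nbrs adj) M y = \<infinity>"
  using le_free_dist_queue[OF assms(1,3)] assms(2) by simp

lemma neighbour_exhausted: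
  assumes "h = length qs" and "y \<in> set qs" and "v \<in> nbrs adj y"
  shows "\<exists>x. M x = Some v \<and> (x \<in> set qs \<or> x \<in> dead)"
proof -
  obtain a where "a < h" "y = qs ! a" using assms(1,2) by (auto simp: in_set_conv_nth)
  then show ?thesis using clients_scanned assms(3) by (auto simp: scanned_def)
qed

lemma queue_subset: "set qs \<subseteq> insert c (dom M)"
  using parent by (auto simp: alt_step_def)

lemma weight_take_Suc:
  assumes "h < length qs"
  shows "weight adj (set (take (Suc h) qs)) =
    weight adj (set (take h qs)) + length (adj (qs ! h)) + 1"
proof -
  have "qs ! h \<notin> set (take h qs)"
    using assms distinct_queue by (auto simp: in_set_conv_nth nth_eq_iff_index_eq)
  then show ?thesis by (simp add: take_Suc_conv_app_nth[OF assms] weight_def)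
qed

lemma weight_take_add_le: "weight adj (set (take h qs)) + p \<le> weight adj (set qs)"
proof (cases "h < length qs")
  case True
  then have "weight adj (set (take h qs)) + p \<le> weight adj (set (take (Suc h) qs))"
    using arcs by (simp add: weight_take_Suc)
  also have "\<dots> \<le> weight adj (set qs)" by (intro weight_mono set_take_subset) simp
  finally show ?thesis .
next
  case False
  then show ?thesis using arcs head_le by simp
qed

end

section \<open>Total correctness with running time\<close>

definition fits_word :: "nat \<Rightarrow> state \<Rightarrow> bool" where
  "fits_word w \<sigma> \<longleftrightarrow> (\<forall>x. regs \<sigma> x < 2 ^ w) \<and> (\<forall>a i. arrs \<sigma> a i < 2 ^ w)"

text \<open>
  The overflow conditions that remain for a memory that fits: those of constants and of the
  operations that can exceed their arguments.
\<close>

fun asafe :: "nat \<Rightarrow> aexp \<Rightarrow> state \<Rightarrow> bool" where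
  "asafe w (Const k) \<sigma> \<longleftrightarrow> k < 2 ^ w"
| "asafe w (Reg x) \<sigma> \<longleftrightarrow> True"
| "asafe w (Load a e) \<sigma> \<longleftrightarrow> asafe w e \<sigma>"
| "asafe w (BinOp f e e') \<sigma> \<longleftrightarrow>
     asafe w e \<sigma> \<and> asafe w e' \<sigma> \<and> (f = Add \<or> f = Mul \<longrightarrow> aval (BinOp f e e') \<sigma> < 2 ^ w)"

fun bsafe :: "nat \<Rightarrow> bexp \<Rightarrow> state \<Rightarrow> bool" where
  "bsafe w (Less e e') \<sigma> \<longleftrightarrow> asafe w e \<sigma> \<and> asafe w e' \<sigma>"
| "bsafe w (Equal e e') \<sigma> \<longleftrightarrow> asafe w e \<sigma> \<and> asafe w e' \<sigma>"
| "bsafe w (Neg b) \<sigma> \<longleftrightarrow> bsafe w b \<sigma>"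
| "bsafe w (Conj b b') \<sigma> \<longleftrightarrow> bsafe w b \<sigma> \<and> bsafe w b' \<sigma>"

lemma afits_aval: "afits w e \<sigma> \<Longrightarrow> aval e \<sigma> < 2 ^ w"
  by (cases e) auto

lemma asafe_afits: "fits_word w \<sigma> \<Longrightarrow> asafe w e \<sigma> \<Longrightarrow> afits w e \<sigma>"
proof (induction e)
  case (BinOp f e e')
  then have "aval e \<sigma> < 2 ^ w" using afits_aval by auto
  then show ?case using BinOp
    by (cases f) (auto intro: le_less_trans[OF diff_le_self] le_less_trans[OF div_le_dividend]
        le_less_trans[OF mod_less_eq_dividend])
qed (auto simp: fits_word_def)

lemma bsafe_bfits: "fits_word w \<sigma> \<Longrightarrow> bsafe w b \<sigma> \<Longrightarrow> bfits w b \<sigma>"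
  by (induction b) (auto intro: asafe_afits)

lemma exec_fits_word: "exec w P \<sigma> t \<sigma>' \<Longrightarrow> fits_word w \<sigma> \<Longrightarrow> fits_word w \<sigma>'"
  by (induction rule: exec.induct) (auto simp: fits_word_def dest: afits_aval)

fun written_regs :: "com \<Rightarrow> string set" where
  "written_regs Skip = {}"
| "written_regs (Assign x e) = {x}"
| "written_regs (Store a i e) = {}"
| "written_regs (Seq P R) = written_regs P \<union> written_regs R"
| "written_regs (Cond b P R) = written_regs P \<union> written_regs R"
| "written_regs (While b P) = written_regs P"

fun written_arrs :: "com \<Rightarrow> string set" where
  "written_arrs Skip = {}"
| "written_arrs (Assign x e) = {}"
| "written_arrs (Store a i e) = {a}"
| "written_arrs (Seq P R) = written_arrs P \<union> written_arrs R"
| "written_arrs (Cond b P R) = written_arrs P \<union> written_arrs R"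
| "written_arrs (While b P) = written_arrs P"

definition frame :: "com \<Rightarrow> state \<Rightarrow> state \<Rightarrow> bool" where
  "frame P \<sigma> \<sigma>' \<longleftrightarrow>
     (\<forall>x. x \<notin> written_regs P \<longrightarrow> regs \<sigma>' x = regs \<sigma> x) \<and>
     (\<forall>a. a \<notin> written_arrs P \<longrightarrow> arrs \<sigma>' a = arrs \<sigma> a)"

lemma frame_refl: "frame P \<sigma> \<sigma>"
  by (simp add: frame_def)

lemma frame_trans: "frame P \<sigma> \<sigma>' \<Longrightarrow> frame P \<sigma>' \<sigma>'' \<Longrightarrow> frame P \<sigma> \<sigma>''"
  by (simp add: frame_def)

lemma frame_While [simp]: "frame (While b P) = frame P"
  by (simp add: frame_def fun_eq_iff)

lemma exec_frame: "exec w P \<sigma> t \<sigma>' \<Longrightarrow> frame P \<sigma> \<sigma>'"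
  by (induction rule: exec.induct) (auto simp: frame_def)

definition wp :: "nat \<Rightarrow> com \<Rightarrow> (nat \<Rightarrow> state \<Rightarrow> bool) \<Rightarrow> state \<Rightarrow> bool" where
  "wp w P Q \<sigma> \<longleftrightarrow> (fits_word w \<sigma> \<longrightarrow> (\<exists>t \<sigma>'. exec w P \<sigma> t \<sigma>' \<and> Q t \<sigma>'))"

lemma wp_mono: "wp w P Q \<sigma> \<Longrightarrow> (\<And>t \<sigma>'. Q t \<sigma>' \<Longrightarrow> Q' t \<sigma>') \<Longrightarrow> wp w P Q' \<sigma>"
  unfolding wp_def by blast

lemma wp_frame: "wp w P Q \<sigma> \<Longrightarrow> wp w P (\<lambda>t \<sigma>'. Q t \<sigma>' \<and> frame P \<sigma> \<sigma>') \<sigma>"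
  unfolding wp_def using exec_frame by blast

lemma wp_Seq:
  assumes "wp w P Q' \<sigma>"
    and "\<And>t \<sigma>'. Q' t \<sigma>' \<Longrightarrow> frame P \<sigma> \<sigma>' \<Longrightarrow> wp w R (\<lambda>t'. Q (t + t')) \<sigma>'"
  shows "wp w (Seq P R) Q \<sigma>"
  using assms unfolding wp_def by (meson exec.Seq exec_fits_word exec_frame)

lemma wp_CondTrue:
  assumes "bsafe w b \<sigma>" and "bval b \<sigma>" and "wp w P (\<lambda>t. Q (1 + bcost b + t)) \<sigma>"
  shows "wp w (Cond b P R) Q \<sigma>"
  using assms exec.CondTrue bsafe_bfits unfolding wp_def by blast

lemma wp_CondFalse:
  assumes "bsafe w b \<sigma>" and "\<not> bval b \<sigma>" and "wp w R (\<lambda>t. Q (1 + bcost b + t)) \<sigma>"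
  shows "wp w (Cond b P R) Q \<sigma>"
  using assms exec.CondFalse bsafe_bfits unfolding wp_def by blast

lemma wp_WhileFalse:
  assumes "bsafe w b \<sigma>" and "\<not> bval b \<sigma>" and "Q (1 + bcost b) \<sigma>"
  shows "wp w (While b P) Q \<sigma>"
  using assms exec.WhileFalse bsafe_bfits unfolding wp_def by blast

lemma wp_WhileTrue:
  assumes "bsafe w b \<sigma>" and "bval b \<sigma>"
    and "wp w (Seq P (While b P)) (\<lambda>t. Q (1 + bcost b + t)) \<sigma>"
  shows "wp w (While b P) Q \<sigma>"
  unfolding wp_def
proof
  assume fits: "fits_word w \<sigma>"
  then obtain t \<sigma>' where "exec w (Seq P (While b P)) \<sigma> t \<sigma>'" and Q: "Q (1 + bcost b + t) \<sigma>'"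
    using assms(3) unfolding wp_def by blast
  then obtain t1 \<sigma>1 t2 where "t = t1 + t2" "exec w P \<sigma> t1 \<sigma>1" "exec w (While b P) \<sigma>1 t2 \<sigma>'"
    by (elim exec_SeqE)
  then have "exec w (While b P) \<sigma> (1 + bcost b + t) \<sigma>'"
    using exec.WhileTrue[OF bsafe_bfits[OF fits assms(1)] assms(2)] by (simp add: add.assoc)
  with Q show "\<exists>t \<sigma>'. exec w (While b P) \<sigma> t \<sigma>' \<and> Q t \<sigma>'" by blast
qed

text \<open>
  The index \<open>p\<close> of the invariant measures progress; it bounds the number of iterations and pays for
  them.
\<close>

lemma wp_While:
  assumes "I p \<sigma>" and bound: "\<And>p \<sigma>'. I p \<sigma>' \<Longrightarrow> frame P \<sigma> \<sigma>' \<Longrightarrow> p \<le> F"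
    and safe: "\<And>p \<sigma>'. I p \<sigma>' \<Longrightarrow> frame P \<sigma> \<sigma>' \<Longrightarrow> bsafe w b \<sigma>'"
    and step: "\<And>p \<sigma>'. I p \<sigma>' \<Longrightarrow> frame P \<sigma> \<sigma>' \<Longrightarrow> bval b \<sigma>' \<Longrightarrow>
      wp w P (\<lambda>t \<sigma>''. 1 + bcost b + t \<le> q \<and> (\<exists>p'>p. I p' \<sigma>'')) \<sigma>'"
  shows "wp w (While b P)
    (\<lambda>t \<sigma>'. \<exists>p'. I p' \<sigma>' \<and> \<not> bval b \<sigma>' \<and> t + q * p \<le> q * p' + 1 + bcost b) \<sigma>"
proof -
  have "wp w (While b P)
      (\<lambda>t \<sigma>'. \<exists>p'. I p' \<sigma>' \<and> \<not> bval b \<sigma>' \<and> t + q * p \<le> q * p' + 1 + bcost b) \<sigma>1"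
    if "I p \<sigma>1" and "frame P \<sigma> \<sigma>1" for p \<sigma>1
    using that
  proof (induction "F - p" arbitrary: p \<sigma>1 rule: less_induct)
    case less
    show ?case
    proof (cases "bval b \<sigma>1")
      case False
      then show ?thesis using less.prems safe by (intro wp_WhileFalse) auto
    next
      case True
      show ?thesis
      proof (rule wp_WhileTrue[OF safe[OF less.prems] True])
        show "wp w (Seq P (While b P)) (\<lambda>t \<sigma>'. \<exists>p'. I p' \<sigma>' \<and> \<not> bval b \<sigma>' \<and>
            1 + bcost b + t + q * p \<le> q * p' + 1 + bcost b) \<sigma>1"
        proof (rule wp_Seq[OF step[OF less.prems True]])
          fix t \<sigma>2 assume t: "1 + bcost b + t \<le> q \<and> (\<exists>p'>p. I p' \<sigma>2)" and "frame P \<sigma>1 \<sigma>2"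
          then obtain p2 where p2: "p < p2" "I p2 \<sigma>2" by blast
          have frame: "frame P \<sigma> \<sigma>2" using less.prems(2) \<open>frame P \<sigma>1 \<sigma>2\<close> by (rule frame_trans)
          have "F - p2 < F - p" using bound[OF p2(2) frame] p2(1) by simp
          from less.hyps[OF this p2(2) frame]
          show "wp w (While b P) (\<lambda>t' \<sigma>'. \<exists>p'. I p' \<sigma>' \<and> \<not> bval b \<sigma>' \<and>
              1 + bcost b + (t + t') + q * p \<le> q * p' + 1 + bcost b) \<sigma>2"
          proof (rule wp_mono)
            fix t' \<sigma>'
            assume "\<exists>p'. I p' \<sigma>' \<and> \<not> bval b \<sigma>' \<and> t' + q * p2 \<le> q * p' + 1 + bcost b"
            moreover have "q + q * p \<le> q * p2"
              using mult_le_mono2[of "Suc p" p2 q] p2(1) by simp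
            ultimately show "\<exists>p'. I p' \<sigma>' \<and> \<not> bval b \<sigma>' \<and>
                1 + bcost b + (t + t') + q * p \<le> q * p' + 1 + bcost b"
              using t by (elim exE) (rule exI, auto)
          qed
        qed
      qed
    qed
  qed
  from this[OF \<open>I p \<sigma>\<close> frame_refl] show ?thesis .
qed

lemma wp_While_counter:
  assumes "I 0 \<sigma>"
    and "\<And>i \<sigma>'. I i \<sigma>' \<Longrightarrow> frame P \<sigma> \<sigma>' \<Longrightarrow> i \<le> F \<and> bsafe w b \<sigma>' \<and> (bval b \<sigma>' \<longleftrightarrow> i < F)"
    and "\<And>i \<sigma>'. I i \<sigma>' \<Longrightarrow> frame P \<sigma> \<sigma>' \<Longrightarrow> i < F \<Longrightarrow>
      wp w P (\<lambda>t \<sigma>''. 1 + bcost b + t \<le> q \<and> I (Suc i) \<sigma>'') \<sigma>'"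
  shows "wp w (While b P) (\<lambda>t \<sigma>'. I F \<sigma>' \<and> frame P \<sigma> \<sigma>' \<and> t \<le> q * F + 1 + bcost b) \<sigma>"
proof (rule wp_mono[OF wp_frame[OF wp_While[where I = I and p = 0 and F = F and q = q]]])
  fix i \<sigma>' assume inv: "I i \<sigma>'" "frame P \<sigma> \<sigma>'"
  show "i \<le> F" "bsafe w b \<sigma>'" using assms(2)[OF inv] by auto
  assume "bval b \<sigma>'"
  then have "i < F" using assms(2)[OF inv] by blast
  from assms(3)[OF inv this]
  show "wp w P (\<lambda>t \<sigma>''. 1 + bcost b + t \<le> q \<and> (\<exists>p'>i. I p' \<sigma>'')) \<sigma>'"
    by (rule wp_mono) auto
next
  fix t \<sigma>'
  assume "(\<exists>p'. I p' \<sigma>' \<and> \<not> bval b \<sigma>' \<and> t + q * 0 \<le> q * p' + 1 + bcost b) \<and>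
    frame (While b P) \<sigma> \<sigma>'"
  then obtain i where i: "I i \<sigma>'" "\<not> bval b \<sigma>'" "t \<le> q * i + 1 + bcost b" "frame P \<sigma> \<sigma>'"
    by auto
  moreover from this have "i = F" using assms(2)[of i \<sigma>'] by auto
  ultimately show "I F \<sigma>' \<and> frame P \<sigma> \<sigma>' \<and> t \<le> q * F + 1 + bcost b" by simp
qed (fact assms(1))

fun vc :: "nat \<Rightarrow> com \<Rightarrow> (nat \<Rightarrow> state \<Rightarrow> bool) \<Rightarrow> state \<Rightarrow> bool" where
  "vc w Skip Q \<sigma> \<longleftrightarrow> Q 1 \<sigma>"
| "vc w (Assign x e) Q \<sigma> \<longleftrightarrow>
     asafe w e \<sigma> \<and> Q (1 + acost e) (\<sigma>\<lparr>regs := (regs \<sigma>)(x := aval e \<sigma>)\<rparr>)"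
| "vc w (Store a i e) Q \<sigma> \<longleftrightarrow>
     asafe w i \<sigma> \<and> asafe w e \<sigma> \<and>
     Q (1 + acost i + acost e) (\<sigma>\<lparr>arrs := (arrs \<sigma>)(a := (arrs \<sigma> a)(aval i \<sigma> := aval e \<sigma>))\<rparr>)"
| "vc w (Seq P R) Q \<sigma> \<longleftrightarrow> vc w P (\<lambda>t. vc w R (\<lambda>t'. Q (t + t'))) \<sigma>"
| "vc w (Cond b P R) Q \<sigma> \<longleftrightarrow>
     bsafe w b \<sigma> \<and>
     (if bval b \<sigma> then vc w P (\<lambda>t. Q (1 + bcost b + t)) \<sigma> else vc w R (\<lambda>t. Q (1 + bcost b + t)) \<sigma>)"
| "vc w (While b P) Q \<sigma> \<longleftrightarrow> wp w (While b P) Q \<sigma>"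

lemma vc_wp: "vc w P Q \<sigma> \<Longrightarrow> wp w P Q \<sigma>"
proof (induction P arbitrary: Q \<sigma>)
  case Skip
  then show ?case unfolding wp_def using exec.Skip by (metis vc.simps(1))
next
  case (Assign x e)
  then show ?case unfolding wp_def by (metis vc.simps(2) exec.Assign asafe_afits)
next
  case (Store a i e)
  then show ?case unfolding wp_def by (metis vc.simps(3) exec.Store asafe_afits)
next
  case (Seq P R)
  then have "wp w P (\<lambda>t. vc w R (\<lambda>t'. Q (t + t'))) \<sigma>" by simp
  then show ?case by (rule wp_Seq) (rule Seq.IH(2))
next
  case (Cond b P R)
  then show ?case by (cases "bval b \<sigma>") (auto intro: wp_CondTrue wp_CondFalse)
qed simp

section \<open>The program\<close>

abbreviation incr :: "string \<Rightarrow> com" where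
  "incr x \<equiv> Assign x (BinOp Add (Reg x) (Const 1))"

abbreviation block :: "com list \<Rightarrow> com" where
  "block cs \<equiv> foldr Seq cs Skip"

definition prepare :: com where
  "prepare = block
     [Store ''start'' (Reg ''cnt'') (Reg ''tot''),
      Store ''deg'' (Reg ''cnt'') (Reg ''degree''),
      Store ''par'' (Reg ''cnt'') (Reg ''cnt''),
      Assign ''u'' (Reg ''cnt''), Assign ''found'' (Const 0), Assign ''k'' (Const 0)]"

definition copy_guard :: bexp where
  "copy_guard = Less (Reg ''k'') (Reg ''degree'')"

definition copy_body :: com where
  "copy_body = block
     [Store ''adj'' (Reg ''tot'') (Load ''neighbours'' (Reg ''k'')), incr ''tot'', incr ''k'']"

definition dfs_guard :: bexp where
  "dfs_guard = Conj (Equal (Reg ''found'') (Const 0))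
     (Conj (Neg (Less (Reg ''cap'') (Load ''lab'' (Reg ''cnt''))))
       (Less (Load ''lab'' (Reg ''cnt'')) (Reg ''servers'')))"

definition dfs_body :: com where
  "dfs_body =
     Cond (Less (Load ''cur'' (Reg ''u'')) (Load ''deg'' (Reg ''u'')))
       (block
         [Assign ''v''
            (Load ''adj'' (BinOp Add (Load ''start'' (Reg ''u'')) (Load ''cur'' (Reg ''u'')))),
          Assign ''x'' (Load ''mate'' (Reg ''v'')),
          Cond (Equal (Reg ''x'') (Const 0))
            (Assign ''found'' (BinOp Add (Reg ''v'') (Const 1)))
            (block
              [Assign ''x'' (BinOp Sub (Reg ''x'') (Const 1)),
               Cond (Less (Load ''lab'' (Reg ''x'')) (Load ''lab'' (Reg ''u'')))
                 (block [Store ''par'' (Reg ''x'') (Reg ''u''), Assign ''u'' (Reg ''x'')])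
                 (Store ''cur'' (Reg ''u'') (BinOp Add (Load ''cur'' (Reg ''u'')) (Const 1)))])])
       (block
         [Store ''lab'' (Reg ''u'') (BinOp Add (Load ''lab'' (Reg ''u'')) (Const 1)),
          Store ''cur'' (Reg ''u'') (Const 0),
          Assign ''u'' (Load ''par'' (Reg ''u''))])"

definition bfs_init :: com where
  "bfs_init = block
     [Store ''queue'' (Const 0) (Reg ''cnt''),
      Store ''seen'' (Reg ''cnt'') (BinOp Add (Reg ''cnt'') (Const 1)),
      Assign ''qh'' (Const 0), Assign ''qt'' (Const 1), Assign ''u'' (Reg ''cnt''),
      Assign ''p'' (Const 0)]"

definition bfs_guard :: bexp where
  "bfs_guard = Conj (Equal (Reg ''found'') (Const 0)) (Less (Reg ''qh'') (Reg ''qt''))"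

definition bfs_body :: com where
  "bfs_body =
     Cond (Less (Reg ''p'') (Load ''deg'' (Reg ''u'')))
       (block
         [Assign ''v'' (Load ''adj'' (BinOp Add (Load ''start'' (Reg ''u'')) (Reg ''p''))),
          Assign ''x'' (Load ''mate'' (Reg ''v'')),
          Cond (Equal (Reg ''x'') (Const 0))
            (Assign ''found'' (BinOp Add (Reg ''v'') (Const 1)))
            (block
              [Assign ''x'' (BinOp Sub (Reg ''x'') (Const 1)),
               Cond (Conj
                   (Neg (Equal (Load ''seen'' (Reg ''x'')) (BinOp Add (Reg ''cnt'') (Const 1))))
                      (Less (Load ''lab'' (Reg ''x'')) (Reg ''servers'')))
                 (block
                   [Store ''par'' (Reg ''x'') (Reg ''u''),
                    Store ''seen'' (Reg ''x'') (BinOp Add (Reg ''cnt'') (Const 1)),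
                    Store ''queue'' (Reg ''qt'') (Reg ''x''),
                    incr ''qt''])
                 Skip,
               incr ''p''])])
       (block
         [incr ''qh'', Assign ''u'' (Load ''queue'' (Reg ''qh'')), Assign ''p'' (Const 0)])"

definition kill_guard :: bexp where
  "kill_guard = Less (Reg ''k'') (Reg ''qt'')"

definition kill_body :: com where
  "kill_body = block
     [Store ''lab'' (Load ''queue'' (Reg ''k'')) (Reg ''servers''), incr ''k'']"

definition flip_guard :: bexp where
  "flip_guard = Neg (Equal (Reg ''found'') (Const 0))"

definition flip_body :: com where
  "flip_body = block
     [Assign ''x'' (Load ''match'' (Reg ''u'')),
      Store ''match'' (Reg ''u'') (Reg ''found''),
      Store ''mate'' (BinOp Sub (Reg ''found'') (Const 1)) (BinOp Add (Reg ''u'') (Const 1)),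
      Cond (Less (Load ''lab'' (Reg ''u'')) (Reg ''k''))
        (block [Store ''lab'' (Reg ''u'') (Reg ''k''), Store ''cur'' (Reg ''u'') (Const 0)])
        Skip,
      incr ''k'',
      Assign ''found'' (Reg ''x''),
      Assign ''u'' (Load ''par'' (Reg ''u''))]"

definition record_client :: com where
  "record_client = Seq prepare (While copy_guard copy_body)"

definition bfs_settle :: com where
  "bfs_settle =
     Cond (Equal (Reg ''found'') (Const 0))
       (Seq (Assign ''k'' (Const 0)) (While kill_guard kill_body))
       (incr ''cap'')"

definition bfs_phase :: com where
  "bfs_phase = Seq bfs_init (Seq (While bfs_guard bfs_body) bfs_settle)"

definition search_rest :: com where
  "search_rest =
     Cond (Conj (Equal (Reg ''found'') (Const 0))
         (Less (Load ''lab'' (Reg ''cnt'')) (Reg ''servers'')))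
       bfs_phase
       Skip"

definition flip_path :: com where
  "flip_path =
     Seq (Assign ''k'' (Const 0)) (Seq (While flip_guard flip_body) (incr ''cnt''))"

text \<open>
  \<open>cap\<close> counts the successful breadth-first searches and is at the same time the largest label up to
  which the depth-first search works.
\<close>

definition sap_program :: com where
  "sap_program = Seq record_client (Seq (While dfs_guard dfs_body) (Seq search_rest flip_path))"

lemma written_regs_program [simp]:
  "written_regs prepare = {''u'', ''found'', ''k''}"
  "written_regs copy_body = {''tot'', ''k''}"
  "written_regs dfs_body = {''v'', ''x'', ''found'', ''u''}"
  "written_regs bfs_init = {''qh'', ''qt'', ''u'', ''p''}"
  "written_regs bfs_body = {''v'', ''x'', ''found'', ''qt'', ''p'', ''qh'', ''u''}"
  "written_regs kill_body = {''k''}"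
  "written_regs flip_body = {''x'', ''k'', ''found'', ''u''}"
  by (auto simp: prepare_def copy_body_def dfs_body_def bfs_init_def bfs_body_def kill_body_def
      flip_body_def)

lemma written_regs_phases [simp]:
  "written_regs record_client = {''u'', ''found'', ''tot'', ''k''}"
  "written_regs search_rest =
     {''qh'', ''qt'', ''u'', ''p'', ''v'', ''x'', ''found'', ''k'', ''cap''}"
  "written_regs flip_path = {''k'', ''x'', ''found'', ''u'', ''cnt''}"
  by (auto simp: record_client_def search_rest_def bfs_phase_def bfs_settle_def flip_path_def)

lemma written_arrs_program [simp]:
  "written_arrs prepare = {''start'', ''deg'', ''par''}"
  "written_arrs copy_body = {''adj''}"
  "written_arrs dfs_body = {''par'', ''cur'', ''lab''}"
  "written_arrs bfs_init = {''queue'', ''seen''}"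
  "written_arrs bfs_body = {''par'', ''seen'', ''queue''}"
  "written_arrs kill_body = {''lab''}"
  "written_arrs flip_body = {''match'', ''mate'', ''lab'', ''cur''}"
  by (auto simp: prepare_def copy_body_def dfs_body_def bfs_init_def bfs_body_def kill_body_def
      flip_body_def)

lemma written_arrs_phases [simp]:
  "written_arrs record_client = {''start'', ''deg'', ''par'', ''adj''}"
  "written_arrs search_rest = {''queue'', ''seen'', ''par'', ''lab''}"
  "written_arrs flip_path = {''match'', ''mate'', ''lab'', ''cur''}"
  by (auto simp: record_client_def search_rest_def bfs_phase_def bfs_settle_def flip_path_def)

section \<open>The memory of the program\<close>

definition partner :: "(nat \<Rightarrow> nat) \<Rightarrow> nat \<rightharpoonup> nat" where
  "partner a x = (case a x of 0 \<Rightarrow> None | Suc y \<Rightarrow> Some y)"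

lemma partner_eq_Some_iff [simp]: "partner a x = Some y \<longleftrightarrow> a x = Suc y"
  by (simp add: partner_def split: nat.split)

lemma partner_eq_None_iff [simp]: "partner a x = None \<longleftrightarrow> a x = 0"
  by (simp add: partner_def split: nat.split)

lemma partner_upd_prefix:
  "partner (upd_prefix a x (\<lambda>j. Suc (y j)) i) = upd_prefix (partner a) x (\<lambda>j. Some (y j)) i"
  by (induction i) (auto simp: fun_eq_iff partner_def)

abbreviation match_in :: "state \<Rightarrow> nat \<Rightarrow> nat" where
  "match_in \<sigma> \<equiv> arrs \<sigma> ''match''"

abbreviation mate_in :: "state \<Rightarrow> nat \<Rightarrow> nat" where
  "mate_in \<sigma> \<equiv> arrs \<sigma> ''mate''"

abbreviation lab_in :: "state \<Rightarrow> nat \<Rightarrow> nat" where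
  "lab_in \<sigma> \<equiv> arrs \<sigma> ''lab''"

abbreviation cur_in :: "state \<Rightarrow> nat \<Rightarrow> nat" where
  "cur_in \<sigma> \<equiv> arrs \<sigma> ''cur''"

abbreviation par_in :: "state \<Rightarrow> nat \<Rightarrow> nat" where
  "par_in \<sigma> \<equiv> arrs \<sigma> ''par''"

abbreviation seen_in :: "state \<Rightarrow> nat \<Rightarrow> nat" where
  "seen_in \<sigma> \<equiv> arrs \<sigma> ''seen''"

abbreviation matching_in :: "state \<Rightarrow> nat \<rightharpoonup> nat" where
  "matching_in \<sigma> \<equiv> partner (match_in \<sigma>)"

definition mates :: "state \<Rightarrow> bool" where
  "mates \<sigma> \<longleftrightarrow> (\<forall>u v. mate_in \<sigma> v = Suc u \<longleftrightarrow> match_in \<sigma> u = Suc v)"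

lemma mate_eq_Suc_iff: "mates \<sigma> \<Longrightarrow> mate_in \<sigma> v = Suc u \<longleftrightarrow> matching_in \<sigma> u = Some v"
  by (simp add: mates_def)

lemma mate_eq_0_iff:
  assumes "mates \<sigma>"
  shows "mate_in \<sigma> v = 0 \<longleftrightarrow> v \<notin> ran (matching_in \<sigma>)"
  using mate_eq_Suc_iff[OF assms, of v] by (cases "mate_in \<sigma> v") (auto simp: ran_def)

lemma matching_of_eq:
  assumes "\<And>u. i \<le> u \<Longrightarrow> match_in \<sigma> u = 0"
  shows "matching_of i \<sigma> = matching_edges (matching_in \<sigma>)"
proof -
  have "u < i" if "match_in \<sigma> u = Suc v" for u v
    using assms[of u] that by (cases "u < i") auto
  then show ?thesis unfolding matching_of_def matching_edges_def by auto
qed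

locale sap_run =
  fixes A :: "nat \<Rightarrow> nat list" and s n m w :: nat
  assumes servers: "u < n \<Longrightarrow> set (A u) \<subseteq> {..<s}"
    and edges: "(\<Sum>u<n. length (A u)) = m"
    and word: "s + n + m + 2 \<le> 2 ^ w"
begin

abbreviation dist_in :: "state \<Rightarrow> nat \<Rightarrow> enat" where
  "dist_in \<sigma> \<equiv> free_dist (nbrs A) (matching_in \<sigma>)"

abbreviation augmentation_in ::
  "state \<Rightarrow> nat \<Rightarrow> nat \<Rightarrow> (nat \<Rightarrow> nat) \<Rightarrow> (nat \<Rightarrow> nat) \<Rightarrow> bool" where
  "augmentation_in \<sigma> \<equiv> shortest_augmentation (nbrs A) (matching_in \<sigma>)"

lemma sum_length_le: "N \<le> n \<Longrightarrow> (\<Sum>u<N. length (A u)) \<le> m"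
  unfolding edges[symmetric] by (intro sum_mono2) auto

lemma length_le: "u < n \<Longrightarrow> length (A u) \<le> m"
  unfolding edges[symmetric] by (intro member_le_sum) auto

lemma weight_le: "C \<subseteq> {..<n} \<Longrightarrow> weight A C \<le> m + n"
  using weight_mono[of "{..<n}" C A] edges sum.distrib[of "\<lambda>u. length (A u)" "\<lambda>_. 1" "{..<n}"]
  by (simp add: weight_def)

lemma less_word: "a < s + n + m + 2 \<Longrightarrow> a < 2 ^ w"
  using word by linarith

definition stored :: "nat \<Rightarrow> state \<Rightarrow> bool" where
  "stored N \<sigma> \<longleftrightarrow>
     regs \<sigma> ''servers'' = s \<and> regs \<sigma> ''tot'' = (\<Sum>u<N. length (A u)) \<and>
     (\<forall>u<N. arrs \<sigma> ''deg'' u = length (A u) \<and>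
        arrs \<sigma> ''start'' u + length (A u) \<le> regs \<sigma> ''tot'' \<and>
        (\<forall>i<length (A u). arrs \<sigma> ''adj'' (arrs \<sigma> ''start'' u + i) = A u ! i))"

text \<open>The adjacency lists of \<open>N\<close> clients are stored, of which the first \<open>c\<close> have been processed.\<close>

definition memory :: "nat \<Rightarrow> nat \<Rightarrow> state \<Rightarrow> bool" where
  "memory N c \<sigma> \<longleftrightarrow>
     stored N \<sigma> \<and> regs \<sigma> ''cnt'' = c \<and> mates \<sigma> \<and> (\<forall>u\<ge>c. match_in \<sigma> u = 0)"

lemma memory_regs:
  assumes "memory N c \<sigma>"
  shows "regs \<sigma> ''servers'' = s" and "regs \<sigma> ''cnt'' = c"
  using assms unfolding memory_def stored_def by blast+

lemma stored_cong:
  assumes "regs \<sigma>' ''servers'' = regs \<sigma> ''servers''" and "regs \<sigma>' ''tot'' = regs \<sigma> ''tot''"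
    and "arrs \<sigma>' ''deg'' = arrs \<sigma> ''deg''" and "arrs \<sigma>' ''start'' = arrs \<sigma> ''start''"
    and "arrs \<sigma>' ''adj'' = arrs \<sigma> ''adj''"
  shows "stored N \<sigma>' \<longleftrightarrow> stored N \<sigma>"
  using assms by (simp add: stored_def)

lemma memory_frame:
  assumes "memory N c \<sigma>" and "frame P \<sigma> \<sigma>'"
    and "{''servers'', ''tot'', ''cnt''} \<inter> written_regs P = {}"
    and "{''deg'', ''start'', ''adj'', ''match'', ''mate''} \<inter> written_arrs P = {}"
  shows "memory N c \<sigma>'"
proof -
  have regs: "regs \<sigma>' x = regs \<sigma> x" if "x \<in> {''servers'', ''tot'', ''cnt''}" for x
    using that assms(2,3) unfolding frame_def by blast
  have arrs: "arrs \<sigma>' a = arrs \<sigma> a"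
    if "a \<in> {''deg'', ''start'', ''adj'', ''match'', ''mate''}" for a
    using that assms(2,4) unfolding frame_def by blast
  have "stored N \<sigma>' \<longleftrightarrow> stored N \<sigma>" by (intro stored_cong regs arrs) simp_all
  then show ?thesis using assms(1) by (simp add: memory_def mates_def regs arrs)
qed

lemma memory_read:
  assumes "memory (Suc c) c \<sigma>" and "u \<le> c" and "c < n"
  shows "arrs \<sigma> ''deg'' u = length (A u)"
    and "i < length (A u) \<Longrightarrow> arrs \<sigma> ''adj'' (arrs \<sigma> ''start'' u + i) = A u ! i"
    and "i < length (A u) \<Longrightarrow> arrs \<sigma> ''start'' u + i < 2 ^ w"
    and "i < length (A u) \<Longrightarrow> Suc (A u ! i) < 2 ^ w"
    and "i < length (A u) \<Longrightarrow> Suc i < 2 ^ w"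
proof -
  have u: "arrs \<sigma> ''deg'' u = length (A u)" "arrs \<sigma> ''start'' u + length (A u) \<le> m"
    "\<forall>i<length (A u). arrs \<sigma> ''adj'' (arrs \<sigma> ''start'' u + i) = A u ! i"
    using assms sum_length_le[of "Suc c"] unfolding memory_def stored_def
    by (auto simp: less_Suc_eq_le simp del: sum.lessThan_Suc)
  then show "arrs \<sigma> ''deg'' u = length (A u)" by simp
  assume i: "i < length (A u)"
  then show "arrs \<sigma> ''adj'' (arrs \<sigma> ''start'' u + i) = A u ! i" using u by simp
  show "arrs \<sigma> ''start'' u + i < 2 ^ w" using u i by (intro less_word) simp
  have "A u ! i < s" using servers[of u] assms(2,3) nth_mem[OF i] by auto
  then show "Suc (A u ! i) < 2 ^ w" by (intro less_word) simp
  show "Suc i < 2 ^ w" using i length_le[of u] assms(2,3) by (intro less_word) simp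
qed

lemma dom_matching_in:
  assumes "memory N c \<sigma>"
  shows "dom (matching_in \<sigma>) \<subseteq> {..<c}"
proof
  fix u assume "u \<in> dom (matching_in \<sigma>)"
  then have "match_in \<sigma> u \<noteq> 0" by auto
  moreover have "\<forall>u\<ge>c. match_in \<sigma> u = 0" using assms unfolding memory_def by blast
  ultimately show "u \<in> {..<c}" by (meson lessThan_iff not_le)
qed

section \<open>The depth-first search loop\<close>

lemma wp_dfs_body_scan:
  assumes mem: "memory (Suc c) c \<sigma>" and u: "regs \<sigma> ''u'' = u" "u \<le> c" and c: "c < n"
    and i: "cur_in \<sigma> u = i" "i < length (A u)" and v: "A u ! i = v"
  shows "mate_in \<sigma> v = 0 \<Longrightarrow>
      wp w dfs_body (\<lambda>t \<sigma>'. t \<le> 55 \<and>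
        \<sigma>' = \<sigma>\<lparr>regs := (regs \<sigma>)(''v'' := v, ''x'' := 0, ''found'' := Suc v)\<rparr>) \<sigma>"
    and "mate_in \<sigma> v = Suc x \<Longrightarrow> lab_in \<sigma> x < lab_in \<sigma> u \<Longrightarrow>
      wp w dfs_body (\<lambda>t \<sigma>'. t \<le> 55 \<and>
        \<sigma>' = \<sigma>\<lparr>regs := (regs \<sigma>)(''v'' := v, ''x'' := x, ''u'' := x),
               arrs := (arrs \<sigma>)(''par'' := (par_in \<sigma>)(x := u))\<rparr>) \<sigma>"
    and "mate_in \<sigma> v = Suc x \<Longrightarrow> \<not> lab_in \<sigma> x < lab_in \<sigma> u \<Longrightarrow>
      wp w dfs_body (\<lambda>t \<sigma>'. t \<le> 55 \<and>
        \<sigma>' = \<sigma>\<lparr>regs := (regs \<sigma>)(''v'' := v, ''x'' := x),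
               arrs := (arrs \<sigma>)(''cur'' := (cur_in \<sigma>)(u := Suc i))\<rparr>) \<sigma>"
  using memory_read(1)[OF mem u(2) c] memory_read(2-5)[OF mem u(2) c, of i] u(1) i v less_word[of 1]
  by (auto intro!: vc_wp simp: dfs_body_def)

lemma wp_dfs_body_relabel:
  assumes mem: "memory (Suc c) c \<sigma>" and u: "regs \<sigma> ''u'' = u" "u \<le> c" and c: "c < n"
    and "\<not> cur_in \<sigma> u < length (A u)" and l: "lab_in \<sigma> u = l" "l < s"
  shows "wp w dfs_body (\<lambda>t \<sigma>'. t \<le> 55 \<and>
    \<sigma>' = \<sigma>\<lparr>regs := (regs \<sigma>)(''u'' := par_in \<sigma> u),
           arrs := (arrs \<sigma>)(''lab'' := (lab_in \<sigma>)(u := Suc l), ''cur'' := (cur_in \<sigma>)(u := 0))\<rparr>) \<sigma>"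
  using memory_read(1)[OF mem u(2) c] u(1) assms(5) l less_word[of 1] less_word[of "Suc l"]
  by (auto intro!: vc_wp simp: dfs_body_def)

definition labels :: "nat \<Rightarrow> state \<Rightarrow> bool" where
  "labels N \<sigma> \<longleftrightarrow> labelled_matching A (matching_in \<sigma>) (lab_in \<sigma>) (cur_in \<sigma>) \<and>
     (\<forall>u\<ge>N. lab_in \<sigma> u = 0)"

definition dfs_inv :: "nat \<Rightarrow> nat \<Rightarrow> state \<Rightarrow> bool" where
  "dfs_inv c k \<sigma> \<longleftrightarrow>
     dfs A (matching_in \<sigma>) (lab_in \<sigma>) (cur_in \<sigma>) c (par_in \<sigma>) (regs \<sigma> ''u'') k \<and>
     (\<forall>u>c. lab_in \<sigma> u = 0) \<and> lab_in \<sigma> c \<le> Suc (regs \<sigma> ''cap'') \<and>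
     (regs \<sigma> ''found'' \<noteq> 0 \<longrightarrow>
        (\<exists>v \<in> set (A (regs \<sigma> ''u'')). regs \<sigma> ''found'' = Suc v \<and> mate_in \<sigma> v = 0))"

lemma dfs_inv_labels: "dfs_inv c k \<sigma> \<Longrightarrow> labels (Suc c) \<sigma>"
  by (auto simp: labels_def dfs_inv_def dfs_def Suc_le_eq)

lemma dfs_inv_depth_le:
  assumes "dfs_inv c k \<sigma>"
  shows "k \<le> Suc (regs \<sigma> ''cap'')"
proof -
  interpret dfs A "matching_in \<sigma>" "lab_in \<sigma>" "cur_in \<sigma>" c "par_in \<sigma>" "regs \<sigma> ''u''" k
    using assms unfolding dfs_inv_def by blast
  show ?thesis using lab_add_depth_le assms by (simp add: dfs_inv_def)
qed

definition scan_pot_of :: "nat \<Rightarrow> state \<Rightarrow> nat" where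
  "scan_pot_of N \<sigma> = scan_pot A (Suc (regs \<sigma> ''cap'')) {..<N} (lab_in \<sigma>) (cur_in \<sigma>)"

definition dfs_progress :: "nat \<Rightarrow> nat \<Rightarrow> state \<Rightarrow> nat" where
  "dfs_progress c k \<sigma> = 2 * scan_pot_of (Suc c) \<sigma> + k + (if regs \<sigma> ''found'' = 0 then 0 else 1)"

definition dfs_step :: "nat \<Rightarrow> nat \<Rightarrow> state \<Rightarrow> nat \<Rightarrow> state \<Rightarrow> bool" where
  "dfs_step c k \<sigma> t \<sigma>' \<longleftrightarrow> t \<le> 55 \<and> (\<exists>k'. dfs_inv c k' \<sigma>' \<and>
     lab_in \<sigma> \<le> lab_in \<sigma>' \<and> dfs_progress c k \<sigma> < dfs_progress c k' \<sigma>')"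

context
  fixes c k :: nat and \<sigma> :: state and u :: nat
  assumes mem: "memory (Suc c) c \<sigma>" and inv: "dfs_inv c k \<sigma>" and guard: "bval dfs_guard \<sigma>"
    and c: "c < n" and u: "regs \<sigma> ''u'' = u"
begin

interpretation dfs A "matching_in \<sigma>" "lab_in \<sigma>" "cur_in \<sigma>" c "par_in \<sigma>" u k
  using inv u unfolding dfs_inv_def by blast

lemma dfs_current_le: "u \<le> c"
  using current_in_insert_dom dom_matching_in[OF mem] by auto

lemma dfs_guard_facts:
  "regs \<sigma> ''found'' = 0" "lab_in \<sigma> c \<le> regs \<sigma> ''cap''"
  "lab_in \<sigma> u \<le> regs \<sigma> ''cap''" "lab_in \<sigma> u < s"
  using guard mem lab_add_depth_le by (auto simp: dfs_guard_def memory_def stored_def)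

lemma dfs_fresh: "\<forall>x>c. lab_in \<sigma> x = 0"
  using inv unfolding dfs_inv_def by blast

lemmas dfs_step_simps =
  dfs_step_def dfs_inv_def dfs_progress_def scan_pot_of_def dfs_guard_facts dfs_fresh le_SucI

lemma wp_dfs_body_case_scan:
  assumes i: "cur_in \<sigma> u = i" "i < length (A u)"
  shows "wp w dfs_body (dfs_step c k \<sigma>) \<sigma>"
proof -
  have mates: "mates \<sigma>" using mem by (simp add: memory_def)
  note body = wp_dfs_body_scan[OF mem u dfs_current_le c i refl]
  show ?thesis
  proof (cases "mate_in \<sigma> (A u ! i)")
    case 0
    show ?thesis
      by (rule wp_mono[OF body(1)[OF 0]])
        (use dfs_axioms i 0 u in \<open>auto simp: dfs_step_simps intro!: exI[of _ k]\<close>)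
  next
    case (Suc x)
    then have x: "matching_in \<sigma> x = Some (A u ! i)" using mate_eq_Suc_iff[OF mates] by blast
    show ?thesis
    proof (cases "lab_in \<sigma> x < lab_in \<sigma> u")
      case True
      have "dfs A (matching_in \<sigma>) (lab_in \<sigma>) (cur_in \<sigma>) c ((par_in \<sigma>)(x := u)) x (Suc k)"
        using i by (intro dfs_advance[OF _ x True]) simp
      then show ?thesis
        by (intro wp_mono[OF body(2)[OF Suc True]])
          (auto simp: dfs_step_simps intro!: exI[of _ "Suc k"])
    next
      case False
      have "dfs A (matching_in \<sigma>) (lab_in \<sigma>) ((cur_in \<sigma>)(u := Suc i)) c (par_in \<sigma>) u k"
        using dfs_next_arc[OF _ _ False] i x by simp
      moreover have "scan_pot A (Suc (regs \<sigma> ''cap'')) {..<Suc c} (lab_in \<sigma>)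
          ((cur_in \<sigma>)(u := Suc i)) =
          Suc (scan_pot_of (Suc c) \<sigma>)"
        unfolding scan_pot_of_def i(1)[symmetric]
        using dfs_current_le dfs_guard_facts by (intro scan_pot_next_arc) auto
      ultimately show ?thesis using u
        by (intro wp_mono[OF body(3)[OF Suc False]]) (auto simp: dfs_step_simps intro!: exI[of _ k])
    qed
  qed
qed

lemma wp_dfs_body_case_relabel:
  assumes "\<not> cur_in \<sigma> u < length (A u)"
  shows "wp w dfs_body (dfs_step c k \<sigma>) \<sigma>"
proof -
  let ?lab = "(lab_in \<sigma>)(u := Suc (lab_in \<sigma> u))" and ?cur = "(cur_in \<sigma>)(u := 0)"
  have cur: "cur_in \<sigma> u = length (A u)" using assms cur_le_length[of u] by simp
  have "dfs A (matching_in \<sigma>) ?lab ?cur c (par_in \<sigma>) (par_in \<sigma> u) (k - 1)"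
    by (rule dfs_relabel[OF cur])
  moreover have "scan_pot A (Suc (regs \<sigma> ''cap'')) {..<Suc c} ?lab ?cur =
      Suc (scan_pot_of (Suc c) \<sigma>)"
    unfolding scan_pot_of_def using dfs_current_le dfs_guard_facts cur
    by (intro scan_pot_relabel) auto
  ultimately show ?thesis using dfs_current_le dfs_guard_facts
    by (intro wp_mono[OF wp_dfs_body_relabel[OF mem u dfs_current_le c assms refl]])
      (auto simp: dfs_step_simps le_fun_def intro!: exI[of _ "k - 1"])
qed

lemma wp_dfs_body: "wp w dfs_body (dfs_step c k \<sigma>) \<sigma>"
  using wp_dfs_body_case_scan[OF refl] wp_dfs_body_case_relabel by blast

end

lemma dfs_progress_le_scan_pot:
  "dfs_inv c k \<sigma> \<Longrightarrow> dfs_progress c k \<sigma> \<le> 2 * scan_pot_of (Suc c) \<sigma> + regs \<sigma> ''cap'' + 2"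
  using dfs_inv_depth_le[of c k \<sigma>] by (simp add: dfs_progress_def)

lemma scan_pot_of_le:
  assumes "N \<le> n"
  shows "scan_pot_of N \<sigma> \<le> Suc (regs \<sigma> ''cap'') * (m + n)"
proof -
  have "scan_pot_of N \<sigma> \<le> Suc (regs \<sigma> ''cap'') * weight A {..<N}"
    unfolding scan_pot_of_def by (rule scan_pot_le)
  also have "\<dots> \<le> Suc (regs \<sigma> ''cap'') * (m + n)"
    using assms by (intro mult_le_mono2 weight_le) auto
  finally show ?thesis .
qed

text \<open>No iteration of a loop of the program takes more than 80 steps.\<close>

definition dfs_post :: "nat \<Rightarrow> state \<Rightarrow> nat \<Rightarrow> state \<Rightarrow> bool" where
  "dfs_post c \<sigma> t \<sigma>' \<longleftrightarrow>
     \<not> bval dfs_guard \<sigma>' \<and> (\<exists>k. dfs_inv c k \<sigma>') \<and> lab_in \<sigma> \<le> lab_in \<sigma>' \<and>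
     t + 160 * scan_pot_of (Suc c) \<sigma> \<le>
       160 * scan_pot_of (Suc c) \<sigma>' + 80 * (regs \<sigma> ''cap'' + 2) + 20"

lemma wp_dfs:
  assumes mem: "memory (Suc c) c \<sigma>" and inv: "dfs_inv c 0 \<sigma>" and c: "c < n"
    and found: "regs \<sigma> ''found'' = 0"
  shows "wp w (While dfs_guard dfs_body) (dfs_post c \<sigma>) \<sigma>"
proof -
  let ?I = "\<lambda>p \<sigma>'. \<exists>k. dfs_inv c k \<sigma>' \<and> lab_in \<sigma> \<le> lab_in \<sigma>' \<and> p = dfs_progress c k \<sigma>'"
  have bcost: "bcost dfs_guard \<le> 19" by (simp add: dfs_guard_def)
  have cap: "regs \<sigma>' ''cap'' = regs \<sigma> ''cap''" if "frame dfs_body \<sigma> \<sigma>'" for \<sigma>'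
    using that by (simp add: frame_def)
  have "wp w (While dfs_guard dfs_body) (\<lambda>t \<sigma>'. \<exists>p. ?I p \<sigma>' \<and> \<not> bval dfs_guard \<sigma>' \<and>
      t + 80 * dfs_progress c 0 \<sigma> \<le> 80 * p + 1 + bcost dfs_guard) \<sigma>"
  proof (rule wp_While)
    show "?I (dfs_progress c 0 \<sigma>) \<sigma>" using inv by blast
  next
    fix p \<sigma>' assume "?I p \<sigma>'" and frame: "frame dfs_body \<sigma> \<sigma>'"
    then obtain k where inv': "dfs_inv c k \<sigma>'" "lab_in \<sigma> \<le> lab_in \<sigma>'"
      and p: "p = dfs_progress c k \<sigma>'" by blast
    show "p \<le> 2 * (Suc (regs \<sigma> ''cap'') * (m + n)) + regs \<sigma> ''cap'' + 2"
      using dfs_progress_le_scan_pot[OF inv'(1)] scan_pot_of_le[of "Suc c" \<sigma>'] c cap[OF frame] p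
      by simp
    show "bsafe w dfs_guard \<sigma>'" by (simp add: dfs_guard_def)
    assume "bval dfs_guard \<sigma>'"
    have "memory (Suc c) c \<sigma>'" by (rule memory_frame[OF mem frame]) simp_all
    from wp_dfs_body[OF this inv'(1) \<open>bval dfs_guard \<sigma>'\<close> c refl]
    show "wp w dfs_body (\<lambda>t \<sigma>''. 1 + bcost dfs_guard + t \<le> 80 \<and> (\<exists>p'>p. ?I p' \<sigma>'')) \<sigma>'"
      by (rule wp_mono) (use inv'(2) p bcost in \<open>auto simp: dfs_step_def intro: order_trans\<close>)
  qed
  from wp_frame[OF this] show ?thesis
  proof (rule wp_mono, elim conjE exE)
    fix t \<sigma>' p k
    assume "dfs_inv c k \<sigma>'" "p = dfs_progress c k \<sigma>'" "frame (While dfs_guard dfs_body) \<sigma> \<sigma>'"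
      and "t + 80 * dfs_progress c 0 \<sigma> \<le> 80 * p + 1 + bcost dfs_guard"
    then show "dfs_post c \<sigma> t \<sigma>'" if "lab_in \<sigma> \<le> lab_in \<sigma>'" "\<not> bval dfs_guard \<sigma>'"
      using bcost found cap[of \<sigma>'] dfs_progress_le_scan_pot[of c k \<sigma>'] that
      by (auto simp: dfs_post_def dfs_progress_def)
  qed
qed

section \<open>The breadth-first search loop\<close>

definition queue_in :: "state \<Rightarrow> nat list" where
  "queue_in \<sigma> = map (arrs \<sigma> ''queue'') [0..<regs \<sigma> ''qt'']"

definition bfs_inv :: "nat \<Rightarrow> (nat \<Rightarrow> nat) \<Rightarrow> state \<Rightarrow> bool" where
  "bfs_inv c d \<sigma> \<longleftrightarrow>
     bfs A (matching_in \<sigma>) {x. s \<le> lab_in \<sigma> x} c (par_in \<sigma>) (queue_in \<sigma>) d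
       (regs \<sigma> ''qh'') (regs \<sigma> ''p'') \<and>
     (\<forall>x. seen_in \<sigma> x \<le> Suc c) \<and>
     (\<forall>x. seen_in \<sigma> x = Suc c \<longleftrightarrow> x \<in> set (queue_in \<sigma>)) \<and>
     (regs \<sigma> ''qh'' < regs \<sigma> ''qt'' \<longrightarrow> regs \<sigma> ''u'' = arrs \<sigma> ''queue'' (regs \<sigma> ''qh'')) \<and>
     (regs \<sigma> ''found'' \<noteq> 0 \<longrightarrow> regs \<sigma> ''qh'' < regs \<sigma> ''qt'' \<and>
        (\<exists>v \<in> set (A (regs \<sigma> ''u'')). regs \<sigma> ''found'' = Suc v \<and> mate_in \<sigma> v = 0))"

definition bfs_progress :: "state \<Rightarrow> nat" where
  "bfs_progress \<sigma> = weight A (set (take (regs \<sigma> ''qh'') (queue_in \<sigma>))) + regs \<sigma> ''p'' +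
     (if regs \<sigma> ''found'' = 0 then 0 else 1)"

lemma bfs_inv_queue:
  assumes "memory (Suc c) c \<sigma>" and "bfs_inv c d \<sigma>"
  shows "set (queue_in \<sigma>) \<subseteq> {..c}" and "regs \<sigma> ''qt'' \<le> Suc c"
    and "card (set (queue_in \<sigma>)) = regs \<sigma> ''qt''"
proof -
  interpret bfs A "matching_in \<sigma>" "{x. s \<le> lab_in \<sigma> x}" c "par_in \<sigma>" "queue_in \<sigma>" d
      "regs \<sigma> ''qh''" "regs \<sigma> ''p''"
    using assms(2) unfolding bfs_inv_def by blast
  show subset: "set (queue_in \<sigma>) \<subseteq> {..c}"
    using queue_subset dom_matching_in[OF assms(1)] by fastforce
  show card: "card (set (queue_in \<sigma>)) = regs \<sigma> ''qt''"
    using distinct_card[OF distinct_queue] by (simp add: queue_in_def)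
  show "regs \<sigma> ''qt'' \<le> Suc c"
    using card_mono[OF finite_atMost subset] card by simp
qed

lemma bfs_progress_le_weight_queue:
  assumes "bfs_inv c d \<sigma>"
  shows "bfs_progress \<sigma> \<le> weight A (set (queue_in \<sigma>)) + (if regs \<sigma> ''found'' = 0 then 0 else 1)"
proof -
  interpret bfs A "matching_in \<sigma>" "{x. s \<le> lab_in \<sigma> x}" c "par_in \<sigma>" "queue_in \<sigma>" d
      "regs \<sigma> ''qh''" "regs \<sigma> ''p''"
    using assms unfolding bfs_inv_def by blast
  show ?thesis using weight_take_add_le by (simp add: bfs_progress_def)
qed

lemma weight_queue_le:
  assumes "memory (Suc c) c \<sigma>" and "bfs_inv c d \<sigma>" and "c < n"
  shows "weight A (set (queue_in \<sigma>)) \<le> m + n"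
  using bfs_inv_queue(1)[OF assms(1,2)] assms(3) by (intro weight_le) auto

lemma bfs_progress_le:
  assumes "memory (Suc c) c \<sigma>" and "bfs_inv c d \<sigma>" and "c < n"
  shows "bfs_progress \<sigma> \<le> m + n + 1"
  using bfs_progress_le_weight_queue[OF assms(2)] weight_queue_le[OF assms]
  by (simp split: if_splits)

lemma wp_bfs_body_scan:
  assumes mem: "memory (Suc c) c \<sigma>" and u: "regs \<sigma> ''u'' = u" "u \<le> c" and c: "c < n"
    and i: "regs \<sigma> ''p'' = i" "i < length (A u)" and v: "A u ! i = v"
    and qt: "regs \<sigma> ''qt'' = qt" "qt \<le> Suc c"
  shows "mate_in \<sigma> v = 0 \<Longrightarrow>
      wp w bfs_body (\<lambda>t \<sigma>'. t \<le> 65 \<and>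
        \<sigma>' = \<sigma>\<lparr>regs := (regs \<sigma>)(''v'' := v, ''x'' := 0, ''found'' := Suc v)\<rparr>) \<sigma>"
    and "mate_in \<sigma> v = Suc x \<Longrightarrow> seen_in \<sigma> x \<noteq> Suc c \<Longrightarrow> lab_in \<sigma> x < s \<Longrightarrow>
      wp w bfs_body (\<lambda>t \<sigma>'. t \<le> 65 \<and>
        \<sigma>' = \<sigma>\<lparr>regs := (regs \<sigma>)(''v'' := v, ''x'' := x, ''qt'' := Suc qt, ''p'' := Suc i),
               arrs := (arrs \<sigma>)(''par'' := (par_in \<sigma>)(x := u),
                 ''seen'' := (seen_in \<sigma>)(x := Suc c),
                 ''queue'' := (arrs \<sigma> ''queue'')(qt := x))\<rparr>) \<sigma>"
    and "mate_in \<sigma> v = Suc x \<Longrightarrow> seen_in \<sigma> x = Suc c \<or> s \<le> lab_in \<sigma> x \<Longrightarrow>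
      wp w bfs_body (\<lambda>t \<sigma>'. t \<le> 65 \<and>
        \<sigma>' = \<sigma>\<lparr>regs := (regs \<sigma>)(''v'' := v, ''x'' := x, ''p'' := Suc i)\<rparr>) \<sigma>"
  using memory_regs[OF mem] memory_read(1)[OF mem u(2) c] memory_read(2-5)[OF mem u(2) c, of i]
    u(1) i v qt less_word[of 1] less_word[of "Suc c"] less_word[of "Suc qt"] c
  by (auto intro!: vc_wp simp: bfs_body_def)

lemma wp_bfs_body_next:
  assumes mem: "memory (Suc c) c \<sigma>" and u: "regs \<sigma> ''u'' = u" "u \<le> c" and c: "c < n"
    and "\<not> regs \<sigma> ''p'' < length (A u)" and qh: "regs \<sigma> ''qh'' = qh" "qh \<le> c"
  shows "wp w bfs_body (\<lambda>t \<sigma>'. t \<le> 65 \<and>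
    \<sigma>' = \<sigma>\<lparr>regs := (regs \<sigma>)(''qh'' := Suc qh, ''u'' := arrs \<sigma> ''queue'' (Suc qh), ''p'' := 0)\<rparr>) \<sigma>"
  using memory_read(1)[OF mem u(2) c] u(1) assms(5) qh c less_word[of 1] less_word[of "Suc qh"]
  by (auto intro!: vc_wp simp: bfs_body_def)

definition bfs_step :: "nat \<Rightarrow> state \<Rightarrow> nat \<Rightarrow> state \<Rightarrow> bool" where
  "bfs_step c \<sigma> t \<sigma>' \<longleftrightarrow>
     t \<le> 65 \<and> (\<exists>d'. bfs_inv c d' \<sigma>' \<and> bfs_progress \<sigma> < bfs_progress \<sigma>')"

context
  fixes c :: nat and d :: "nat \<Rightarrow> nat" and \<sigma> :: state and qs :: "nat list" and u h p :: nat
  assumes mem: "memory (Suc c) c \<sigma>" and inv: "bfs_inv c d \<sigma>" and guard: "bval bfs_guard \<sigma>"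
    and c: "c < n" and u: "regs \<sigma> ''u'' = u" and h: "regs \<sigma> ''qh'' = h" and p: "regs \<sigma> ''p'' = p"
    and qs: "queue_in \<sigma> = qs"
begin

interpretation bfs A "matching_in \<sigma>" "{x. s \<le> lab_in \<sigma> x}" c "par_in \<sigma>" qs d h p
  using inv h p qs unfolding bfs_inv_def by blast

lemma bfs_current: "h < length qs" "qs ! h = u" "h \<le> c" "u \<le> c"
proof -
  show head: "h < length qs" "qs ! h = u"
    using guard inv u h qs by (auto simp: bfs_guard_def bfs_inv_def queue_in_def)
  show "h \<le> c" using head(1) bfs_inv_queue(2)[OF mem inv] qs by (auto simp: queue_in_def)
  have "u \<in> set qs" using head by auto
  then show "u \<le> c" using bfs_inv_queue(1)[OF mem inv] qs by auto
qed

lemma bfs_not_found: "regs \<sigma> ''found'' = 0"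
  using guard by (simp add: bfs_guard_def)

lemma bfs_seen:
  "\<forall>x. seen_in \<sigma> x \<le> Suc c" "\<forall>x. seen_in \<sigma> x = Suc c \<longleftrightarrow> x \<in> set qs"
  using inv qs unfolding bfs_inv_def by blast+

lemmas bfs_step_simps = bfs_step_def bfs_inv_def bfs_progress_def queue_in_def bfs_not_found u h p
  qs[symmetric, unfolded queue_in_def]

lemmas wp_bfs_body_scan_current =
  wp_bfs_body_scan[OF mem u bfs_current(4) c p _ refl refl bfs_inv_queue(2)[OF mem inv]]

lemma wp_bfs_body_case_enqueue:
  assumes i: "p < length (A u)" and mate: "mate_in \<sigma> (A u ! p) = Suc x"
    and x: "matching_in \<sigma> x = Some (A u ! p)" "seen_in \<sigma> x \<noteq> Suc c" "lab_in \<sigma> x < s"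
  shows "wp w bfs_body (bfs_step c \<sigma>) \<sigma>"
proof -
  let ?dead = "{x. s \<le> lab_in \<sigma> x}" and ?par = "(par_in \<sigma>)(x := u)"
  have fresh: "x \<notin> set qs" "x \<notin> ?dead" using x bfs_seen(2) by auto
  moreover have "alt_step (nbrs A) (matching_in \<sigma>) (qs ! h) x"
    using x(1) i bfs_current unfolding alt_step_def by (metis nth_mem)
  ultimately interpret enqueued:
    bfs A "matching_in \<sigma>" ?dead c ?par "qs @ [x]" "d(x := Suc (d u))" h p
    using bfs_enqueue bfs_current by auto
  have "bfs A (matching_in \<sigma>) ?dead c ?par (qs @ [x]) (d(x := Suc (d u))) h (Suc p)"
    using bfs_current i x(1) by (intro enqueued.bfs_scan) (auto simp: nth_append scanned_def)
  then show ?thesis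
    using bfs_seen bfs_current fresh
    by (intro wp_mono[OF wp_bfs_body_scan_current(2)[OF i mate x(2,3)]]) (auto simp: bfs_step_simps)
qed

lemma wp_bfs_body_case_scan:
  assumes i: "p < length (A u)"
  shows "wp w bfs_body (bfs_step c \<sigma>) \<sigma>"
proof (cases "mate_in \<sigma> (A u ! p)")
  case 0
  show ?thesis
    by (rule wp_mono[OF wp_bfs_body_scan_current(1)[OF i 0]])
      (use bfs_axioms bfs_seen bfs_current i 0 in \<open>auto simp: bfs_step_simps\<close>)
next
  case (Suc x)
  then have x: "matching_in \<sigma> x = Some (A u ! p)"
    using mem mate_eq_Suc_iff unfolding memory_def by blast
  have seen_x: "seen_in \<sigma> x = Suc c \<longleftrightarrow> x \<in> set qs" using bfs_seen(2) by blast
  show ?thesis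
  proof (cases "seen_in \<sigma> x \<noteq> Suc c \<and> lab_in \<sigma> x < s")
    case True
    with i Suc x show ?thesis by (intro wp_bfs_body_case_enqueue) auto
  next
    case False
    let ?dead = "{x. s \<le> lab_in \<sigma> x}"
    have old: "seen_in \<sigma> x = Suc c \<or> s \<le> lab_in \<sigma> x" using False by auto
    then have "scanned (matching_in \<sigma>) ?dead qs d (qs ! h) (A (qs ! h) ! p)"
      using x near bfs_current seen_x by (auto simp: scanned_def)
    then have "bfs A (matching_in \<sigma>) ?dead c (par_in \<sigma>) qs d h (Suc p)"
      using i bfs_current by (intro bfs_scan) auto
    then show ?thesis
      using bfs_seen bfs_current
      by (intro wp_mono[OF wp_bfs_body_scan_current(3)[OF i Suc old]]) (auto simp: bfs_step_simps)
  qed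
qed

lemma wp_bfs_body_case_next:
  assumes "\<not> p < length (A u)"
  shows "wp w bfs_body (bfs_step c \<sigma>) \<sigma>"
proof -
  have last: "p = length (A u)" using assms arcs bfs_current by simp
  then have "bfs A (matching_in \<sigma>) {x. s \<le> lab_in \<sigma> x} c (par_in \<sigma>) qs d (Suc h) 0"
    using bfs_current by (intro bfs_next_client) auto
  then show ?thesis
    using last bfs_seen bfs_current weight_take_Suc
    by (intro wp_mono[OF wp_bfs_body_next[OF mem u bfs_current(4) c _ h bfs_current(3)]])
      (auto simp: bfs_step_simps)
qed

lemma wp_bfs_body: "wp w bfs_body (bfs_step c \<sigma>) \<sigma>"
  using wp_bfs_body_case_scan wp_bfs_body_case_next by blast

end

lemma wp_bfs:
  assumes mem: "memory (Suc c) c \<sigma>" and inv: "bfs_inv c d \<sigma>" and c: "c < n"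
  shows "wp w (While bfs_guard bfs_body) (\<lambda>t \<sigma>'. \<not> bval bfs_guard \<sigma>' \<and>
    (\<exists>d'. bfs_inv c d' \<sigma>') \<and> t + 80 * bfs_progress \<sigma> \<le> 80 * bfs_progress \<sigma>' + 10) \<sigma>"
proof -
  let ?I = "\<lambda>p \<sigma>'. (\<exists>d'. bfs_inv c d' \<sigma>') \<and> p = bfs_progress \<sigma>'"
  have bcost: "bcost bfs_guard \<le> 9" by (simp add: bfs_guard_def)
  have "wp w (While bfs_guard bfs_body) (\<lambda>t \<sigma>'. \<exists>p'. ?I p' \<sigma>' \<and> \<not> bval bfs_guard \<sigma>' \<and>
      t + 80 * bfs_progress \<sigma> \<le> 80 * p' + 1 + bcost bfs_guard) \<sigma>"
  proof (rule wp_While)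
    show "?I (bfs_progress \<sigma>) \<sigma>" using inv by blast
  next
    fix p \<sigma>' assume "?I p \<sigma>'" and frame: "frame bfs_body \<sigma> \<sigma>'"
    then obtain d' where inv': "bfs_inv c d' \<sigma>'" and p: "p = bfs_progress \<sigma>'" by blast
    have mem': "memory (Suc c) c \<sigma>'" by (rule memory_frame[OF mem frame]) simp_all
    show "p \<le> m + n + 1" unfolding p by (rule bfs_progress_le[OF mem' inv' c])
    show "bsafe w bfs_guard \<sigma>'" by (simp add: bfs_guard_def)
    assume "bval bfs_guard \<sigma>'"
    from wp_bfs_body[OF mem' inv' this c refl refl refl refl]
    show "wp w bfs_body (\<lambda>t \<sigma>''. 1 + bcost bfs_guard + t \<le> 80 \<and> (\<exists>p'>p. ?I p' \<sigma>'')) \<sigma>'"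
      by (rule wp_mono) (use p bcost in \<open>auto simp: bfs_step_def\<close>)
  qed
  then show ?thesis by (rule wp_mono) (use bcost in auto)
qed

lemma wp_kill:
  assumes k: "regs \<sigma> ''k'' = 0" and qt: "regs \<sigma> ''qt'' \<le> n" and s: "regs \<sigma> ''servers'' = s"
    and lab: "lab_in \<sigma> = lab" and qs: "queue_in \<sigma> = qs"
  shows "wp w (While kill_guard kill_body) (\<lambda>t \<sigma>'.
    lab_in \<sigma>' = (\<lambda>y. if y \<in> set qs then s else lab y) \<and>
    t \<le> 80 * regs \<sigma> ''qt'' + 4) \<sigma>"
proof -
  let ?q = "arrs \<sigma> ''queue''" and ?qt = "regs \<sigma> ''qt''"
  define I where "I i \<sigma>' \<longleftrightarrow> regs \<sigma>' ''k'' = i \<and> i \<le> ?qt \<and>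
    lab_in \<sigma>' = (\<lambda>y. if y \<in> ?q ` {..<i} then s else lab y)" for i and \<sigma>' :: state
  have "wp w (While kill_guard kill_body)
      (\<lambda>t \<sigma>'. I ?qt \<sigma>' \<and> frame kill_body \<sigma> \<sigma>' \<and> t \<le> 80 * ?qt + 1 + bcost kill_guard) \<sigma>"
  proof (rule wp_While_counter)
    show "I 0 \<sigma>" using k lab by (simp add: I_def)
  next
    fix i \<sigma>' assume I: "I i \<sigma>'" and frame: "frame kill_body \<sigma> \<sigma>'"
    then have unchanged: "regs \<sigma>' ''qt'' = ?qt" "regs \<sigma>' ''servers'' = s" "arrs \<sigma>' ''queue'' = ?q"
      using s by (simp_all add: frame_def)
    then show "i \<le> ?qt \<and> bsafe w kill_guard \<sigma>' \<and> (bval kill_guard \<sigma>' \<longleftrightarrow> i < ?qt)"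
      using I by (auto simp: I_def kill_guard_def)
    assume "i < ?qt"
    then show "wp w kill_body (\<lambda>t \<sigma>''. 1 + bcost kill_guard + t \<le> 80 \<and> I (Suc i) \<sigma>'') \<sigma>'"
      using I unchanged qt less_word[of 1] less_word[of "Suc i"]
      by (intro vc_wp) (auto simp: kill_body_def kill_guard_def I_def fun_eq_iff lessThan_Suc)
  qed
  then show ?thesis
    by (rule wp_mono) (simp add: I_def qs[symmetric] queue_in_def kill_guard_def lessThan_atLeast0)
qed

section \<open>The phases of an insertion\<close>

definition run_inv :: "nat \<Rightarrow> state \<Rightarrow> bool" where
  "run_inv N \<sigma> \<longleftrightarrow> memory N N \<sigma> \<and> labels N \<sigma> \<and> (\<forall>x. seen_in \<sigma> x \<le> N) \<and>
     low_excess (nbrs A) n (dom (matching_in \<sigma>)) (regs \<sigma> ''cap'')"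

definition dead_weight :: "nat \<Rightarrow> state \<Rightarrow> nat" where
  "dead_weight N \<sigma> = weight A {u. u < N \<and> s \<le> lab_in \<sigma> u}"

lemma dead_weight_mono:
  assumes "N \<le> N'" and "lab_in \<sigma> \<le> lab_in \<sigma>'"
  shows "dead_weight N \<sigma> \<le> dead_weight N' \<sigma>'"
  unfolding dead_weight_def
  using assms by (intro weight_mono) (auto simp: le_fun_def intro: order_trans)

definition prepared :: "nat \<Rightarrow> state \<Rightarrow> state" where
  "prepared c \<sigma> = \<sigma>\<lparr>
     regs := (regs \<sigma>)(''u'' := c, ''found'' := 0, ''k'' := 0),
     arrs := (arrs \<sigma>)(''start'' := (arrs \<sigma> ''start'')(c := regs \<sigma> ''tot''),
       ''deg'' := (arrs \<sigma> ''deg'')(c := regs \<sigma> ''degree''), ''par'' := (par_in \<sigma>)(c := c))\<rparr>"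

lemma wp_prepare:
  assumes "regs \<sigma> ''cnt'' = c"
  shows "wp w prepare (\<lambda>t \<sigma>'. t \<le> 40 \<and> \<sigma>' = prepared c \<sigma>) \<sigma>"
  using assms by (intro vc_wp) (simp add: prepare_def prepared_def)

definition copied :: "nat list \<Rightarrow> state \<Rightarrow> state \<Rightarrow> bool" where
  "copied N \<sigma> \<sigma>' \<longleftrightarrow> regs \<sigma>' ''tot'' = regs \<sigma> ''tot'' + length N \<and>
     (\<forall>j<regs \<sigma> ''tot''. arrs \<sigma>' ''adj'' j = arrs \<sigma> ''adj'' j) \<and>
     (\<forall>i<length N. arrs \<sigma>' ''adj'' (regs \<sigma> ''tot'' + i) = N ! i)"

lemma wp_copy:
  assumes k: "regs \<sigma> ''k'' = 0" and T: "regs \<sigma> ''tot'' + length N \<le> m"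
    and N: "regs \<sigma> ''degree'' = length N" "\<And>i. i < length N \<Longrightarrow> arrs \<sigma> ''neighbours'' i = N ! i"
  shows "wp w (While copy_guard copy_body) (\<lambda>t \<sigma>'. copied N \<sigma> \<sigma>' \<and> t \<le> 80 * length N + 4) \<sigma>"
proof -
  define T where "T = regs \<sigma> ''tot''"
  define I where "I i \<sigma>' \<longleftrightarrow> regs \<sigma>' ''k'' = i \<and> i \<le> length N \<and> regs \<sigma>' ''tot'' = T + i \<and>
    (\<forall>j<T. arrs \<sigma>' ''adj'' j = arrs \<sigma> ''adj'' j) \<and> (\<forall>j<i. arrs \<sigma>' ''adj'' (T + j) = N ! j)"
    for i and \<sigma>' :: state
  have "wp w (While copy_guard copy_body) (\<lambda>t \<sigma>'. I (length N) \<sigma>' \<and> frame copy_body \<sigma> \<sigma>' \<and>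
      t \<le> 80 * length N + 1 + bcost copy_guard) \<sigma>"
  proof (rule wp_While_counter)
    show "I 0 \<sigma>" using k by (simp add: I_def T_def)
  next
    fix i \<sigma>' assume I: "I i \<sigma>'" and frame: "frame copy_body \<sigma> \<sigma>'"
    then have unchanged: "regs \<sigma>' ''degree'' = length N"
      "arrs \<sigma>' ''neighbours'' = arrs \<sigma> ''neighbours''"
      using N(1) by (simp_all add: frame_def)
    then show "i \<le> length N \<and> bsafe w copy_guard \<sigma>' \<and> (bval copy_guard \<sigma>' \<longleftrightarrow> i < length N)"
      using I by (auto simp: I_def copy_guard_def)
    assume i: "i < length N"
    then have "Suc 0 < 2 ^ w" "Suc i < 2 ^ w" "Suc (T + i) < 2 ^ w"
      using T by (auto simp: T_def intro: less_word)
    then show "wp w copy_body (\<lambda>t \<sigma>''. 1 + bcost copy_guard + t \<le> 80 \<and> I (Suc i) \<sigma>'') \<sigma>'"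
      using I i unchanged N(2)
      by (intro vc_wp) (auto simp: copy_body_def copy_guard_def I_def less_Suc_eq)
  qed
  then show ?thesis
    by (rule wp_mono) (simp add: I_def T_def copied_def copy_guard_def)
qed

lemma stored_Suc:
  assumes "stored c \<sigma>" and "regs \<sigma>' ''servers'' = regs \<sigma> ''servers''"
    and "copied (A c) \<sigma> \<sigma>'" and "arrs \<sigma>' ''start'' = (arrs \<sigma> ''start'')(c := regs \<sigma> ''tot'')"
    and "arrs \<sigma>' ''deg'' = (arrs \<sigma> ''deg'')(c := length (A c))"
  shows "stored (Suc c) \<sigma>'"
  using assms unfolding stored_def copied_def by (auto simp: less_Suc_eq)

lemma wp_record_client:
  assumes inv: "run_inv c \<sigma>" and c: "c < n"
  shows "wp w record_client (\<lambda>t \<sigma>'. memory (Suc c) c \<sigma>' \<and> dfs_inv c 0 \<sigma>' \<and> regs \<sigma>' ''found'' = 0 \<and>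
    t \<le> 80 * length (A c) + 44) (arrival (A c) \<sigma>)"
  unfolding record_client_def
proof (rule wp_Seq[OF wp_prepare])
  let ?\<sigma>1 = "prepared c (arrival (A c) \<sigma>)"
  have mem: "memory c c \<sigma>" and labels: "labels c \<sigma>" using inv unfolding run_inv_def by blast+
  then show "regs (arrival (A c) \<sigma>) ''cnt'' = c" by (simp add: memory_def arrival_def)
  have "regs \<sigma> ''tot'' + length (A c) \<le> m"
    using mem sum_length_le[of "Suc c"] c by (simp add: memory_def stored_def)
  then have "wp w (While copy_guard copy_body)
      (\<lambda>t \<sigma>'. copied (A c) ?\<sigma>1 \<sigma>' \<and> t \<le> 80 * length (A c) + 4) ?\<sigma>1"
    by (intro wp_copy) (simp_all add: prepared_def arrival_def)
  note copy = wp_frame[OF this]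
  fix t :: nat and \<sigma>1 assume t: "t \<le> 40 \<and> \<sigma>1 = ?\<sigma>1"
  show "wp w (While copy_guard copy_body) (\<lambda>t' \<sigma>'. memory (Suc c) c \<sigma>' \<and> dfs_inv c 0 \<sigma>' \<and>
    regs \<sigma>' ''found'' = 0 \<and> t + t' \<le> 80 * length (A c) + 44) \<sigma>1"
    unfolding conjunct2[OF t]
  proof (rule wp_mono[OF copy])
    fix t' :: nat and \<sigma>' assume copied: "(copied (A c) ?\<sigma>1 \<sigma>' \<and> t' \<le> 80 * length (A c) + 4) \<and>
      frame (While copy_guard copy_body) ?\<sigma>1 \<sigma>'"
    then have regs': "regs \<sigma>' x = regs ?\<sigma>1 x" if "x \<notin> {''tot'', ''k''}" for x
      using that by (simp add: frame_def)
    have arrs': "arrs \<sigma>' a = arrs ?\<sigma>1 a" if "a \<noteq> ''adj''" for a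
      using copied that by (simp add: frame_def)
    note unchanged = regs' arrs' prepared_def arrival_def
    have "stored (Suc c) \<sigma>'"
      using mem copied by (intro stored_Suc[of c \<sigma>]) (simp_all add: memory_def copied_def unchanged)
    then have "memory (Suc c) c \<sigma>'"
      using mem by (simp add: memory_def mates_def unchanged)
    moreover have "dfs_inv c 0 \<sigma>'"
      using mem labels
      by (simp add: dfs_inv_def dfs_def dfs_axioms_def labels_def memory_def unchanged)
    ultimately show "memory (Suc c) c \<sigma>' \<and> dfs_inv c 0 \<sigma>' \<and> regs \<sigma>' ''found'' = 0 \<and>
      t + t' \<le> 80 * length (A c) + 44"
      using t copied by (simp add: unchanged)
  qed
qed

lemma free_dist_dead:
  assumes mem: "memory (Suc c) c \<sigma>" and labels: "labels (Suc c) \<sigma>" and c: "c < n"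
    and x: "s \<le> lab_in \<sigma> x" and "x \<le> c \<or> 0 < s"
  shows "dist_in \<sigma> x = \<infinity>"
proof (rule ccontr)
  assume finite_dist: "dist_in \<sigma> x \<noteq> \<infinity>"
  interpret labelled_matching A "matching_in \<sigma>" "lab_in \<sigma>" "cur_in \<sigma>"
    using labels unfolding labels_def by blast
  have "x \<le> c"
  proof (rule ccontr)
    assume "\<not> x \<le> c"
    then have "lab_in \<sigma> x = 0" using labels by (simp add: labels_def)
    with x assms(5) \<open>\<not> x \<le> c\<close> show False by simp
  qed
  then have "nbrs A y \<subseteq> {..<s}" if "y \<in> insert x (dom (matching_in \<sigma>))" for y
    using that dom_matching_in[OF mem] c by (intro servers) auto
  then have "dist_in \<sigma> x < enat (card {..<s})"
    using finite_dist by (intro free_dist_less_card_servers) auto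
  also have "\<dots> \<le> enat (lab_in \<sigma> x)" using x by simp
  also have "\<dots> \<le> dist_in \<sigma> x" by (rule lab_le_free_dist)
  finally show False by simp
qed

text \<open>\<open>B\<close> is the value of \<open>cap\<close> before the search.\<close>

definition search_failed :: "nat \<Rightarrow> nat \<Rightarrow> state \<Rightarrow> bool" where
  "search_failed c B \<sigma> \<longleftrightarrow> regs \<sigma> ''found'' = 0 \<and> regs \<sigma> ''cap'' = B \<and> dist_in \<sigma> c = \<infinity>"

definition search_found :: "nat \<Rightarrow> nat \<Rightarrow> nat \<Rightarrow> (nat \<Rightarrow> nat) \<Rightarrow> state \<Rightarrow> bool" where
  "search_found c B k pv \<sigma> \<longleftrightarrow> regs \<sigma> ''found'' = Suc (pv 0) \<and>
     augmentation_in \<sigma> c k (\<lambda>j. (par_in \<sigma> ^^ j) (regs \<sigma> ''u'')) pv \<and>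
     (regs \<sigma> ''cap'' = B \<and> k \<le> Suc B \<or> regs \<sigma> ''cap'' = Suc B \<and> Suc B \<le> k)"

definition search_done :: "nat \<Rightarrow> nat \<Rightarrow> state \<Rightarrow> bool" where
  "search_done c B \<sigma> \<longleftrightarrow> labels (Suc c) \<sigma> \<and> (\<forall>x. seen_in \<sigma> x \<le> Suc c) \<and>
     (search_failed c B \<sigma> \<or> (\<exists>k pv. search_found c B k pv \<sigma>))"

text \<open>
  Every one of \<open>b\<close> successful breadth-first searches has to be paid for twice: for the search itself
  and for the augmentation that follows it.
\<close>

definition bfs_credit :: "nat \<Rightarrow> nat" where
  "bfs_credit b = (m + n + 1) * b"

definition search_post :: "nat \<Rightarrow> state \<Rightarrow> nat \<Rightarrow> state \<Rightarrow> bool" where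
  "search_post c \<sigma> t \<sigma>' \<longleftrightarrow> search_done c (regs \<sigma> ''cap'') \<sigma>' \<and> lab_in \<sigma> \<le> lab_in \<sigma>' \<and>
     t + 160 * dead_weight (Suc c) \<sigma> + 80 * bfs_credit (regs \<sigma> ''cap'') \<le>
     160 * dead_weight (Suc c) \<sigma>' + 80 * bfs_credit (regs \<sigma>' ''cap'') + 80"

lemma wp_bfs_settle_found:
  assumes mem: "memory (Suc c) c \<sigma>" and labels: "labels (Suc c) \<sigma>" and inv: "bfs_inv c d \<sigma>"
    and c: "c < n" and s: "Suc (regs \<sigma> ''cap'') < s" and found: "regs \<sigma> ''found'' \<noteq> 0"
    and far: "enat (Suc (regs \<sigma> ''cap'')) \<le> dist_in \<sigma> c"
  shows "wp w bfs_settle (\<lambda>t. search_post c \<sigma> (t + 80 * bfs_progress \<sigma> + 60)) \<sigma>"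
proof -
  let ?u = "regs \<sigma> ''u''"
  interpret bfs A "matching_in \<sigma>" "{x. s \<le> lab_in \<sigma> x}" c "par_in \<sigma>" "queue_in \<sigma>" d
      "regs \<sigma> ''qh''" "regs \<sigma> ''p''"
    using inv unfolding bfs_inv_def by blast
  have head: "regs \<sigma> ''qh'' < length (queue_in \<sigma>)" "queue_in \<sigma> ! regs \<sigma> ''qh'' = ?u"
    using inv found by (auto simp: bfs_inv_def queue_in_def)
  obtain v where v: "regs \<sigma> ''found'' = Suc v" "v \<in> nbrs A ?u" "mate_in \<sigma> v = 0"
    using inv found unfolding bfs_inv_def by blast
  have "v \<notin> ran (matching_in \<sigma>)" using mem v(3) mate_eq_0_iff unfolding memory_def by blast
  moreover have "matching_in \<sigma> c = None" using mem by (simp add: memory_def)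
  ultimately obtain pv where pv: "pv 0 = v" and
    aug: "augmentation_in \<sigma> c (d ?u) (\<lambda>j. (par_in \<sigma> ^^ j) ?u) pv"
    using bfs_found[OF free_dist_dead[OF mem labels c] head(1)] v(2) s head(2) by auto
  have "Suc (regs \<sigma> ''cap'') \<le> d ?u"
    using far shortest_augmentation.free_dist_start[OF aug] by simp
  then have "search_done c (regs \<sigma> ''cap'') (\<sigma>\<lparr>regs := (regs \<sigma>)(''cap'' := Suc (regs \<sigma> ''cap''))\<rparr>)"
    using labels inv aug pv v(1) unfolding search_done_def search_found_def bfs_inv_def
    by (auto simp: labels_def)
  moreover have "bfs_progress \<sigma> \<le> m + n + 1" by (rule bfs_progress_le[OF mem inv c])
  ultimately show ?thesis
    using found s less_word[of 1] less_word[of "Suc (regs \<sigma> ''cap'')"]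
    by (intro vc_wp) (auto simp: bfs_settle_def search_post_def dead_weight_def bfs_credit_def)
qed

lemma dead_weight_raise:
  assumes "Q \<subseteq> {..<N}" and "\<And>y. y \<in> Q \<Longrightarrow> lab_in \<sigma> y < s"
    and lab': "lab_in \<sigma>' = (\<lambda>y. if y \<in> Q then s else lab_in \<sigma> y)"
  shows "dead_weight N \<sigma>' = dead_weight N \<sigma> + weight A Q"
proof -
  have "{u. u < N \<and> s \<le> lab_in \<sigma>' u} = {u. u < N \<and> s \<le> lab_in \<sigma> u} \<union> Q"
    using assms(1) lab' by auto
  moreover have "{u. u < N \<and> s \<le> lab_in \<sigma> u} \<inter> Q = {}" using assms(2) by fastforce
  moreover have "finite Q" using assms(1) finite_subset by blast
  ultimately show ?thesis by (simp add: dead_weight_def weight_def sum.union_disjoint)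
qed

lemma bfs_exhausted:
  assumes mem: "memory (Suc c) c \<sigma>" and labels: "labels (Suc c) \<sigma>" and inv: "bfs_inv c d \<sigma>"
    and c: "c < n" and s: "0 < s" and exhausted: "\<not> regs \<sigma> ''qh'' < regs \<sigma> ''qt''"
  defines "Q \<equiv> set (queue_in \<sigma>)"
  shows "y \<in> Q \<Longrightarrow> lab_in \<sigma> y < s"
    and "dist_in \<sigma> c = \<infinity>"
    and "labelled_matching A (matching_in \<sigma>) (\<lambda>y. if y \<in> Q then s else lab_in \<sigma> y) (cur_in \<sigma>)"
proof -
  let ?dead = "{x. s \<le> lab_in \<sigma> x}"
  interpret labelled_matching A "matching_in \<sigma>" "lab_in \<sigma>" "cur_in \<sigma>"
    using labels unfolding labels_def by blast
  interpret bfs A "matching_in \<sigma>" ?dead c "par_in \<sigma>" "queue_in \<sigma>" d "regs \<sigma> ''qh''" "regs \<sigma> ''p''"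
    using inv unfolding bfs_inv_def by blast
  have h: "regs \<sigma> ''qh'' = length (queue_in \<sigma>)" using exhausted head_le by (simp add: queue_in_def)
  show lab_less: "lab_in \<sigma> y < s" if "y \<in> Q" for y
    using alive that by (auto simp: Q_def not_le[symmetric])
  have unreachable: "dist_in \<sigma> y = \<infinity>" if "y \<in> Q" for y
    using free_dist_exhausted[OF free_dist_dead[OF mem labels c] h] that s by (simp add: Q_def)
  then show "dist_in \<sigma> c = \<infinity>" using root by (simp add: Q_def)
  show "labelled_matching A (matching_in \<sigma>) (\<lambda>y. if y \<in> Q then s else lab_in \<sigma> y) (cur_in \<sigma>)"
  proof (rule labelled_matching_raise)
    show "\<exists>x. matching_in \<sigma> x = Some v \<and> (x \<in> Q \<or> s \<le> lab_in \<sigma> x)"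
      if "u \<in> Q" "v \<in> nbrs A u" for u v
      using neighbour_exhausted[OF h _ that(2)] that(1) unfolding Q_def by blast
  qed (use lab_less unreachable in \<open>auto simp: less_imp_le\<close>)
qed

lemma wp_bfs_settle_failed:
  assumes mem: "memory (Suc c) c \<sigma>" and labels: "labels (Suc c) \<sigma>" and inv: "bfs_inv c d \<sigma>"
    and c: "c < n" and s: "0 < s" and found: "regs \<sigma> ''found'' = 0"
    and exhausted: "\<not> regs \<sigma> ''qh'' < regs \<sigma> ''qt''"
  shows "wp w bfs_settle (\<lambda>t. search_post c \<sigma> (t + 80 * bfs_progress \<sigma> + 60)) \<sigma>"
proof -
  let ?Q = "set (queue_in \<sigma>)"
  let ?lab = "\<lambda>y. if y \<in> ?Q then s else lab_in \<sigma> y" and ?\<sigma>0 = "\<sigma>\<lparr>regs := (regs \<sigma>)(''k'' := 0)\<rparr>"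
  note queue = bfs_inv_queue[OF mem inv] and killed = bfs_exhausted[OF mem labels inv c s exhausted]
  have "?Q \<subseteq> {..<Suc c}" using queue(1) by auto
  then have dead: "dead_weight (Suc c) \<sigma>' = dead_weight (Suc c) \<sigma> + weight A ?Q"
    if "lab_in \<sigma>' = ?lab" for \<sigma>'
    using killed(1) that by (rule dead_weight_raise)
  have qt: "regs \<sigma> ''qt'' \<le> weight A ?Q"
    unfolding queue(3)[symmetric] weight_def card_eq_sum by (intro sum_mono) simp
  have work: "bfs_progress \<sigma> \<le> weight A ?Q" using bfs_progress_le_weight_queue[OF inv] found by simp
  have "wp w (While kill_guard kill_body) (\<lambda>t \<sigma>'.
      lab_in \<sigma>' = ?lab \<and> t \<le> 80 * regs \<sigma> ''qt'' + 4) ?\<sigma>0"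
    using queue(2) c mem wp_kill[of ?\<sigma>0 "lab_in \<sigma>" "queue_in \<sigma>"]
    by (simp add: queue_in_def memory_def stored_def)
  from wp_frame[OF this]
  have "wp w (While kill_guard kill_body)
      (\<lambda>t. search_post c \<sigma> (t + 6 + 80 * bfs_progress \<sigma> + 60)) ?\<sigma>0"
  proof (rule wp_mono)
    fix t :: nat and \<sigma>' assume post: "(lab_in \<sigma>' = ?lab \<and> t \<le> 80 * regs \<sigma> ''qt'' + 4) \<and>
      frame (While kill_guard kill_body) ?\<sigma>0 \<sigma>'"
    then have frame: "regs \<sigma>' ''found'' = 0" "regs \<sigma>' ''cap'' = regs \<sigma> ''cap''"
      "match_in \<sigma>' = match_in \<sigma>" "cur_in \<sigma>' = cur_in \<sigma>" "seen_in \<sigma>' = seen_in \<sigma>"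
      using found by (simp_all add: frame_def)
    have "labels (Suc c) \<sigma>'"
      using killed(3) post frame labels queue(1) by (auto simp: labels_def)
    then have "search_done c (regs \<sigma> ''cap'') \<sigma>'"
      using frame inv killed(2) by (simp add: search_done_def search_failed_def bfs_inv_def)
    moreover have "lab_in \<sigma> \<le> lab_in \<sigma>'"
      using post killed(1) by (auto simp: le_fun_def less_imp_le)
    ultimately show "search_post c \<sigma> (t + 6 + 80 * bfs_progress \<sigma> + 60) \<sigma>'"
      using post qt work dead[of \<sigma>'] frame(2) by (simp add: search_post_def)
  qed
  then show ?thesis
    using found by (intro vc_wp) (simp add: bfs_settle_def add_ac)
qed

lemma wp_bfs_init:
  assumes mem: "memory (Suc c) c \<sigma>" and labels: "labels (Suc c) \<sigma>" and c: "c < n"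
    and seen: "\<forall>x. seen_in \<sigma> x \<le> c" and lab: "lab_in \<sigma> c < s" and found: "regs \<sigma> ''found'' = 0"
  shows "wp w bfs_init (\<lambda>t \<sigma>'. t \<le> 30 \<and> bfs_inv c (\<lambda>_. 0) \<sigma>' \<and> bfs_progress \<sigma>' = 0) \<sigma>"
proof -
  interpret labelled_matching A "matching_in \<sigma>" "lab_in \<sigma>" "cur_in \<sigma>"
    using labels unfolding labels_def by blast
  have "bfs A (matching_in \<sigma>) {x. s \<le> lab_in \<sigma> x} c (par_in \<sigma>) [c] (\<lambda>_. 0) 0 0"
    using lab by (intro bfs_start bipartite_matching_axioms) simp
  moreover have "seen_in \<sigma> x \<noteq> Suc c" "seen_in \<sigma> x \<le> Suc c" for x
    using seen[rule_format, of x] by auto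
  moreover have "Suc 0 < 2 ^ w" "Suc c < 2 ^ w" using c by (auto intro: less_word)
  ultimately show ?thesis
    using mem found
    by (intro vc_wp)
      (auto simp: bfs_init_def memory_def bfs_inv_def bfs_progress_def queue_in_def weight_def)
qed

lemma wp_bfs_phase:
  assumes mem: "memory (Suc c) c \<sigma>" and labels: "labels (Suc c) \<sigma>" and c: "c < n"
    and seen: "\<forall>x. seen_in \<sigma> x \<le> c" and found: "regs \<sigma> ''found'' = 0"
    and lab: "lab_in \<sigma> c = Suc (regs \<sigma> ''cap'')" "Suc (regs \<sigma> ''cap'') < s"
  shows "wp w bfs_phase (\<lambda>t. search_post c \<sigma> (t + 10)) \<sigma>"
  unfolding bfs_phase_def
proof (rule wp_Seq)
  show "wp w bfs_init (\<lambda>t \<sigma>'. t \<le> 30 \<and> bfs_inv c (\<lambda>_. 0) \<sigma>' \<and> bfs_progress \<sigma>' = 0) \<sigma>"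
    using wp_bfs_init[OF mem labels c seen _ found] lab by simp
  fix t1 :: nat and \<sigma>1
  assume init: "t1 \<le> 30 \<and> bfs_inv c (\<lambda>_. 0) \<sigma>1 \<and> bfs_progress \<sigma>1 = 0"
    and frame1: "frame bfs_init \<sigma> \<sigma>1"
  have mem1: "memory (Suc c) c \<sigma>1" by (rule memory_frame[OF mem frame1]) simp_all
  show "wp w (Seq (While bfs_guard bfs_body) bfs_settle) (\<lambda>t. search_post c \<sigma> (t1 + t + 10)) \<sigma>1"
  proof (rule wp_Seq[OF wp_bfs[OF mem1 _ c]])
    show "bfs_inv c (\<lambda>_. 0) \<sigma>1" using init by blast
    fix t2 :: nat and \<sigma>2
    assume loop: "\<not> bval bfs_guard \<sigma>2 \<and> (\<exists>d'. bfs_inv c d' \<sigma>2) \<and>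
      t2 + 80 * bfs_progress \<sigma>1 \<le> 80 * bfs_progress \<sigma>2 + 10"
      and frame2: "frame (While bfs_guard bfs_body) \<sigma>1 \<sigma>2"
    then obtain d where inv2: "bfs_inv c d \<sigma>2" by blast
    have mem2: "memory (Suc c) c \<sigma>2" by (rule memory_frame[OF mem1 frame2]) simp_all
    have frame: "regs \<sigma>2 ''cap'' = regs \<sigma> ''cap''" "lab_in \<sigma>2 = lab_in \<sigma>"
      "cur_in \<sigma>2 = cur_in \<sigma>" "match_in \<sigma>2 = match_in \<sigma>"
      using frame1 frame2 by (simp_all add: frame_def)
    have labels2: "labels (Suc c) \<sigma>2" using labels by (simp add: labels_def frame)
    interpret labelled_matching A "matching_in \<sigma>" "lab_in \<sigma>" "cur_in \<sigma>"
      using labels unfolding labels_def by blast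
    have far: "enat (Suc (regs \<sigma> ''cap'')) \<le> dist_in \<sigma> c"
      using lab_le_free_dist[of c] lab(1) by simp
    have "wp w bfs_settle (\<lambda>t. search_post c \<sigma>2 (t + 80 * bfs_progress \<sigma>2 + 60)) \<sigma>2"
    proof (cases "regs \<sigma>2 ''found'' = 0")
      case True
      then have "\<not> regs \<sigma>2 ''qh'' < regs \<sigma>2 ''qt''" using loop by (auto simp: bfs_guard_def)
      with True lab(2) show ?thesis by (intro wp_bfs_settle_failed[OF mem2 labels2 inv2 c]) auto
    next
      case False
      with far lab(2) show ?thesis
        by (intro wp_bfs_settle_found[OF mem2 labels2 inv2 c]) (simp_all add: frame)
    qed
    then show "wp w bfs_settle (\<lambda>t. search_post c \<sigma> (t1 + (t2 + t) + 10)) \<sigma>2"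
      by (rule wp_mono) (use init loop in \<open>auto simp: search_post_def dead_weight_def frame\<close>)
  qed
qed

lemma search_done_dfs:
  assumes mem: "memory (Suc c) c \<sigma>" and inv: "dfs_inv c k \<sigma>" and found: "regs \<sigma> ''found'' \<noteq> 0"
    and seen: "\<forall>x. seen_in \<sigma> x \<le> c"
  shows "search_done c (regs \<sigma> ''cap'') \<sigma>"
proof -
  let ?u = "regs \<sigma> ''u''"
  interpret dfs A "matching_in \<sigma>" "lab_in \<sigma>" "cur_in \<sigma>" c "par_in \<sigma>" ?u k
    using inv unfolding dfs_inv_def by blast
  obtain v where v: "regs \<sigma> ''found'' = Suc v" "v \<in> nbrs A ?u" "mate_in \<sigma> v = 0"
    using inv found unfolding dfs_inv_def by blast
  then have "v \<notin> ran (matching_in \<sigma>)" using mem mate_eq_0_iff unfolding memory_def by blast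
  then obtain pv where "pv 0 = v"
    and "augmentation_in \<sigma> c k (\<lambda>j. (par_in \<sigma> ^^ j) ?u) pv"
    using dfs_found v(2) by blast
  then have "search_found c (regs \<sigma> ''cap'') k pv \<sigma>"
    using v(1) dfs_inv_depth_le[OF inv] by (simp add: search_found_def)
  then show ?thesis
    using dfs_inv_labels[OF inv] seen by (auto simp: search_done_def le_SucI)
qed

lemma wp_search_rest:
  assumes mem: "memory (Suc c) c \<sigma>" and inv: "dfs_inv c k \<sigma>" and guard: "\<not> bval dfs_guard \<sigma>"
    and c: "c < n" and seen: "\<forall>x. seen_in \<sigma> x \<le> c"
  shows "wp w search_rest (search_post c \<sigma>) \<sigma>"
proof -
  let ?B = "regs \<sigma> ''cap''"
  note labels = dfs_inv_labels[OF inv] and regs = memory_regs[OF mem]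
  have "lab_in \<sigma> c \<le> Suc ?B" using inv by (simp add: dfs_inv_def)
  then consider (found) "regs \<sigma> ''found'' \<noteq> 0"
    | (dead) "regs \<sigma> ''found'' = 0" "s \<le> lab_in \<sigma> c"
    | (search) "regs \<sigma> ''found'' = 0" "lab_in \<sigma> c = Suc ?B" "Suc ?B < s"
    using guard regs unfolding dfs_guard_def by fastforce
  then show ?thesis
  proof cases
    case found
    then show ?thesis using search_done_dfs[OF mem inv found seen]
      by (intro vc_wp) (simp add: search_rest_def search_post_def)
  next
    case dead
    then have "search_done c ?B \<sigma>"
      using labels seen free_dist_dead[OF mem labels c dead(2)]
      by (simp add: search_done_def search_failed_def le_SucI)
    then show ?thesis
      using dead regs by (intro vc_wp) (simp add: search_rest_def search_post_def)
  next
    case search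
    have "wp w bfs_phase (\<lambda>t. search_post c \<sigma> (9 + t)) \<sigma>"
      by (rule wp_mono[OF wp_bfs_phase[OF mem labels c seen search]]) (simp add: search_post_def)
    then show ?thesis
      unfolding search_rest_def using search regs
      by (intro wp_CondTrue) (simp_all add: numeral_eq_Suc)
  qed
qed

definition flipped :: "nat \<Rightarrow> (nat \<Rightarrow> nat) \<Rightarrow> (nat \<Rightarrow> nat) \<Rightarrow> state \<Rightarrow> state \<Rightarrow> bool" where
  "flipped i pu pv \<sigma> \<sigma>' \<longleftrightarrow>
     match_in \<sigma>' = upd_prefix (match_in \<sigma>) pu (\<lambda>j. Suc (pv j)) i \<and>
     mate_in \<sigma>' = upd_prefix (mate_in \<sigma>) pv (\<lambda>j. Suc (pu j)) i \<and>
     lab_in \<sigma>' = upd_prefix (lab_in \<sigma>) pu (\<lambda>j. j) i \<and>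
     cur_in \<sigma>' = (\<lambda>u. if lab_in \<sigma>' u = lab_in \<sigma> u then cur_in \<sigma> u else 0)"

lemma wp_flip_body:
  assumes regs: "regs \<sigma>' ''u'' = u" "regs \<sigma>' ''found'' = Suc v" "regs \<sigma>' ''k'' = i"
    and small: "Suc i < 2 ^ w" "Suc u < 2 ^ w"
    and lab: "lab_in \<sigma>' u \<le> i"
  shows "wp w flip_body (\<lambda>t \<sigma>''. t \<le> 65 \<and>
    regs \<sigma>'' ''u'' = par_in \<sigma>' u \<and> regs \<sigma>'' ''found'' = match_in \<sigma>' u \<and>
    regs \<sigma>'' ''k'' = Suc i \<and>
    match_in \<sigma>'' = (match_in \<sigma>')(u := Suc v) \<and>
    mate_in \<sigma>'' = (mate_in \<sigma>')(v := Suc u) \<and>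
    lab_in \<sigma>'' = (lab_in \<sigma>')(u := i) \<and>
    cur_in \<sigma>'' = (if lab_in \<sigma>' u = i then cur_in \<sigma>' else (cur_in \<sigma>')(u := 0))) \<sigma>'"
proof -
  have one: "Suc 0 < 2 ^ w" using less_word[of 1] by simp
  show ?thesis
  proof (cases "lab_in \<sigma>' u = i")
    case True
    then have "(lab_in \<sigma>')(u := i) = lab_in \<sigma>'" by auto
    then show ?thesis using True regs small one by (intro vc_wp) (simp add: flip_body_def)
  next
    case False
    then show ?thesis using lab regs small one by (intro vc_wp) (simp add: flip_body_def)
  qed
qed

lemma wp_flip:
  assumes aug: "labelled_augmentation A (matching_in \<sigma>) (lab_in \<sigma>) (cur_in \<sigma>) c k pu pv"
    and mem: "memory (Suc c) c \<sigma>" and c: "c < n" and "k < n"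
    and start: "regs \<sigma> ''k'' = 0" "regs \<sigma> ''u'' = pu 0" "regs \<sigma> ''found'' = Suc (pv 0)"
    and par: "\<And>j. j < k \<Longrightarrow> par_in \<sigma> (pu j) = pu (Suc j)"
  shows "wp w (While flip_guard flip_body)
    (\<lambda>t \<sigma>'. flipped (Suc k) pu pv \<sigma> \<sigma>' \<and> t \<le> 80 * Suc k + 5) \<sigma>"
proof -
  interpret labelled_augmentation A "matching_in \<sigma>" "lab_in \<sigma>" "cur_in \<sigma>" c k pu pv
    by (rule aug)
  define I where "I i \<sigma>' \<longleftrightarrow> regs \<sigma>' ''k'' = i \<and> i \<le> Suc k \<and> (i \<le> k \<longrightarrow> regs \<sigma>' ''u'' = pu i) \<and>
    regs \<sigma>' ''found'' = (if i \<le> k then Suc (pv i) else 0) \<and> flipped i pu pv \<sigma> \<sigma>'"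
    for i and \<sigma>' :: state
  have "wp w (While flip_guard flip_body) (\<lambda>t \<sigma>'. I (Suc k) \<sigma>' \<and> frame flip_body \<sigma> \<sigma>' \<and>
      t \<le> 80 * Suc k + 1 + bcost flip_guard) \<sigma>"
  proof (rule wp_While_counter)
    show "I 0 \<sigma>" using start by (simp add: I_def flipped_def)
  next
    fix i \<sigma>' assume I: "I i \<sigma>'" and frame: "frame flip_body \<sigma> \<sigma>'"
    then show "i \<le> Suc k \<and> bsafe w flip_guard \<sigma>' \<and> (bval flip_guard \<sigma>' \<longleftrightarrow> i < Suc k)"
      by (auto simp: I_def flip_guard_def)
    assume "i < Suc k"
    then have i: "i \<le> k" by simp
    then have regs: "regs \<sigma>' ''u'' = pu i" "regs \<sigma>' ''found'' = Suc (pv i)" "regs \<sigma>' ''k'' = i"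
      and fl: "flipped i pu pv \<sigma> \<sigma>'"
      using I by (auto simp: I_def)
    have "pu i \<le> c" using pu_in_insert_dom[OF i] dom_matching_in[OF mem] by auto
    then have small: "Suc i < 2 ^ w" "Suc (pu i) < 2 ^ w"
      using i \<open>k < n\<close> c by (auto intro: less_word)
    have off: "pu i \<notin> pu ` {..<i}"
      using i pu_eq_iff[of i] by (auto simp: image_iff)
    then have old: "lab_in \<sigma>' (pu i) = lab_in \<sigma> (pu i)"
      "match_in \<sigma>' (pu i) = match_in \<sigma> (pu i)"
      using fl by (simp_all add: flipped_def upd_prefix_out)
    have next_u: "par_in \<sigma>' (pu i) = pu (Suc i)" if "i < k"
      using par[OF that] frame by (simp add: frame_def)
    have next_found: "match_in \<sigma> (pu i) = (if i < k then Suc (pv (Suc i)) else 0)"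
      using path_match[of i] start_unmatched path_start i by (cases "i = k") auto
    have lab: "lab_in \<sigma>' (pu i) \<le> i" using lab_pu_le[OF i] old by simp
    show "wp w flip_body (\<lambda>t \<sigma>''. 1 + bcost flip_guard + t \<le> 80 \<and> I (Suc i) \<sigma>'') \<sigma>'"
      by (rule wp_mono[OF wp_flip_body[OF regs small lab]])
        (use i fl old next_u next_found in
          \<open>auto simp: I_def flipped_def flip_guard_def fun_eq_iff Suc_le_eq\<close>)
  qed
  then show ?thesis
    by (rule wp_mono) (simp add: I_def flip_guard_def)
qed

definition inserted :: "nat \<Rightarrow> state \<Rightarrow> state \<Rightarrow> bool" where
  "inserted c \<sigma> \<sigma>' \<longleftrightarrow> run_inv (Suc c) \<sigma>' \<and>
     sap_step (client_edges {..c} (nbrs A)) (matching_edges (matching_in \<sigma>)) c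
       (matching_edges (matching_in \<sigma>'))"

definition flip_post :: "nat \<Rightarrow> state \<Rightarrow> state \<Rightarrow> bool" where
  "flip_post c \<sigma> \<sigma>' \<longleftrightarrow> inserted c \<sigma> \<sigma>' \<and>
     scan_pot_of (Suc c) \<sigma> \<le> scan_pot_of (Suc c) \<sigma>' \<and> lab_in \<sigma> \<le> lab_in \<sigma>'"

lemma card_matched_le:
  assumes "memory (Suc c) c \<sigma>" and "c < n"
  shows "finite (dom (matching_in \<sigma>))" and "insert c (dom (matching_in \<sigma>)) \<subseteq> {..c}"
    and "card (insert c (dom (matching_in \<sigma>))) \<le> n"
proof -
  show subset: "insert c (dom (matching_in \<sigma>)) \<subseteq> {..c}"
    using dom_matching_in[OF assms(1)] by auto
  then show "finite (dom (matching_in \<sigma>))" by (auto intro: finite_subset)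
  show "card (insert c (dom (matching_in \<sigma>))) \<le> n"
    using card_mono[OF _ subset] assms(2) by simp
qed

lemma inserted_unmatched:
  assumes mem: "memory (Suc c) c \<sigma>" and labels: "labels (Suc c) \<sigma>"
    and seen: "\<forall>x. seen_in \<sigma> x \<le> Suc c"
    and low: "low_excess (nbrs A) n (dom (matching_in \<sigma>)) (regs \<sigma> ''cap'')"
    and none: "dist_in \<sigma> c = \<infinity>"
  shows "inserted c \<sigma> (\<sigma>\<lparr>regs := (regs \<sigma>)(''k'' := 0, ''cnt'' := Suc c)\<rparr>)"
  using assms sap_step_no_path[OF none]
    stored_cong[of "\<sigma>\<lparr>regs := (regs \<sigma>)(''k'' := 0, ''cnt'' := Suc c)\<rparr>" \<sigma>]
  by (simp add: inserted_def run_inv_def memory_def mates_def labels_def)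

context
  fixes c k :: nat and pu pv :: "nat \<Rightarrow> nat" and \<sigma> \<sigma>' :: state
  assumes aug: "augmentation_in \<sigma> c k pu pv"
    and mem: "memory (Suc c) c \<sigma>" and labels: "labels (Suc c) \<sigma>" and c: "c < n"
    and flipped: "flipped (Suc k) pu pv \<sigma> \<sigma>'"
begin

interpretation labelled_augmentation A "matching_in \<sigma>" "lab_in \<sigma>" "cur_in \<sigma>" c k pu pv
  using aug labels by (simp add: labelled_augmentation_def labels_def)

lemma matching_in_flipped: "matching_in \<sigma>' = augmented"
  using flipped by (simp add: flipped_def augmented_def partner_upd_prefix del: upd_prefix.simps)

lemma lab_flipped: "lab_in \<sigma>' = raised"
  using flipped by (simp add: flipped_def raised_def del: upd_prefix.simps)

lemma cur_flipped: "cur_in \<sigma>' = (\<lambda>u. if raised u = lab_in \<sigma> u then cur_in \<sigma> u else 0)"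
  using flipped lab_flipped by (simp add: flipped_def del: upd_prefix.simps)

lemma lab_le_lab_flipped: "lab_in \<sigma> \<le> lab_in \<sigma>'"
  using lab_le_raised by (simp add: le_fun_def lab_flipped)

lemma scan_pot_of_flipped:
  assumes "regs \<sigma>' ''cap'' = regs \<sigma> ''cap''"
  shows "scan_pot_of (Suc c) \<sigma> \<le> scan_pot_of (Suc c) \<sigma>'"
  unfolding scan_pot_of_def assms
  using lab_le_lab_flipped
  by (intro scan_pot_mono scans_mono) (auto simp: le_fun_def lab_flipped cur_flipped)

lemma mates_flipped: "mates \<sigma>'"
proof -
  have "partner (mate_in \<sigma>) v = Some u \<longleftrightarrow> matching_in \<sigma> u = Some v" for u v
    using mem by (simp add: memory_def mates_def)
  note inverse = augmented_inverse[of "partner (mate_in \<sigma>)", OF this]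
  have "partner (mate_in \<sigma>') = upd_prefix (partner (mate_in \<sigma>)) pv (\<lambda>j. Some (pu j)) (Suc k)"
    using flipped by (simp add: flipped_def partner_upd_prefix del: upd_prefix.simps)
  then have "partner (mate_in \<sigma>') v = Some u \<longleftrightarrow> matching_in \<sigma>' u = Some v" for u v
    using inverse matching_in_flipped by simp
  then show ?thesis by (simp add: mates_def)
qed

lemma labels_flipped: "labels (Suc c) \<sigma>'"
proof -
  have "raised u = 0" if "Suc c \<le> u" for u
  proof -
    have "u \<notin> pu ` {..k}" using that pu_in_insert_dom card_matched_le(2)[OF mem c] by fastforce
    then show ?thesis using labels that by (simp add: raised_off_path labels_def)
  qed
  then show ?thesis
    using labelled_matching_augmented
    by (simp add: labels_def matching_in_flipped lab_flipped cur_flipped)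
qed

lemma low_excess_flipped:
  assumes low: "low_excess (nbrs A) n (dom (matching_in \<sigma>)) B"
    and B: "B' = B \<or> B' = Suc B \<and> Suc B \<le> k"
  shows "low_excess (nbrs A) n (dom (matching_in \<sigma>')) B'"
  unfolding matching_in_flipped dom_augmented
proof (cases "B' = B")
  case True
  then show "low_excess (nbrs A) n (insert c (dom (matching_in \<sigma>))) B'"
    using low by (auto elim: low_excess_mono)
next
  case False
  with B have "B' = Suc B" "enat (Suc B) \<le> dist_in \<sigma> c"
    by (simp_all add: free_dist_start)
  then show "low_excess (nbrs A) n (insert c (dom (matching_in \<sigma>))) B'"
    using low_excess_Suc[OF low] card_matched_le[OF mem c] start_unmatched by simp
qed

lemma sap_step_flipped:
  "sap_step (client_edges {..c} (nbrs A)) (matching_edges (matching_in \<sigma>)) c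
     (matching_edges (matching_in \<sigma>'))"
proof -
  interpret client_augmentation "nbrs A" "matching_in \<sigma>" c k pu pv "{..c}"
    by unfold_locales (rule card_matched_le(2)[OF mem c])
  show ?thesis unfolding matching_in_flipped by (rule sap_step_augmented)
qed

lemma inserted_flipped:
  assumes frame: "frame flip_body \<sigma> \<sigma>'" and seen: "\<forall>x. seen_in \<sigma> x \<le> Suc c"
    and low: "low_excess (nbrs A) n (dom (matching_in \<sigma>)) B"
    and B: "regs \<sigma> ''cap'' = B \<or> regs \<sigma> ''cap'' = Suc B \<and> Suc B \<le> k"
  shows "inserted c \<sigma> (\<sigma>'\<lparr>regs := (regs \<sigma>')(''cnt'' := Suc c)\<rparr>)"
proof -
  have unchanged: "regs \<sigma>' ''servers'' = regs \<sigma> ''servers''" "regs \<sigma>' ''tot'' = regs \<sigma> ''tot''"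
    "regs \<sigma>' ''cap'' = regs \<sigma> ''cap''" "arrs \<sigma>' ''deg'' = arrs \<sigma> ''deg''"
    "arrs \<sigma>' ''start'' = arrs \<sigma> ''start''" "arrs \<sigma>' ''adj'' = arrs \<sigma> ''adj''"
    "seen_in \<sigma>' = seen_in \<sigma>"
    using frame by (simp_all add: frame_def)
  have "dom (matching_in \<sigma>') \<subseteq> {..c}"
    unfolding matching_in_flipped dom_augmented by (rule card_matched_le(2)[OF mem c])
  then have "u \<notin> dom (matching_in \<sigma>')" if "Suc c \<le> u" for u using that by fastforce
  then have "match_in \<sigma>' u = 0" if "Suc c \<le> u" for u using that by (simp add: domIff)
  then have "memory (Suc c) (Suc c) (\<sigma>'\<lparr>regs := (regs \<sigma>')(''cnt'' := Suc c)\<rparr>)"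
    using mem mates_flipped stored_cong[of "\<sigma>'\<lparr>regs := (regs \<sigma>')(''cnt'' := Suc c)\<rparr>" \<sigma> "Suc c"]
    by (simp add: memory_def mates_def unchanged)
  then show ?thesis
    using labels_flipped seen low_excess_flipped[OF low B] sap_step_flipped
    by (simp add: inserted_def run_inv_def labels_def unchanged)
qed

end

lemma augmentation_length_less:
  assumes "augmentation_in \<sigma> c k pu pv"
    and "memory (Suc c) c \<sigma>" and "c < n"
  shows "k < n"
proof -
  interpret shortest_augmentation "nbrs A" "matching_in \<sigma>" c k pu pv by fact
  have "card {..k} \<le> card {..c}"
    using inj_on_pu pu_in_insert_dom card_matched_le(2)[OF assms(2,3)]
    by (intro card_inj_on_le) auto
  with assms(3) show ?thesis by simp
qed

lemma wp_flip_path_unmatched: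
  assumes "regs \<sigma> ''found'' = 0" and "regs \<sigma> ''cnt'' = c" and "c < n"
  shows "wp w flip_path
    (\<lambda>t \<sigma>'. t \<le> 20 \<and> \<sigma>' = \<sigma>\<lparr>regs := (regs \<sigma>)(''k'' := 0, ''cnt'' := Suc c)\<rparr>) \<sigma>"
proof -
  let ?\<sigma>0 = "\<sigma>\<lparr>regs := (regs \<sigma>)(''k'' := 0)\<rparr>"
  have "Suc 0 < 2 ^ w" "Suc c < 2 ^ w" using assms(3) by (auto intro: less_word)
  moreover have "wp w (While flip_guard flip_body) (\<lambda>t \<sigma>'. t = 5 \<and> \<sigma>' = ?\<sigma>0) ?\<sigma>0"
    using assms(1) by (intro wp_WhileFalse) (simp_all add: flip_guard_def)
  ultimately show ?thesis
    unfolding flip_path_def using assms(2)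
    by (intro vc_wp) (auto elim!: wp_mono)
qed

lemma wp_flip_path_matched:
  assumes aug: "augmentation_in \<sigma> c k (\<lambda>j. (par_in \<sigma> ^^ j) (regs \<sigma> ''u'')) pv"
    and mem: "memory (Suc c) c \<sigma>" and labels: "labels (Suc c) \<sigma>" and c: "c < n"
    and found: "regs \<sigma> ''found'' = Suc (pv 0)"
    and seen: "\<forall>x. seen_in \<sigma> x \<le> Suc c"
    and low: "low_excess (nbrs A) n (dom (matching_in \<sigma>)) B"
    and B: "regs \<sigma> ''cap'' = B \<or> regs \<sigma> ''cap'' = Suc B \<and> Suc B \<le> k"
  shows "wp w flip_path (\<lambda>t \<sigma>'. flip_post c \<sigma> \<sigma>' \<and> t \<le> 80 * Suc k + 11) \<sigma>"
proof -
  let ?pu = "\<lambda>j. (par_in \<sigma> ^^ j) (regs \<sigma> ''u'')"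
  let ?\<sigma>0 = "\<sigma>\<lparr>regs := (regs \<sigma>)(''k'' := 0)\<rparr>"
  interpret labelled_augmentation A "matching_in \<sigma>" "lab_in \<sigma>" "cur_in \<sigma>" c k ?pu pv
    using aug labels by (simp add: labelled_augmentation_def labels_def)
  have "k < n" by (rule augmentation_length_less[OF aug mem c])
  show ?thesis
    unfolding flip_path_def
  proof (rule wp_Seq[where Q' = "\<lambda>t \<sigma>'. t = 2 \<and> \<sigma>' = ?\<sigma>0"])
    show "wp w (Assign ''k'' (Const 0)) (\<lambda>t \<sigma>'. t = 2 \<and> \<sigma>' = ?\<sigma>0) \<sigma>"
      by (rule vc_wp) simp
    fix t1 :: nat and \<sigma>1 assume \<sigma>1: "t1 = 2 \<and> \<sigma>1 = ?\<sigma>0"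
    have "memory (Suc c) c ?\<sigma>0"
      using mem stored_cong[of ?\<sigma>0 \<sigma>] by (simp add: memory_def mates_def)
    then have flip: "wp w (While flip_guard flip_body)
        (\<lambda>t \<sigma>'. flipped (Suc k) ?pu pv ?\<sigma>0 \<sigma>' \<and> t \<le> 80 * Suc k + 5) ?\<sigma>0"
      using labelled_augmentation_axioms c \<open>k < n\<close> found by (intro wp_flip) simp_all
    show "wp w (Seq (While flip_guard flip_body) (incr ''cnt''))
        (\<lambda>t \<sigma>'. flip_post c \<sigma> \<sigma>' \<and> t1 + t \<le> 80 * Suc k + 11) \<sigma>1"
      unfolding conjunct2[OF \<sigma>1]
    proof (rule wp_Seq[OF flip])
      fix t2 :: nat and \<sigma>2
      assume post: "flipped (Suc k) ?pu pv ?\<sigma>0 \<sigma>2 \<and> t2 \<le> 80 * Suc k + 5"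
        and frame2: "frame (While flip_guard flip_body) ?\<sigma>0 \<sigma>2"
      have flipped: "flipped (Suc k) ?pu pv \<sigma> \<sigma>2"
        using post by (simp add: flipped_def del: upd_prefix.simps cong: if_cong)
      have frame: "frame flip_body \<sigma> \<sigma>2" using frame2 by (simp add: frame_def)
      then have regs: "regs \<sigma>2 ''cap'' = regs \<sigma> ''cap''" "regs \<sigma>2 ''cnt'' = c"
        using mem by (simp_all add: frame_def memory_def)
      have "flip_post c \<sigma> (\<sigma>2\<lparr>regs := (regs \<sigma>2)(''cnt'' := Suc c)\<rparr>)"
        using inserted_flipped[OF aug mem labels c flipped frame seen low B]
          scan_pot_of_flipped[OF aug mem labels c flipped regs(1)]
          lab_le_lab_flipped[OF aug mem labels c flipped]
        by (simp add: flip_post_def scan_pot_of_def)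
      then show "wp w (incr ''cnt'')
          (\<lambda>t \<sigma>'. flip_post c \<sigma> \<sigma>' \<and> t1 + (t2 + t) \<le> 80 * Suc k + 11) \<sigma>2"
        using post \<sigma>1 regs(2) less_word[of 1] less_word[of "Suc c"] c by (intro vc_wp) simp
    qed
  qed
qed

lemma wp_flip_path:
  assumes mem: "memory (Suc c) c \<sigma>" and c: "c < n" and search: "search_done c B \<sigma>"
    and low: "low_excess (nbrs A) n (dom (matching_in \<sigma>)) B"
  shows "wp w flip_path (\<lambda>t \<sigma>'. flip_post c \<sigma> \<sigma>' \<and>
    t + 80 * bfs_credit B \<le> 80 * bfs_credit (regs \<sigma> ''cap'') + 80 * (B + 3)) \<sigma>"
proof -
  have labels: "labels (Suc c) \<sigma>" and seen: "\<forall>x. seen_in \<sigma> x \<le> Suc c"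
    using search unfolding search_done_def by blast+
  consider (failed) "search_failed c B \<sigma>" | (found) k pv where "search_found c B k pv \<sigma>"
    using search unfolding search_done_def by blast
  then show ?thesis
  proof cases
    case failed
    then have none: "regs \<sigma> ''found'' = 0" "regs \<sigma> ''cap'' = B" "dist_in \<sigma> c = \<infinity>"
      unfolding search_failed_def by blast+
    have "inserted c \<sigma> (\<sigma>\<lparr>regs := (regs \<sigma>)(''k'' := 0, ''cnt'' := Suc c)\<rparr>)"
      using low none by (intro inserted_unmatched[OF mem labels seen]) simp_all
    then show ?thesis
      using none(1,2) mem c
      by (intro wp_mono[OF wp_flip_path_unmatched])
        (auto simp: memory_def scan_pot_of_def flip_post_def)
  next
    case found
    then have path: "regs \<sigma> ''found'' = Suc (pv 0)"
      "augmentation_in \<sigma> c k (\<lambda>j. (par_in \<sigma> ^^ j) (regs \<sigma> ''u'')) pv"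
      "regs \<sigma> ''cap'' = B \<and> k \<le> Suc B \<or> regs \<sigma> ''cap'' = Suc B \<and> Suc B \<le> k"
      unfolding search_found_def by blast+
    have "k < n" by (rule augmentation_length_less[OF path(2) mem c])
    with path(3) have "80 * Suc k + 11 + 80 * bfs_credit B \<le>
        80 * bfs_credit (regs \<sigma> ''cap'') + 80 * (B + 3)"
      by (auto simp: bfs_credit_def)
    then show ?thesis
      using path(3)
      by (intro wp_mono[OF wp_flip_path_matched[OF path(2) mem labels c path(1) seen low]]) auto
  qed
qed

definition run_pot :: "nat \<Rightarrow> state \<Rightarrow> nat" where
  "run_pot N \<sigma> =
     2 * scan_pot_of N \<sigma> + 2 * dead_weight N \<sigma> + 2 * bfs_credit (regs \<sigma> ''cap'')"

definition insertion :: "nat \<Rightarrow> state \<Rightarrow> nat \<Rightarrow> state \<Rightarrow> bool" where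
  "insertion c \<sigma> t \<sigma>' \<longleftrightarrow> inserted c \<sigma> \<sigma>' \<and> regs \<sigma> ''cap'' \<le> regs \<sigma>' ''cap'' \<and>
     t + 80 * run_pot c \<sigma> \<le> 80 * (run_pot (Suc c) \<sigma>' + length (A c) + 2 * regs \<sigma> ''cap'' + 7)"

lemma scan_pot_of_mono:
  assumes "labels N \<sigma>" and "N \<le> N'" and "regs \<sigma> ''cap'' \<le> regs \<sigma>' ''cap''"
    and "lab_in \<sigma> \<le> lab_in \<sigma>'" and "cur_in \<sigma>' = cur_in \<sigma>"
  shows "scan_pot_of N \<sigma> \<le> scan_pot_of N' \<sigma>'"
proof -
  interpret labelled_matching A "matching_in \<sigma>" "lab_in \<sigma>" "cur_in \<sigma>"
    using assms(1) unfolding labels_def by blast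
  show ?thesis
    unfolding scan_pot_of_def
    using assms by (intro scan_pot_mono scans_mono) (auto simp: le_fun_def)
qed

lemma wp_augment_after_dfs:
  assumes mem: "memory (Suc c) c \<sigma>" and c: "c < n" and dfs: "dfs_inv c k \<sigma>" "\<not> bval dfs_guard \<sigma>"
    and seen: "\<forall>x. seen_in \<sigma> x \<le> c"
    and low: "low_excess (nbrs A) n (dom (matching_in \<sigma>)) (regs \<sigma> ''cap'')"
  shows "wp w (Seq search_rest flip_path) (\<lambda>t \<sigma>'. inserted c \<sigma> \<sigma>' \<and>
    regs \<sigma> ''cap'' \<le> regs \<sigma>' ''cap'' \<and>
    t + 80 * run_pot (Suc c) \<sigma> \<le> 80 * (run_pot (Suc c) \<sigma>' + regs \<sigma> ''cap'' + 4)) \<sigma>"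
proof (rule wp_Seq[OF wp_search_rest[OF mem dfs c seen]])
  fix t1 and \<sigma>1 assume post: "search_post c \<sigma> t1 \<sigma>1" and frame: "frame search_rest \<sigma> \<sigma>1"
  have mem1: "memory (Suc c) c \<sigma>1" by (rule memory_frame[OF mem frame]) simp_all
  have same: "match_in \<sigma>1 = match_in \<sigma>" "cur_in \<sigma>1 = cur_in \<sigma>"
    using frame by (simp_all add: frame_def)
  have search: "search_done c (regs \<sigma> ''cap'') \<sigma>1" using post by (simp add: search_post_def)
  then have cap: "regs \<sigma> ''cap'' \<le> regs \<sigma>1 ''cap''"
    by (auto simp: search_done_def search_failed_def search_found_def)
  have scan: "scan_pot_of (Suc c) \<sigma> \<le> scan_pot_of (Suc c) \<sigma>1"
    using post cap same
    by (intro scan_pot_of_mono[OF dfs_inv_labels[OF dfs(1)]]) (simp_all add: search_post_def)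
  have "wp w flip_path (\<lambda>t \<sigma>'. flip_post c \<sigma>1 \<sigma>' \<and>
    t + 80 * bfs_credit (regs \<sigma> ''cap'') \<le>
      80 * bfs_credit (regs \<sigma>1 ''cap'') + 80 * (regs \<sigma> ''cap'' + 3)) \<sigma>1"
    using low same by (intro wp_flip_path[OF mem1 c search]) simp
  from wp_frame[OF this]
  show "wp w flip_path (\<lambda>t \<sigma>'. inserted c \<sigma> \<sigma>' \<and> regs \<sigma> ''cap'' \<le> regs \<sigma>' ''cap'' \<and>
    t1 + t + 80 * run_pot (Suc c) \<sigma> \<le> 80 * (run_pot (Suc c) \<sigma>' + regs \<sigma> ''cap'' + 4)) \<sigma>1"
  proof (rule wp_mono)
    fix t2 \<sigma>2 assume flip: "(flip_post c \<sigma>1 \<sigma>2 \<and>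
      t2 + 80 * bfs_credit (regs \<sigma> ''cap'') \<le>
        80 * bfs_credit (regs \<sigma>1 ''cap'') + 80 * (regs \<sigma> ''cap'' + 3)) \<and> frame flip_path \<sigma>1 \<sigma>2"
    then have cap2: "regs \<sigma>2 ''cap'' = regs \<sigma>1 ''cap''" by (simp add: frame_def)
    have "dead_weight (Suc c) \<sigma>1 \<le> dead_weight (Suc c) \<sigma>2"
      using flip by (intro dead_weight_mono) (simp_all add: flip_post_def)
    then have "t1 + t2 + 80 * run_pot (Suc c) \<sigma> \<le> 80 * (run_pot (Suc c) \<sigma>2 + regs \<sigma> ''cap'' + 4)"
      using post flip scan by (simp add: run_pot_def search_post_def flip_post_def cap2)
    then show "inserted c \<sigma> \<sigma>2 \<and> regs \<sigma> ''cap'' \<le> regs \<sigma>2 ''cap'' \<and>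
      t1 + t2 + 80 * run_pot (Suc c) \<sigma> \<le> 80 * (run_pot (Suc c) \<sigma>2 + regs \<sigma> ''cap'' + 4)"
      using flip cap cap2 same by (simp add: flip_post_def inserted_def)
  qed
qed

lemma wp_sap_program:
  assumes inv: "run_inv c \<sigma>" and c: "c < n"
  shows "wp w sap_program (insertion c \<sigma>) (arrival (A c) \<sigma>)"
  unfolding sap_program_def
proof (rule wp_Seq[OF wp_record_client[OF inv c]])
  fix t1 \<sigma>1
  assume rec: "memory (Suc c) c \<sigma>1 \<and> dfs_inv c 0 \<sigma>1 \<and> regs \<sigma>1 ''found'' = 0 \<and>
      t1 \<le> 80 * length (A c) + 44"
    and frame: "frame record_client (arrival (A c) \<sigma>) \<sigma>1"
  then have mem1: "memory (Suc c) c \<sigma>1" by blast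
  show "wp w (Seq (While dfs_guard dfs_body) (Seq search_rest flip_path))
      (\<lambda>t. insertion c \<sigma> (t1 + t)) \<sigma>1"
  proof (rule wp_Seq[OF wp_dfs[OF mem1 _ c]])
    show "dfs_inv c 0 \<sigma>1" "regs \<sigma>1 ''found'' = 0" using rec by blast+
    fix t2 \<sigma>2 assume dfs: "dfs_post c \<sigma>1 t2 \<sigma>2" and frame2: "frame (While dfs_guard dfs_body) \<sigma>1 \<sigma>2"
    have mem2: "memory (Suc c) c \<sigma>2" by (rule memory_frame[OF mem1 frame2]) simp_all
    obtain k where inv2: "dfs_inv c k \<sigma>2" and guard2: "\<not> bval dfs_guard \<sigma>2"
      using dfs unfolding dfs_post_def by blast
    have same: "lab_in \<sigma>1 = lab_in \<sigma>" "cur_in \<sigma>1 = cur_in \<sigma>"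
      "regs \<sigma>1 ''cap'' = regs \<sigma> ''cap''" "regs \<sigma>2 ''cap'' = regs \<sigma> ''cap''"
      "match_in \<sigma>2 = match_in \<sigma>" "seen_in \<sigma>2 = seen_in \<sigma>"
      using frame frame2 by (simp_all add: frame_def arrival_def)
    have "labels c \<sigma>" using inv by (simp add: run_inv_def)
    then have "scan_pot_of c \<sigma> \<le> scan_pot_of (Suc c) \<sigma>1"
      by (rule scan_pot_of_mono) (simp_all add: same)
    moreover have "dead_weight c \<sigma> \<le> dead_weight (Suc c) \<sigma>2"
      using dfs by (intro dead_weight_mono) (simp_all add: dfs_post_def same)
    ultimately have pot:
      "t2 + 80 * run_pot c \<sigma> \<le> 80 * (run_pot (Suc c) \<sigma>2 + regs \<sigma> ''cap'' + 2) + 20"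
      using dfs by (simp add: run_pot_def dfs_post_def same)
    show "wp w (Seq search_rest flip_path) (\<lambda>t. insertion c \<sigma> (t1 + (t2 + t))) \<sigma>2"
    proof (rule wp_mono[OF wp_augment_after_dfs[OF mem2 c inv2 guard2]])
      show "\<forall>x. seen_in \<sigma>2 x \<le> c"
        "low_excess (nbrs A) n (dom (matching_in \<sigma>2)) (regs \<sigma>2 ''cap'')"
        using inv by (simp_all add: run_inv_def same)
      show "insertion c \<sigma> (t1 + (t2 + t)) \<sigma>'"
        if "inserted c \<sigma>2 \<sigma>' \<and> regs \<sigma>2 ''cap'' \<le> regs \<sigma>' ''cap'' \<and>
          t + 80 * run_pot (Suc c) \<sigma>2 \<le> 80 * (run_pot (Suc c) \<sigma>' + regs \<sigma>2 ''cap'' + 4)" for t \<sigma>'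
        using that rec pot by (simp add: insertion_def inserted_def same)
    qed
  qed
qed

section \<open>The whole run\<close>

lemma run_inv_initial: "run_inv 0 (initial_state s)"
proof -
  have "labelled_matching A (matching_in (initial_state s)) (\<lambda>_. 0) (\<lambda>_. 0)"
    by unfold_locales (simp_all add: initial_state_def flip: zero_enat_def)
  then show ?thesis

    by (simp add: run_inv_def memory_def stored_def mates_def labels_def initial_state_def
        low_excess_0)
qed

lemma fits_word_initial: "fits_word w (initial_state s)"
  using word unfolding fits_word_def initial_state_def by simp

lemma fits_word_arrival:
  assumes i: "i < n" and fits: "fits_word w \<sigma>"
  shows "fits_word w (arrival (A i) \<sigma>)"
proof -
  have "length (A i) < 2 ^ w" using length_le[OF i] by (intro less_word) simp
  moreover have "A i ! k < 2 ^ w" if "k < length (A i)" for k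
    using servers[OF i] nth_mem[OF that] by (intro less_word) auto
  ultimately show ?thesis using fits unfolding fits_word_def arrival_def by auto
qed

lemma ex_sap_run:
  "\<exists>\<sigma> \<tau>. \<sigma> 0 = initial_state s \<and> (\<forall>i\<le>n. run_inv i (\<sigma> i)) \<and>
     (\<forall>i<n. exec w sap_program (arrival (A i) (\<sigma> i)) (\<tau> i) (\<sigma> (Suc i)) \<and>
        insertion i (\<sigma> i) (\<tau> i) (\<sigma> (Suc i)))"
proof -
  define P where "P i \<sigma> \<longleftrightarrow> (i \<le> n \<longrightarrow> run_inv i \<sigma> \<and> fits_word w \<sigma>) \<and> (i = 0 \<longrightarrow> \<sigma> = initial_state s)"
    for i \<sigma>
  define step where "step i \<sigma> t \<sigma>' \<longleftrightarrow>
    exec w sap_program (arrival (A i) \<sigma>) t \<sigma>' \<and> insertion i \<sigma> t \<sigma>'" for i \<sigma> t \<sigma>'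
  have "\<exists>\<sigma>'. P (Suc i) \<sigma>' \<and> (i < n \<longrightarrow> (\<exists>t. step i \<sigma> t \<sigma>'))" if "P i \<sigma>" for i \<sigma>
  proof (cases "i < n")
    case True
    then have inv: "run_inv i \<sigma>" and fits: "fits_word w (arrival (A i) \<sigma>)"
      using that fits_word_arrival by (auto simp: P_def)
    then obtain t \<sigma>' where "step i \<sigma> t \<sigma>'"
      using wp_sap_program[OF inv True] unfolding wp_def step_def by blast
    moreover from this have "P (Suc i) \<sigma>'"
      using exec_fits_word fits by (auto simp: P_def step_def insertion_def inserted_def)
    ultimately show ?thesis by blast
  qed (auto simp: P_def)
  moreover have "P 0 (initial_state s)" by (simp add: P_def run_inv_initial fits_word_initial)
  ultimately obtain \<sigma> where \<sigma>: "\<And>i. P i (\<sigma> i)" "\<And>i. i < n \<longrightarrow> (\<exists>t. step i (\<sigma> i) t (\<sigma> (Suc i)))"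
    using dependent_nat_choice[of P "\<lambda>i \<sigma> \<sigma>'. i < n \<longrightarrow> (\<exists>t. step i \<sigma> t \<sigma>')"] by blast
  then obtain \<tau> where "\<And>i. i < n \<Longrightarrow> step i (\<sigma> i) (\<tau> i) (\<sigma> (Suc i))" by metis
  with \<sigma>(1) show ?thesis
    by (intro exI[of _ \<sigma>] exI[of _ \<tau>]) (auto simp: P_def step_def)
qed

lemma sum_insertion_time_le:
  assumes "\<And>j. j < i \<Longrightarrow> insertion j (\<sigma> j) (\<tau> j) (\<sigma> (Suc j))"
  shows "(\<Sum>j<i. \<tau> j) \<le>
    80 * (run_pot i (\<sigma> i) + (\<Sum>j<i. length (A j)) + i * (2 * regs (\<sigma> i) ''cap'' + 7))"
  using assms
proof (induction i)
  case (Suc i)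
  then have step: "insertion i (\<sigma> i) (\<tau> i) (\<sigma> (Suc i))" by simp
  then have cap: "regs (\<sigma> i) ''cap'' \<le> regs (\<sigma> (Suc i)) ''cap''"
    and time: "\<tau> i + 80 * run_pot i (\<sigma> i) \<le>
      80 * (run_pot (Suc i) (\<sigma> (Suc i)) + length (A i) + 2 * regs (\<sigma> i) ''cap'' + 7)"
    by (simp_all add: insertion_def)
  have "(\<Sum>j<i. \<tau> j) \<le>
      80 * (run_pot i (\<sigma> i) + (\<Sum>j<i. length (A j)) + i * (2 * regs (\<sigma> i) ''cap'' + 7))"
    using Suc by simp
  also have "\<dots> \<le>
      80 * (run_pot i (\<sigma> i) + (\<Sum>j<i. length (A j)) + i * (2 * regs (\<sigma> (Suc i)) ''cap'' + 7))"
    using cap by (intro mult_le_mono2 add_left_mono) simp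
  finally show ?case using cap time by simp
qed simp

lemma run_pot_le:
  assumes "n \<le> m" and "0 < m" and "regs \<sigma> ''cap'' < K"
  shows "run_pot n \<sigma> + m + n * (2 * regs \<sigma> ''cap'' + 7) \<le> 22 * (K * m)"
proof -
  have "m \<le> K * m" using assms(3) by simp
  have "scan_pot_of n \<sigma> \<le> Suc (regs \<sigma> ''cap'') * (m + n)" by (rule scan_pot_of_le) simp
  also have "\<dots> \<le> K * (2 * m)" using assms by (intro mult_le_mono) auto
  finally have "scan_pot_of n \<sigma> \<le> 2 * (K * m)" by simp
  moreover have "dead_weight n \<sigma> \<le> m + n"
    unfolding dead_weight_def by (rule weight_le) auto
  moreover have "bfs_credit (regs \<sigma> ''cap'') \<le> (3 * m) * K"
    unfolding bfs_credit_def using assms by (intro mult_le_mono) auto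
  then have "bfs_credit (regs \<sigma> ''cap'') \<le> 3 * (K * m)" by (simp add: mult_ac)
  moreover have "n * (2 * regs \<sigma> ''cap'' + 7) \<le> m * (7 * K)"
    using assms by (intro mult_le_mono) auto
  then have "n * (2 * regs \<sigma> ''cap'' + 7) \<le> 7 * (K * m)" by (simp add: mult_ac)
  ultimately show ?thesis using \<open>n \<le> m\<close> \<open>m \<le> K * m\<close> unfolding run_pot_def by linarith
qed

lemma matching_of_run_inv: "run_inv i \<sigma> \<Longrightarrow> matching_of i \<sigma> = matching_edges (matching_in \<sigma>)"
  by (rule matching_of_eq) (simp add: run_inv_def memory_def)

lemma sap_step_insertion:
  assumes "run_inv i \<sigma>" and "insertion i \<sigma> t \<sigma>'"
  shows "sap_step (client_edges {..i} (nbrs A)) (matching_of i \<sigma>) i (matching_of (Suc i) \<sigma>')"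
  using assms by (simp add: insertion_def inserted_def matching_of_run_inv)

lemma one_le_mult_ln:
  assumes "2 \<le> (x :: real)"
  shows "1 \<le> x * ln x"
proof -
  have "1 / 2 \<le> ln (2 :: real)" using half_le_ln_one_plus[of 1] by simp
  also have "\<dots> \<le> ln x" using assms by simp
  finally show ?thesis using mult_mono[of 2 x "1 / 2" "ln x"] assms by simp
qed

lemma total_time_le:
  assumes inv: "run_inv n \<sigma>" and n: "2 \<le> n" "n \<le> m"
    and T: "T \<le> 80 * (run_pot n \<sigma> + m + n * (2 * regs \<sigma> ''cap'' + 7))"
  shows "real T \<le> 7040 * (real m * sqrt (real n) * sqrt (ln (real n)))"
proof -
  let ?B = "regs \<sigma> ''cap''" and ?r = "sqrt (real n * ln (real n))"
  interpret labelled_matching A "matching_in \<sigma>" "lab_in \<sigma>" "cur_in \<sigma>"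
    using inv unfolding run_inv_def labels_def by blast
  have dom: "dom (matching_in \<sigma>) \<subseteq> {..<n}"
    using inv dom_matching_in[of n n \<sigma>] by (simp add: run_inv_def)
  have "real ?B \<le> 3 * ?r"
  proof (rule low_excess_le_sqrt)
    show "low_excess (nbrs A) n (dom (matching_in \<sigma>)) ?B" using inv by (simp add: run_inv_def)
    show "finite (dom (matching_in \<sigma>))" using dom finite_subset by blast
    show "card (dom (matching_in \<sigma>)) \<le> n" using card_mono[OF _ dom] by simp
  qed (use n in auto)
  moreover have "1 \<le> ?r" using one_le_mult_ln[of "real n"] n(1) by simp
  ultimately have K: "real (Suc ?B) \<le> 4 * ?r" unfolding of_nat_Suc by linarith
  have "T \<le> 1760 * (Suc ?B * m)" using T run_pot_le[of \<sigma> "Suc ?B"] n by simp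
  then have "real T \<le> real (1760 * (Suc ?B * m))" by (simp only: of_nat_le_iff)
  also have "\<dots> = 1760 * (real (Suc ?B) * real m)" by (simp only: of_nat_mult of_nat_numeral)
  also have "\<dots> \<le> 1760 * (4 * ?r * real m)" using K by (intro mult_left_mono mult_right_mono) auto
  also have "\<dots> = 7040 * (real m * sqrt (real n) * sqrt (ln (real n)))" by (simp add: real_sqrt_mult)
  finally show ?thesis .
qed

lemma ex_sap_run_within_time:
  "\<exists>\<sigma> \<tau>. \<sigma> 0 = initial_state s \<and>
     (\<forall>i<n. exec w sap_program (arrival (A i) (\<sigma> i)) (\<tau> i) (\<sigma> (Suc i))) \<and>
     (\<forall>i<n. sap_step (client_edges {..i} (nbrs A)) (matching_of i (\<sigma> i)) i
       (matching_of (Suc i) (\<sigma> (Suc i)))) \<and>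
     (2 \<le> n \<longrightarrow> n \<le> m \<longrightarrow>
       real (\<Sum>i<n. \<tau> i) \<le> 7040 * (real m * sqrt (real n) * sqrt (ln (real n))))"
proof -
  obtain \<sigma> \<tau> where \<sigma>: "\<sigma> 0 = initial_state s" and inv: "\<And>i. i \<le> n \<Longrightarrow> run_inv i (\<sigma> i)"
    and exec: "\<And>i. i < n \<Longrightarrow> exec w sap_program (arrival (A i) (\<sigma> i)) (\<tau> i) (\<sigma> (Suc i))"
    and insertion: "\<And>i. i < n \<Longrightarrow> insertion i (\<sigma> i) (\<tau> i) (\<sigma> (Suc i))"
    using ex_sap_run by blast
  have "real (\<Sum>i<n. \<tau> i) \<le> 7040 * (real m * sqrt (real n) * sqrt (ln (real n)))"
    if "2 \<le> n" "n \<le> m"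
    using that inv insertion sum_insertion_time_le[of n \<sigma> \<tau>] edges
    by (intro total_time_le[of "\<sigma> n"]) auto
  moreover have "sap_step (client_edges {..i} (nbrs A)) (matching_of i (\<sigma> i)) i
      (matching_of (Suc i) (\<sigma> (Suc i)))" if "i < n" for i
    using that inv insertion by (intro sap_step_insertion) auto
  ultimately show ?thesis using \<sigma> exec by blast
qed

end

theorem theorem2:
  shows "\<exists>(P :: com) (C :: real) (D :: nat).
    \<forall>(s :: nat) (Ns :: nat list list) (w :: nat) (n :: nat) (m :: nat).
      online_instance s Ns \<longrightarrow> n = length Ns \<longrightarrow> m = card (graph_of Ns) \<longrightarrow>
      (s + n + m + 2) ^ D \<le> 2 ^ w \<longrightarrow>
      (\<exists>\<sigma> \<tau>. online_run w P s Ns \<sigma> \<tau> \<and> follows_sap Ns \<sigma> \<and>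
        (2 \<le> n \<longrightarrow> n \<le> m \<longrightarrow>
          real (\<Sum>i<n. \<tau> i) \<le> C * (real m * sqrt (real n) * sqrt (ln (real n)))))"
proof (intro exI[of _ sap_program] exI[of _ "7040 :: real"] exI[of _ "1 :: nat"] allI impI)
  fix s Ns w n m
  assume inst: "online_instance s Ns" and n: "n = length Ns" and m: "m = card (graph_of Ns)"
    and word: "(s + n + m + 2) ^ 1 \<le> (2 :: nat) ^ w"
  interpret sap_run "(!) Ns" s n m w
    using inst n m word card_graph_of[OF inst] by unfold_locales (auto simp: online_instance_def)
  show "\<exists>\<sigma> \<tau>. online_run w sap_program s Ns \<sigma> \<tau> \<and> follows_sap Ns \<sigma> \<and>
        (2 \<le> n \<longrightarrow> n \<le> m \<longrightarrow>
          real (\<Sum>i<n. \<tau> i) \<le> 7040 * (real m * sqrt (real n) * sqrt (ln (real n))))"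
    using ex_sap_run_within_time unfolding n online_run_def follows_sap_def
    by (simp add: graph_of_take)
qed

end
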